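(* Let $r>0$ be real and $q=e^{-\pi\sqrt r}$. Then $$\pi\int_{\sqrt r}^{+\infty}\eta(it/2)^4\,dt=3\sqrt[3]{2k_r}\cdot{}_2F_1\!\left[\tfrac13,\tfrac16;\tfrac76;k_r^2\right]=5\int_0^{R(q)}\frac{dx}{x\sqrt[6]{x^{-5}-11-x^5}}.$$
   Context: $\eta(\tau)=e^{\pi i\tau/12}\prod_{n=1}^\infty(1-e^{2\pi i n\tau})$ ($\operatorname{Im}\tau>0$) is the Dedekind eta function. For $0\le q<1$, $R(q)$ is the Rogers–Ramanujan continued fraction $R(q)=\cfrac{q^{1/5}}{1+\cfrac{q}{1+\cfrac{q^2}{1+\cdots}}}$ (nonnegative real fifth root). For $r>0$, $k_r\in(0,1)$ is the elliptic singular modulus: the unique $k\in(0,1)$ with $K(\sqrt{1-k^2})/K(k)=\sqrt r$, where $K(k)=\int_0^{\pi/2}\frac{d\theta}{\sqrt{1-k^2\sin^2\theta}}$. ${}_2F_1[a,b;c;z]=\sum_{n\ge0}\frac{(a)_n(b)_n}{(c)_n}\frac{z^n}{n!}$ is the Gauss hypergeometric function. *)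

theory Defs
  imports "HOL-Analysis.Analysis"
begin

definition dedekind_eta :: "complex \<Rightarrow> complex" where
  "dedekind_eta \<tau> = exp (of_real pi * \<i> * \<tau> / 12) *
     (\<Prod>n. 1 - exp (2 * of_real pi * \<i> * of_nat (Suc n) * \<tau>))"

text \<open>
  \<open>rr_tail q m n\<close> is the finite continued fraction
  \<open>q^m / (1 + q^(m+1) / (1 + ... + q^(m+n-1) / 1))\<close> with \<open>n\<close> levels.
\<close>
primrec rr_tail :: "real \<Rightarrow> nat \<Rightarrow> nat \<Rightarrow> real" where
  "rr_tail q m 0 = 0"
| "rr_tail q m (Suc n) = q ^ m / (1 + rr_tail q (Suc m) n)"

text \<open>
  Meaningful for \<open>0 \<le> q < 1\<close>. The value is the limit of the convergents;
  \<open>root 5 q\<close> is the nonnegative fifth root.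
\<close>
definition rogers_ramanujan :: "real \<Rightarrow> real" where
  "rogers_ramanujan q = lim (\<lambda>n. root 5 q / (1 + rr_tail q 1 n))"

text \<open>The argument is the modulus \<open>k\<close>, not the parameter \<open>m = k\<^sup>2\<close>.\<close>
definition elliptic_K :: "real \<Rightarrow> real" where
  "elliptic_K k = (LBINT \<theta>=0..ereal (pi / 2). 1 / sqrt (1 - k\<^sup>2 * (sin \<theta>)\<^sup>2))"

definition singular_modulus :: "real \<Rightarrow> real" where
  "singular_modulus r =
     (THE k. k \<in> {0<..<1} \<and> elliptic_K (sqrt (1 - k\<^sup>2)) / elliptic_K k = sqrt r)"

definition hypergeometric_2F1 :: "real \<Rightarrow> real \<Rightarrow> real \<Rightarrow> real \<Rightarrow> real" where
  "hypergeometric_2F1 a b c z =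
     (\<Sum>n. pochhammer a n * pochhammer b n / pochhammer c n * (z ^ n / fact n))"

end

theory Submission
  imports Defs
begin

text \<open>
  As functions of \<open>q\<close>, all three expressions have derivative \<open>q powr (1/6) * E(q) ^ 4 / q\<close>, where
  \<open>E(q) = (\<Prod>n. 1 - q ^ (n + 1))\<close>, and vanish at \<open>0\<close>. For the eta integral this is the definition. For the
  hypergeometric side, the modulus is \<open>k = \<theta>\<^sub>2\<^sup>2 / \<theta>\<^sub>3\<^sup>2\<close> at nome \<open>q\<close>: Landen's transformation evaluates both
  complete elliptic integrals at \<open>k\<close>, and \<open>q * dk/dq = k \<theta>\<^sub>4\<^sup>4 / 2\<close>. For the last integral, the continued
  fraction is \<open>R = q powr (1/5) * a / b\<close> with two theta series \<open>a\<close>, \<open>b\<close> (Schur's proof of the Rogers-Ramanujan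
  identities), and Ramanujan's identities \<open>1 / R ^ 5 - 11 - R ^ 5 = E(q) ^ 6 / (q * E(q ^ 5) ^ 6)\<close> and
  \<open>q R' / R = E(q) ^ 5 / (5 E(q ^ 5))\<close> follow from rearrangements of double theta series.
\<close>

section \<open>Gaussian binomial coefficients\<close>

text \<open>The shared derivative comes from eta(it/2)^4 = q^(1/6) E(q)^4 at q = e^(-pi t). On the
  Rogers-Ramanujan side the sixth root of 1/R^5 - 11 - R^5 is E(q) / (q^(1/6) E(q^5)); it cancels
  the E(q^5) in R'/R and leaves one fifth of the shared derivative, hence the factor 5. On the
  hypergeometric side the series is the binomial series of (1 - k^2)^(-1/3) integrated termwise, and
  cubing its q-derivative gives a monomial in theta constants in which all Euler products except
  E(q)^12 cancel. The obstacle is to fix constants, in q k'/k and in K(k')/K(k), without the modular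
  inversion of theta functions. Each is found from a relation between q and q^2, iterated along
  q^(2^n) -> 0, and a limit at 0. The infinite products live in a general complete normed field
  because the identity with 11 multiplies E over the five complex numbers zeta^j q^(1/5), whereas
  nearly everything else is real.\<close>

definition qpoch :: "'a::real_normed_field \<Rightarrow> 'a \<Rightarrow> nat \<Rightarrow> 'a" where
  "qpoch z q n = (\<Prod>i<n. 1 - z * q ^ i)"

definition qpoch_inf :: "'a::real_normed_field \<Rightarrow> 'a \<Rightarrow> 'a" where
  "qpoch_inf z q = (\<Prod>i. 1 - z * q ^ i)"

abbreviation euler :: "'a::real_normed_field \<Rightarrow> 'a" where
  "euler q \<equiv> qpoch_inf q q"

lemma qpoch_0 [simp]: "qpoch z q 0 = 1"
  by (simp add: qpoch_def)

lemma qpoch_Suc: "qpoch z q (Suc n) = qpoch z q n * (1 - z * q ^ n)"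
  by (simp add: qpoch_def)

lemma convergent_prod_qpoch:
  fixes q :: "'a::{real_normed_field,banach}"
  assumes "norm q < 1"
  shows "convergent_prod (\<lambda>i. 1 - z * q ^ i)"
proof -
  have "summable (\<lambda>i. norm z * norm q ^ i)"
    using assms by (intro summable_mult summable_geometric) auto
  then show ?thesis
    by (intro abs_convergent_prod_imp_convergent_prod summable_imp_abs_convergent_prod)
       (simp add: norm_mult norm_power)
qed

lemma qpoch_tendsto:
  fixes q :: "'a::{real_normed_field,banach}"
  assumes "norm q < 1"
  shows "qpoch z q \<longlonglongrightarrow> qpoch_inf z q"
proof -
  have "(\<lambda>n. \<Prod>i\<le>n. 1 - z * q ^ i) \<longlonglongrightarrow> qpoch_inf z q"
    unfolding qpoch_inf_def by (intro convergent_prod_LIMSEQ convergent_prod_qpoch assms)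
  then have "(\<lambda>n. qpoch z q (Suc n)) \<longlonglongrightarrow> qpoch_inf z q"
    unfolding qpoch_def lessThan_Suc_atMost .
  then show ?thesis
    by (simp only: filterlim_sequentially_Suc)
qed

lemma one_minus_power_nonzero:
  fixes q :: "'a::real_normed_field"
  assumes "norm q < 1" "n > 0"
  shows "1 - q ^ n \<noteq> 0"
proof
  assume "1 - q ^ n = 0"
  then have "norm q ^ n = 1"
    by (metis eq_iff_diff_eq_0 norm_one norm_power)
  moreover have "norm q ^ n < 1"
    using assms by (intro power_less_one_iff[THEN iffD2]) auto
  ultimately show False by simp
qed

lemma qpoch_nonzero:
  fixes q :: "'a::real_normed_field"
  assumes "norm q < 1"
  shows "qpoch q q n \<noteq> 0"
  using one_minus_power_nonzero[OF assms, of "Suc _"] by (simp add: qpoch_def)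

lemma euler_nonzero:
  fixes q :: "'a::{real_normed_field,banach}"
  assumes "norm q < 1"
  shows "euler q \<noteq> 0"
  unfolding qpoch_inf_def
  using one_minus_power_nonzero[OF assms, of "Suc _"]
  by (intro prodinf_nonzero convergent_prod_qpoch assms) simp_all

lemma qpoch_inf_Suc:
  fixes q :: "'a::{real_normed_field,banach}"
  assumes "norm q < 1"
  shows "qpoch_inf z q = (1 - z) * qpoch_inf (z * q) q"
proof (rule LIMSEQ_unique)
  show "(\<lambda>n. qpoch z q (Suc n)) \<longlonglongrightarrow> qpoch_inf z q"
    using qpoch_tendsto[OF assms] by (simp only: filterlim_sequentially_Suc)
  have "qpoch z q (Suc n) = (1 - z) * qpoch (z * q) q n" for n
    unfolding qpoch_def prod.lessThan_Suc_shift by (simp add: mult.assoc)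
  then show "(\<lambda>n. qpoch z q (Suc n)) \<longlonglongrightarrow> (1 - z) * qpoch_inf (z * q) q"
    using qpoch_tendsto[OF assms] by (simp add: tendsto_mult_left)
qed

text \<open>The factors are sorted by their index modulo \<open>k\<close>. With \<open>z = q\<close>
  this splits \<open>euler q\<close> by the residue of the exponent, which is the source of the
  product identities below for \<open>k\<close> = 2, 3 and 5.\<close>

lemma qpoch_inf_dissect:
  fixes q :: "'a::{real_normed_field,banach}"
  assumes "norm q < 1" "k > 0"
  shows "qpoch_inf z q = (\<Prod>j<k. qpoch_inf (z * q ^ j) (q ^ k))"
proof (rule LIMSEQ_unique)
  have k: "strict_mono (\<lambda>n::nat. n * k)"
    using assms by (auto simp: strict_mono_def)
  show "(\<lambda>n. qpoch z q (n * k)) \<longlonglongrightarrow> qpoch_inf z q"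
    using LIMSEQ_subseq_LIMSEQ[OF qpoch_tendsto[OF assms(1)] k] by (simp add: o_def)
  have split: "(\<Prod>i<m + l. f i) = (\<Prod>i<m. f i) * (\<Prod>j<l. f (m + j))" for f :: "nat \<Rightarrow> 'a" and m l
    by (induction l) (auto simp: mult.assoc)
  have "qpoch z q (n * k) = (\<Prod>j<k. qpoch (z * q ^ j) (q ^ k) n)" for n
  proof (induction n)
    case (Suc n)
    have "qpoch z q (Suc n * k) = qpoch z q (n * k) * (\<Prod>j<k. 1 - z * q ^ (n * k + j))"
      unfolding qpoch_def mult_Suc add.commute[of k] by (rule split)
    also have "(\<Prod>j<k. 1 - z * q ^ (n * k + j)) = (\<Prod>j<k. 1 - z * q ^ j * (q ^ k) ^ n)"
      by (intro prod.cong) (auto simp: power_add mult_ac simp flip: power_mult)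
    finally show ?case
      by (simp add: qpoch_Suc Suc prod.distrib)
  qed simp
  moreover have "norm (q ^ k) < 1"
    using assms by (simp add: norm_power power_less_one_iff)
  ultimately show "(\<lambda>n. qpoch z q (n * k)) \<longlonglongrightarrow> (\<Prod>j<k. qpoch_inf (z * q ^ j) (q ^ k))"
    by (simp add: tendsto_prod qpoch_tendsto)
qed

text \<open>Links the real Euler product with the complex one, which occurs in the eta function and
  in the products over fifth roots of unity.\<close>

lemma qpoch_inf_of_real:
  fixes q :: real
  assumes "\<bar>q\<bar> < 1"
  shows "qpoch_inf (of_real z) (of_real q) = (of_real (qpoch_inf z q) :: 'a::{real_normed_field,banach})"
proof (rule LIMSEQ_unique)
  have "qpoch (of_real z) (of_real q) = (\<lambda>n. of_real (qpoch z q n) :: 'a)"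
    by (simp add: qpoch_def fun_eq_iff)
  moreover have "(\<lambda>n. of_real (qpoch z q n) :: 'a) \<longlonglongrightarrow> of_real (qpoch_inf z q)"
    using assms by (intro tendsto_of_real qpoch_tendsto) auto
  ultimately show "qpoch (of_real z) (of_real q) \<longlonglongrightarrow> (of_real (qpoch_inf z q) :: 'a)"
    by simp
  show "qpoch (of_real z) (of_real q) \<longlonglongrightarrow> (qpoch_inf (of_real z) (of_real q) :: 'a)"
    using assms by (intro qpoch_tendsto) auto
qed

text \<open>The lower index is an integer and the value outside \<open>{0..n}\<close> is 0. Pascal's
  rules then hold for every \<open>k\<close>, and finite identities become sums over all integers,
  where an index shift costs nothing.\<close>

definition qbinom :: "'a::real_normed_field \<Rightarrow> nat \<Rightarrow> int \<Rightarrow> 'a" where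
  "qbinom q n k = (if 0 \<le> k \<and> k \<le> int n
     then qpoch q q n / (qpoch q q (nat k) * qpoch q q (n - nat k)) else 0)"

lemma qbinom_eq_0: "k < 0 \<or> k > int n \<Longrightarrow> qbinom q n k = 0"
  by (auto simp: qbinom_def)

lemma qbinom_0:
  fixes q :: "'a::real_normed_field"
  assumes "norm q < 1" shows "qbinom q n 0 = 1"
  using qpoch_nonzero[OF assms] by (simp add: qbinom_def)

lemma qbinom_same:
  fixes q :: "'a::real_normed_field"
  assumes "norm q < 1" shows "qbinom q n (int n) = 1"
  using qpoch_nonzero[OF assms] by (simp add: qbinom_def)

lemma qbinom_sym:
  "qbinom q n (int n - k) = qbinom q n k"
proof (cases "0 \<le> k \<and> k \<le> int n")
  case True
  then obtain j where "k = int j" "j \<le> n"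
    using zero_le_imp_eq_int by auto
  then show ?thesis
    by (simp add: qbinom_def nat_diff_distrib' mult.commute)
qed (auto simp: qbinom_def)

lemma qbinom_pascal:
  fixes q :: "'a::real_normed_field"
  assumes "norm q < 1" "q \<noteq> 0"
  shows "qbinom q (Suc n) k = qbinom q n (k - 1) + q powi k * qbinom q n k"
proof (cases "0 < k \<and> k \<le> int n")
  case True
  then obtain j where j: "k = int (Suc j)" "Suc j \<le> n"
    by (metis gr0_conv_Suc of_nat_0_less_iff of_nat_le_iff zero_less_imp_eq_int)
  define m where "m = n - Suc j"
  have n: "n = Suc (j + m)" using j m_def by simp
  note [simp] = qpoch_nonzero[OF assms(1)]
  have "1 - q * q ^ j \<noteq> 0" "1 - q * q ^ m \<noteq> 0" "1 - q * (q * (q ^ j * q ^ m)) \<noteq> 0" "1 - q * (q ^ j * q ^ m) \<noteq> 0"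
    using one_minus_power_nonzero[OF assms(1), of "Suc j"] one_minus_power_nonzero[OF assms(1), of "Suc m"]
      one_minus_power_nonzero[OF assms(1), of "Suc (Suc (j + m))"]
      one_minus_power_nonzero[OF assms(1), of "Suc (j + m)"]
    by (simp_all add: power_add)
  then show ?thesis
    using j n by (simp add: qbinom_def nat_add_distrib power_int_def Suc_diff_le qpoch_Suc power_add divide_simps)
       (simp add: algebra_simps)
next
  case False
  then consider "k < 0" | "k = 0" | "k = int n + 1" | "k > int n + 1" by linarith
  then show ?thesis
  proof cases
    case 3
    then show ?thesis
      using qbinom_same[OF assms(1), of "Suc n"] qbinom_same[OF assms(1), of n]
      by (simp add: qbinom_eq_0 add.commute)
  qed (use assms in \<open>auto simp: qbinom_eq_0 qbinom_0\<close>)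
qed

lemma qbinom_pascal':
  fixes q :: "'a::real_normed_field"
  assumes "norm q < 1" "q \<noteq> 0"
  shows "qbinom q (Suc n) k = qbinom q n k + q powi (int n + 1 - k) * qbinom q n (k - 1)"
proof -
  have "qbinom q (Suc n) k = qbinom q (Suc n) (int n + 1 - k)"
    using qbinom_sym[of q "Suc n" k] by (simp add: algebra_simps)
  also have "\<dots> = qbinom q n (int n - k) + q powi (int n + 1 - k) * qbinom q n (int n - (k - 1))"
    using qbinom_pascal[OF assms, of n "int n + 1 - k"] by (simp add: algebra_simps)
  finally show ?thesis
    by (simp only: qbinom_sym)
qed

section \<open>The Jacobi triple product\<close>

lemma abs_summable_int_suminf:
  fixes f :: "int \<Rightarrow> 'a::banach"
  assumes "f abs_summable_on UNIV"
  shows "summable (\<lambda>n. norm (f (int_decode n)))"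
    and "(\<Sum>\<^sub>\<infinity>i. f i) = (\<Sum>n. f (int_decode n))"
proof -
  have 1: "(\<lambda>n. norm (f (int_decode n))) summable_on UNIV"
    using assms summable_on_reindex_bij_betw[OF bij_int_decode, of "\<lambda>i. norm (f i)"] by simp
  then show "summable (\<lambda>n. norm (f (int_decode n)))"
    by (rule summable_on_imp_summable)
  have "(\<lambda>n. f (int_decode n)) summable_on UNIV"
    using 1 by (rule abs_summable_summable)
  then have "(\<lambda>n. f (int_decode n)) sums (\<Sum>\<^sub>\<infinity>n. f (int_decode n))"
    by (intro has_sum_imp_sums has_sum_infsum)
  then show "(\<Sum>\<^sub>\<infinity>i. f i) = (\<Sum>n. f (int_decode n))"
    using infsum_reindex_bij_betw[OF bij_int_decode, of f] by (simp add: sums_iff)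
qed

text \<open>Dominated convergence with majorant \<open>norm (c i) * B\<close>. A limit
  \<open>L\<close> common to all \<open>i\<close> is enough, because Gaussian binomials at a fixed
  distance from the centre all tend to \<open>1 / euler q\<close>.\<close>

lemma tannery_int:
  fixes c :: "int \<Rightarrow> 'a::{real_normed_field,banach}"
  assumes c: "c abs_summable_on UNIV"
    and B: "\<And>n i. norm (g n i) \<le> B"
    and lim: "\<And>i. (\<lambda>n. g n i) \<longlonglongrightarrow> L"
  shows "(\<lambda>n. \<Sum>\<^sub>\<infinity>i. c i * g n i) \<longlonglongrightarrow> (\<Sum>\<^sub>\<infinity>i. c i) * L"
proof -
  have s: "(\<lambda>i. norm (c i * g n i)) summable_on UNIV" for n
    using summable_on_cmult_left[OF c, of B]
    by (rule summable_on_comparison_test) (use B in \<open>auto simp: norm_mult intro: mult_left_mono\<close>)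
  have "(\<lambda>n. \<Sum>k. c (int_decode k) * g n (int_decode k)) \<longlonglongrightarrow> (\<Sum>k. c (int_decode k) * L)"
  proof (rule tannerys_theorem[THEN conjunct2, THEN conjunct2])
    show "summable (\<lambda>k. norm (c (int_decode k)) * B)"
      by (intro summable_mult2 abs_summable_int_suminf c)
    show "\<forall>\<^sub>F (k, n) in sequentially \<times>\<^sub>F sequentially.
       norm (c (int_decode k) * g n (int_decode k)) \<le> norm (c (int_decode k)) * B"
      using B by (intro always_eventually) (auto simp: norm_mult intro: mult_left_mono)
  qed (auto intro!: tendsto_mult lim)
  moreover have "(\<Sum>k. c (int_decode k) * L) = (\<Sum>\<^sub>\<infinity>i. c i) * L"
    using abs_summable_int_suminf[OF c] by (simp add: suminf_mult2 summable_norm_cancel)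
  ultimately show ?thesis
    using abs_summable_int_suminf(2)[OF s] by simp
qed

text \<open>\<open>qpoch q q n\<close> converges to a nonzero limit, so it and its inverse are
  bounded sequences. This is the uniform bound that \<open>tannery_int\<close> asks for.\<close>

lemma qbinom_bounded:
  fixes q :: "'a::{real_normed_field,banach}"
  assumes "norm q < 1"
  obtains B where "\<And>n k. norm (qbinom q n k) \<le> B"
proof -
  have lim: "qpoch q q \<longlonglongrightarrow> euler q"
    using assms by (rule qpoch_tendsto)
  obtain M where M: "\<And>n. norm (qpoch q q n) \<le> M"
    using convergent_imp_Bseq[OF convergentI[OF lim]] by (auto simp: Bseq_def)
  have "(\<lambda>n. inverse (qpoch q q n)) \<longlonglongrightarrow> inverse (euler q)"
    using lim euler_nonzero[OF assms] by (rule tendsto_inverse)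
  then obtain M' where M': "\<And>n. norm (inverse (qpoch q q n)) \<le> M'"
    using convergent_imp_Bseq[OF convergentI[of "\<lambda>n. inverse (qpoch q q n)"]] by (auto simp: Bseq_def)
  have pos: "M \<ge> 0" "M' \<ge> 0"
    using order_trans[OF norm_ge_zero M] order_trans[OF norm_ge_zero M'] by auto
  have "norm (qbinom q n k) \<le> M * (M' * M')" for n k
  proof -
    have "norm (qpoch q q n * (inverse (qpoch q q (nat k)) * inverse (qpoch q q (n - nat k)))) \<le> M * (M' * M')"
      unfolding norm_mult by (intro mult_mono M M' mult_nonneg_nonneg pos norm_ge_zero)
    then show ?thesis
      using pos by (simp add: qbinom_def field_simps)
  qed
  then show ?thesis by (rule that)
qed

lemma qbinom_tendsto:
  fixes q :: "'a::{real_normed_field,banach}"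
  assumes "norm q < 1"
    and k: "filterlim k at_top sequentially" and nk: "filterlim (\<lambda>i. int (n i) - k i) at_top sequentially"
  shows "(\<lambda>i. qbinom q (n i) (k i)) \<longlonglongrightarrow> 1 / euler q"
proof -
  have lim: "qpoch q q \<longlonglongrightarrow> euler q"
    using assms by (intro qpoch_tendsto)
  have nat: "filterlim nat sequentially (at_top :: int filter)"
    unfolding filterlim_at_top eventually_at_top_linorder by (metis nat_int nat_mono)
  have n: "filterlim n at_top sequentially"
  proof -
    have "eventually (\<lambda>i. 0 \<le> int (n i) - k i) sequentially"
      using nk unfolding filterlim_at_top by blast
    then have "filterlim (\<lambda>i. int (n i)) at_top sequentially"
      by (intro filterlim_at_top_mono[OF k]) (simp add: eventually_mono)
    from filterlim_compose[OF nat this] show ?thesis by simp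
  qed
  have nk': "filterlim (\<lambda>i. n i - nat (k i)) at_top sequentially"
  proof (rule filterlim_cong[THEN iffD1])
    show "filterlim (\<lambda>i. nat (int (n i) - k i)) at_top sequentially"
      using filterlim_compose[OF nat nk] .
    have "eventually (\<lambda>i. k i \<ge> 0) sequentially"
      using k by (simp add: filterlim_at_top)
    then show "\<forall>\<^sub>F i in sequentially. nat (int (n i) - k i) = n i - nat (k i)"
      by eventually_elim (simp add: nat_diff_distrib')
  qed auto
  have "(\<lambda>i. qpoch q q (n i) / (qpoch q q (nat (k i)) * qpoch q q (n i - nat (k i)))) \<longlonglongrightarrow>
      euler q / (euler q * euler q)"
    by (intro tendsto_intros filterlim_compose[OF lim] n nk' filterlim_compose[OF nat k])
       (use euler_nonzero[OF assms(1)] in auto)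
  moreover have "eventually (\<lambda>i. qpoch q q (n i) / (qpoch q q (nat (k i)) * qpoch q q (n i - nat (k i))) = qbinom q (n i) (k i)) sequentially"
  proof -
    have "eventually (\<lambda>i. 0 \<le> k i) sequentially" "eventually (\<lambda>i. 0 \<le> int (n i) - k i) sequentially"
      using k nk unfolding filterlim_at_top by blast+
    then show ?thesis
      by eventually_elim (auto simp: qbinom_def)
  qed
  ultimately have "(\<lambda>i. qbinom q (n i) (k i)) \<longlonglongrightarrow> euler q / (euler q * euler q)"
    by (rule Lim_transform_eventually)
  then show ?thesis
    using euler_nonzero[OF assms(1)] by simp
qed

section \<open>Triangular exponents and convergence of theta series\<close>

definition tri :: "int \<Rightarrow> nat" where
  "tri m = nat (m * (m - 1) div 2)"

lemma two_tri: "2 * int (tri m) = m * (m - 1)"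
proof -
  have "m * (m - 1) \<ge> 0"
    by (cases "m \<ge> 1") (auto simp: mult_nonneg_nonneg mult_nonpos_nonpos)
  moreover have "even (m * (m - 1))" by auto
  ultimately show ?thesis
    by (simp add: tri_def)
qed

lemma int_tri_diff: "int (tri (m - 1)) = int (tri m) - m + 1"
  and int_tri_Suc: "int (tri (m + 1)) = int (tri m) + m"
  using two_tri[of "m - 1"] two_tri[of m] two_tri[of "m + 1"] by (auto simp: algebra_simps)

lemma abs_summable_intI:
  fixes f :: "int \<Rightarrow> 'a::banach"
  assumes "summable (\<lambda>n. norm (f (int n)))" "summable (\<lambda>n. norm (f (- int n)))"
  shows "f abs_summable_on UNIV"
proof -
  have "(\<lambda>i. norm (f i)) summable_on range int"
    by (subst summable_on_reindex) (auto simp: o_def intro!: summable_nonneg_imp_summable_on assms)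
  moreover have "(\<lambda>i. norm (f i)) summable_on range (\<lambda>n. - int n)"
    by (subst summable_on_reindex) (auto simp: o_def inj_def intro!: summable_nonneg_imp_summable_on assms)
  ultimately have "(\<lambda>i. norm (f i)) summable_on (range int \<union> range (\<lambda>n. - int n))"
    by (rule summable_on_union)
  moreover have "range int \<union> range (\<lambda>n. - int n) = UNIV"
    by (auto simp: image_iff) (metis int_cases2)
  ultimately show ?thesis by simp
qed

text \<open>The weight \<open>n + 1\<close> lets one estimate serve the series with coefficient
  \<open>m\<close> too. The ratio of consecutive terms is at most \<open>2 * x * r ^ n\<close>,
  eventually below 1/2 however large \<open>x\<close> is.\<close>

lemma summable_theta_aux:
  fixes x r :: real
  assumes "x \<ge> 0" "0 \<le> r" "r < 1"
  shows "summable (\<lambda>n. (real n + 1) * x ^ n * r ^ tri (int n))"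
proof -
  have "(\<lambda>n. 2 * x * r ^ n) \<longlonglongrightarrow> 2 * x * 0"
    using assms by (intro tendsto_mult_left LIMSEQ_power_zero) auto
  then have "eventually (\<lambda>n. 2 * x * r ^ n < 1 / 2) sequentially"
    by (rule order_tendstoD) simp
  then obtain N where N: "\<And>n. n \<ge> N \<Longrightarrow> 2 * x * r ^ n < 1 / 2"
    by (auto simp: eventually_at_top_linorder)
  show ?thesis
  proof (rule summable_ratio_test[of "1/2" N])
    fix n assume "n \<ge> N"
    have "int (tri (int (Suc n))) = int (tri (int n)) + int n"
      using int_tri_Suc[of "int n"] by (simp add: add.commute)
    then have t: "tri (int (Suc n)) = tri (int n) + n" by linarith
    have "(real (Suc n) + 1) * x ^ Suc n * r ^ tri (int (Suc n))
        = (real n + 2) * x * r ^ n * (x ^ n * r ^ tri (int n))"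
      by (simp only: t power_add) simp
    also have "\<dots> \<le> (2 * (real n + 1)) * x * r ^ n * (x ^ n * r ^ tri (int n))"
      using assms by (intro mult_right_mono) auto
    also have "\<dots> = (2 * x * r ^ n) * ((real n + 1) * x ^ n * r ^ tri (int n))"
      by simp
    also have "\<dots> \<le> 1 / 2 * ((real n + 1) * x ^ n * r ^ tri (int n))"
      using N[OF \<open>n \<ge> N\<close>] assms by (intro mult_right_mono) auto
    finally show "norm ((real (Suc n) + 1) * x ^ Suc n * r ^ tri (int (Suc n)))
       \<le> 1 / 2 * norm ((real n + 1) * x ^ n * r ^ tri (int n))"
      using assms by simp
  qed simp
qed

lemma abs_summable_theta:
  fixes q z :: "'a::{real_normed_field,banach}"
  assumes "norm q < 1"
  shows "(\<lambda>m. of_int m * z powi m * q ^ tri m) abs_summable_on UNIV"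
    and "(\<lambda>m. z powi m * q ^ tri m) abs_summable_on UNIV"
proof -
  have *: "summable (\<lambda>n. (real n + 1) * norm z ^ n * norm q ^ tri (int n))"
          "summable (\<lambda>n. (real n + 1) * norm (inverse z) ^ n * norm q ^ tri (int n))"
    using assms by (intro summable_theta_aux; simp)+
  \<comment> \<open>Exponents at negative indices are larger, so that half is dominated by the
    positive half with \<open>inverse z\<close>.\<close>
  have t: "tri (- int n) = tri (int n) + n" for n
    using two_tri[of "- int n"] two_tri[of "int n"] by (simp add: algebra_simps)
  show "(\<lambda>m. of_int m * z powi m * q ^ tri m) abs_summable_on UNIV"
  proof (rule abs_summable_intI)
    show "summable (\<lambda>n. norm (of_int (int n) * z powi int n * q ^ tri (int n)))"
      by (rule summable_comparison_test'[OF *(1), of 0])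
         (auto simp: norm_mult norm_power intro!: mult_right_mono)
    show "summable (\<lambda>n. norm (of_int (- int n) * z powi - int n * q ^ tri (- int n)))"
      using assms
      by (intro summable_comparison_test'[OF *(2), of 0])
         (auto simp: norm_mult norm_power norm_inverse t power_int_minus power_inverse
            intro!: mult_mono power_decreasing)
  qed
  show "(\<lambda>m. z powi m * q ^ tri m) abs_summable_on UNIV"
  proof (rule abs_summable_intI)
    have 1: "a \<le> (real n + 1) * a" if "a \<ge> 0" for a n
      using that by (simp add: algebra_simps)
    show "summable (\<lambda>n. norm (z powi int n * q ^ tri (int n)))"
      by (rule summable_comparison_test'[OF *(1), of 0])
         (auto simp: norm_mult norm_power mult.assoc intro!: 1)
    have "inverse (norm z) ^ n * norm q ^ tri (- int n) \<le> (real n + 1) * (inverse (norm z) ^ n * norm q ^ tri (int n))" for n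
      using assms by (intro order_trans[OF _ 1] mult_left_mono power_decreasing) (auto simp: t)
    then show "summable (\<lambda>n. norm (z powi - int n * q ^ tri (- int n)))"
      by (intro summable_comparison_test'[OF *(2), of 0])
         (auto simp: norm_mult norm_power norm_inverse power_int_minus power_inverse mult.assoc)
  qed
qed

abbreviation sgn_pow :: "int \<Rightarrow> 'a::real_normed_field" where
  "sgn_pow m \<equiv> (-1) powi m"

lemma abs_summable_finite_supp:
  fixes f :: "int \<Rightarrow> 'a::real_normed_vector"
  assumes "\<And>i. i < a \<or> i > b \<Longrightarrow> f i = 0"
  shows "f abs_summable_on UNIV"
proof (rule finite_nonzero_values_imp_summable_on)
  have "{i \<in> UNIV. norm (f i) \<noteq> 0} \<subseteq> {a..b}"
    using assms by force
  then show "finite {i \<in> UNIV. norm (f i) \<noteq> 0}"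
    using finite_subset by blast
qed

lemma summable_finite_supp:
  fixes f :: "int \<Rightarrow> 'a::banach"
  assumes "\<And>i. i < a \<or> i > b \<Longrightarrow> f i = 0"
  shows "f summable_on UNIV"
  using abs_summable_finite_supp[of a b f] assms by (auto intro: abs_summable_summable)

lemma has_sum_diff:
  fixes f g :: "'i \<Rightarrow> 'a::real_normed_field"
  assumes "(f has_sum a) A" "(g has_sum b) A"
  shows "((\<lambda>i. f i - g i) has_sum (a - b)) A"
  using has_sum_add[OF assms(1) has_sum_uminusI[OF assms(2)]] by simp

lemma has_sum_int_shift:
  "((\<lambda>m. f (m + k)) has_sum s) UNIV \<longleftrightarrow> (f has_sum s) (UNIV :: int set)"
  by (rule has_sum_reindex_bij_witness[where i = "\<lambda>m. m - k" and j = "\<lambda>m. m + k"]) auto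

section \<open>The finite triple product and its derivative at z = 1\<close>

lemma qbinom_central_rec:
  fixes q z :: "'a::real_normed_field" and N :: nat
  assumes q: "norm q < 1" "q \<noteq> 0"
  shows "qbinom q (2 * Suc N) (int (Suc N) + m) = (1 + q ^ (2 * N + 1)) * qbinom q (2 * N) (int N + m)
     + q powi (int N + 1 - m) * qbinom q (2 * N) (int N + (m - 1))
     + q powi (int N + 1 + m) * qbinom q (2 * N) (int N + (m + 1))"
proof -
  have e: "2 * Suc N = Suc (Suc (2 * N))" by simp
  have "q powi (int N + 1 + m) * q powi (int N - m) = q ^ (2 * N + 1)"
    using q(2) by (simp flip: power_int_add power_int_of_nat add: algebra_simps)
  moreover have "qbinom q (2 * Suc N) (int (Suc N) + m) = qbinom q (Suc (2 * N)) (int N + m)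
      + q powi (int N + 1 + m) * qbinom q (Suc (2 * N)) (int N + 1 + m)"
    unfolding e using qbinom_pascal[OF q, of "Suc (2 * N)" "int (Suc N) + m"] by (simp add: algebra_simps)
  moreover have "qbinom q (Suc (2 * N)) (int N + m) = qbinom q (2 * N) (int N + m)
      + q powi (int N + 1 - m) * qbinom q (2 * N) (int N + (m - 1))"
    using qbinom_pascal'[OF q, of "2 * N" "int N + m"] by (simp add: algebra_simps)
  moreover have "qbinom q (Suc (2 * N)) (int N + 1 + m) = qbinom q (2 * N) (int N + (m + 1))
      + q powi (int N - m) * qbinom q (2 * N) (int N + m)"
    using qbinom_pascal'[OF q, of "2 * N" "int N + 1 + m"] by (simp add: algebra_simps)
  ultimately show ?thesis
    by (simp add: algebra_simps)
qed

definition jterm :: "'a::real_normed_field \<Rightarrow> 'a \<Rightarrow> nat \<Rightarrow> int \<Rightarrow> 'a" where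
  "jterm z q N m = (-z) powi m * q ^ tri m * qbinom q (2 * N) (int N + m)"

lemma jterm_eq_0: "m < - int N \<or> m > int N \<Longrightarrow> jterm z q N m = 0"
  by (auto simp: jterm_def qbinom_eq_0)

text \<open>Coefficientwise multiplication by (1 - z q^N)(1 - q^(N+1)/z) = 1 + q^(2N+1) - z q^N -
  q^(N+1)/z, the two factors that \<open>qpoch z q\<close> and \<open>qpoch (q / z) q\<close> gain
  as \<open>N\<close> grows by one. A factor z or 1/z moves the index \<open>m\<close> by
  one.\<close>

lemma jterm_Suc:
  fixes q z :: "'a::real_normed_field"
  assumes q: "norm q < 1" "q \<noteq> 0" and z: "z \<noteq> 0"
  shows "jterm z q (Suc N) m = (1 + q ^ (2 * N + 1)) * jterm z q N m
     - z * q ^ N * jterm z q N (m - 1) - q ^ Suc N / z * jterm z q N (m + 1)"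
proof -
  have p: "q powi i * q powi j = q powi (i + j)" "z powi i * z powi j = z powi (i + j)"  for i j
    using q z by (simp_all add: power_int_add)
  have 1: "z * q ^ N * ((-z) powi (m - 1) * q ^ tri (m - 1))
      = - ((-z) powi m * q ^ tri m * q powi (int N + 1 - m))"
  proof -
    have "q ^ N * q ^ tri (m - 1) = q ^ tri m * q powi (int N + 1 - m)"
      using q by (simp add: p int_tri_diff algebra_simps flip: power_int_of_nat)
    moreover have "z * (-z) powi (m - 1) = - ((-z) powi m)"
      using z by (simp add: power_int_diff)
    moreover have "z * q ^ N * ((-z) powi (m - 1) * q ^ tri (m - 1)) = (z * (-z) powi (m - 1)) * (q ^ N * q ^ tri (m - 1))"
      by (simp only: mult_ac)
    ultimately show ?thesis by (simp add: mult.assoc)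
  qed
  have 2: "q ^ Suc N / z * ((-z) powi (m + 1) * q ^ tri (m + 1))
      = - ((-z) powi m * q ^ tri m * q powi (int N + 1 + m))"
  proof -
    have "q ^ Suc N * q ^ tri (m + 1) = q ^ tri m * q powi (int N + 1 + m)"
    proof -
      have "int (Suc N) + int (tri (m + 1)) = int (tri m) + (int N + 1 + m)"
        by (simp add: int_tri_Suc)
      then show ?thesis
        by (metis p(1) power_int_of_nat)
    qed
    moreover have "(-z) powi (m + 1) / z = - ((-z) powi m)"
      using z by (simp add: power_int_add)
    moreover have "q ^ Suc N / z * ((-z) powi (m + 1) * q ^ tri (m + 1)) = ((-z) powi (m + 1) / z) * (q ^ Suc N * q ^ tri (m + 1))"
      by (simp add: mult_ac)
    ultimately show ?thesis by (simp only: mult_minus_left mult.assoc)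
  qed
  show ?thesis
    unfolding jterm_def qbinom_central_rec[OF q] mult.assoc[symmetric] 1[unfolded mult.assoc[symmetric]] 2[unfolded mult.assoc[symmetric]]
    by (simp add: algebra_simps)
qed

lemma jacobi_triple_finite:
  fixes q z :: "'a::{real_normed_field,banach}"
  assumes q: "norm q < 1" "q \<noteq> 0" and z: "z \<noteq> 0"
  shows "(jterm z q N has_sum qpoch z q N * qpoch (q / z) q N) UNIV"
proof (induction N)
  case 0
  have "jterm z q 0 m = (if m = 0 then 1 else 0)" for m
    using jterm_eq_0[of m 0 z q] qbinom_0[OF q(1), of 0]
    by (cases "m = 0"; cases "m < 0") (auto simp: jterm_def[of _ _ _ 0] tri_def)
  then show ?case
    by (intro has_sum_finite_neutralI[of "{0}"]) auto
next
  case (Suc N)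
  let ?P = "qpoch z q N * qpoch (q / z) q N"
  have "((\<lambda>m. jterm z q N (m - 1)) has_sum ?P) UNIV" "((\<lambda>m. jterm z q N (m + 1)) has_sum ?P) UNIV"
    using Suc has_sum_int_shift[of "jterm z q N" "-1" ?P] has_sum_int_shift[of "jterm z q N" 1 ?P] by simp_all
  then have "((\<lambda>m. (1 + q ^ (2 * N + 1)) * jterm z q N m
     - z * q ^ N * jterm z q N (m - 1) - q ^ Suc N / z * jterm z q N (m + 1)) has_sum
      ((1 + q ^ (2 * N + 1)) * ?P - z * q ^ N * ?P - q ^ Suc N / z * ?P)) UNIV"
    using Suc by (intro has_sum_diff has_sum_cmult_right)
  moreover have "(1 + q ^ (2 * N + 1)) * ?P - z * q ^ N * ?P - q ^ Suc N / z * ?P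
     = qpoch z q (Suc N) * qpoch (q / z) q (Suc N)"
    using z by (simp add: qpoch_Suc field_simps power_add power_mult power2_eq_square)
  ultimately show ?case
    by (simp add: jterm_Suc[OF q z])
qed

lemma jterm_int_finite:
  fixes q :: "'a::{real_normed_field,banach}"
  assumes q: "norm q < 1" "q \<noteq> 0"
  shows "((\<lambda>m. of_int m * jterm 1 q (Suc N) m) has_sum (- qpoch q q N * qpoch q q (Suc N))) UNIV"
proof (induction N)
  case 0
  have "qpoch q q (Suc 0) = 1 - q" by (simp add: qpoch_Suc)
  moreover have "(\<Sum>m\<in>{-1..1}. of_int m * jterm 1 q (Suc 0) m) = q - 1"
    using qbinom_0[OF q(1), of "Suc (Suc 0)"] qbinom_same[OF q(1), of "Suc (Suc 0)"]
    by (simp add: jterm_def tri_def simp_from_to numeral_2_eq_2)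
  ultimately show ?case
    by (intro has_sum_finite_neutralI[of "{-1..1}"]) (auto intro!: jterm_eq_0)
next
  case (Suc N)
  let ?j = "jterm 1 q (Suc N)" let ?P = "- qpoch q q N * qpoch q q (Suc N)"
  have "qpoch 1 q (Suc N) = 0"
    unfolding qpoch_def prod.lessThan_Suc_shift by simp
  then have z: "(?j has_sum 0) UNIV"
    using jacobi_triple_finite[OF q, of 1 "Suc N"] by simp
  have s: "((\<lambda>m. of_int (m - 1) * ?j (m - 1)) has_sum ?P) UNIV"
          "((\<lambda>m. of_int (m + 1) * ?j (m + 1)) has_sum ?P) UNIV"
    using Suc has_sum_int_shift[of "\<lambda>m. of_int m * ?j m" "-1" ?P] has_sum_int_shift[of "\<lambda>m. of_int m * ?j m" 1 ?P] by simp_all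
  have z': "((\<lambda>m. ?j (m - 1)) has_sum 0) UNIV" "((\<lambda>m. ?j (m + 1)) has_sum 0) UNIV"
    using z has_sum_int_shift[of ?j "-1" 0] has_sum_int_shift[of ?j 1 0] by simp_all
  have "((\<lambda>m. (1 + q ^ (2 * Suc N + 1)) * (of_int m * ?j m)
     - q ^ Suc N * (of_int (m - 1) * ?j (m - 1) + ?j (m - 1))
     - q ^ Suc (Suc N) * (of_int (m + 1) * ?j (m + 1) - ?j (m + 1))) has_sum
      ((1 + q ^ (2 * Suc N + 1)) * ?P - q ^ Suc N * (?P + 0) - q ^ Suc (Suc N) * (?P - 0))) UNIV"
    using Suc by (intro has_sum_diff has_sum_add has_sum_cmult_right s z')
  moreover have "(1 + q ^ (2 * Suc N + 1)) * ?P - q ^ Suc N * (?P + 0) - q ^ Suc (Suc N) * (?P - 0)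
     = - qpoch q q (Suc N) * qpoch q q (Suc (Suc N))"
    by (simp add: qpoch_Suc algebra_simps power_add power_mult power2_eq_square)
  moreover have "of_int m * jterm 1 q (Suc (Suc N)) m = (1 + q ^ (2 * Suc N + 1)) * (of_int m * ?j m)
     - q ^ Suc N * (of_int (m - 1) * ?j (m - 1) + ?j (m - 1))
     - q ^ Suc (Suc N) * (of_int (m + 1) * ?j (m + 1) - ?j (m + 1))" for m
    unfolding jterm_Suc[OF q one_neq_zero] by (simp add: algebra_simps)
  ultimately show ?case by simp
qed

lemma qbinom_central_tendsto:
  fixes q :: "'a::{real_normed_field,banach}"
  assumes "norm q < 1"
  shows "(\<lambda>N. qbinom q (2 * N) (int N + m)) \<longlonglongrightarrow> 1 / euler q"
proof (rule qbinom_tendsto[OF assms])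
  have lin: "filterlim (\<lambda>N. int N + c) at_top sequentially" for c
    unfolding filterlim_at_top eventually_at_top_linorder
  proof safe
    fix Z show "\<exists>n0. \<forall>n\<ge>n0. Z \<le> int n + c"
      by (rule exI[of _ "nat (Z - c)"]) auto
  qed
  show "filterlim (\<lambda>N. int N + m) at_top sequentially" by (rule lin)
  show "filterlim (\<lambda>N. int (2 * N) - (int N + m)) at_top sequentially" using lin[of "-m"] by (simp add: algebra_simps)
qed

theorem jacobi_triple:
  fixes q z :: "'a::{real_normed_field,banach}"
  assumes q: "norm q < 1" "q \<noteq> 0" and z: "z \<noteq> 0"
  shows "((\<lambda>m. (-z) powi m * q ^ tri m) has_sum (qpoch_inf z q * qpoch_inf (q / z) q * euler q)) UNIV"
proof -
  obtain B where B: "\<And>n k. norm (qbinom q n k) \<le> B"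
    using qbinom_bounded[OF q(1)] by blast
  have s: "(\<lambda>m. (-z) powi m * q ^ tri m) abs_summable_on UNIV"
    using abs_summable_theta[OF q(1)] by blast
  have "(\<lambda>N. \<Sum>\<^sub>\<infinity>m. (-z) powi m * q ^ tri m * qbinom q (2 * N) (int N + m)) \<longlonglongrightarrow>
      (\<Sum>\<^sub>\<infinity>m. (-z) powi m * q ^ tri m) * (1 / euler q)"
    by (rule tannery_int[OF s B qbinom_central_tendsto[OF q(1)]])
  moreover have "(\<lambda>N. \<Sum>\<^sub>\<infinity>m. (-z) powi m * q ^ tri m * qbinom q (2 * N) (int N + m)) \<longlonglongrightarrow>
     qpoch_inf z q * qpoch_inf (q / z) q"
    using infsumI[OF jacobi_triple_finite[OF assms]] qpoch_tendsto[OF q(1)]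
    unfolding jterm_def by (simp add: tendsto_mult)
  ultimately have "(\<Sum>\<^sub>\<infinity>m. (-z) powi m * q ^ tri m) * (1 / euler q) = qpoch_inf z q * qpoch_inf (q / z) q"
    by (rule LIMSEQ_unique)
  then have "(\<Sum>\<^sub>\<infinity>m. (-z) powi m * q ^ tri m) = qpoch_inf z q * qpoch_inf (q / z) q * euler q"
    using euler_nonzero[OF q(1)] by (simp add: field_simps)
  then show ?thesis
    using abs_summable_summable[OF s] by (simp add: has_sum_iff)
qed

text \<open>Jacobi's identity, the limit of \<open>jterm_int_finite\<close>. Since \<open>m\<close>
  and \<open>1 - m\<close> share an exponent, each power of \<open>q\<close> occurs twice here;
  joining the two terms gives the usual odd coefficients.\<close>

theorem euler_cube:
  fixes q :: "'a::{real_normed_field,banach}"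
  assumes q: "norm q < 1" "q \<noteq> 0"
  shows "((\<lambda>m. - of_int m * sgn_pow m * q ^ tri m) has_sum euler q ^ 3) UNIV"
proof -
  obtain B where B: "\<And>n k. norm (qbinom q n k) \<le> B"
    using qbinom_bounded[OF q(1)] by blast
  have s: "(\<lambda>m. of_int m * sgn_pow m * q ^ tri m) abs_summable_on UNIV"
    using abs_summable_theta[OF q(1)] by blast
  have "(\<lambda>N. \<Sum>\<^sub>\<infinity>m. of_int m * sgn_pow m * q ^ tri m * qbinom q (2 * N) (int N + m)) \<longlonglongrightarrow>
      (\<Sum>\<^sub>\<infinity>m. of_int m * sgn_pow m * q ^ tri m) * (1 / euler q)"
    by (rule tannery_int[OF s B qbinom_central_tendsto[OF q(1)]])
  then have "(\<lambda>N. \<Sum>\<^sub>\<infinity>m. of_int m * sgn_pow m * q ^ tri m * qbinom q (2 * Suc N) (int (Suc N) + m)) \<longlonglongrightarrow>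
      (\<Sum>\<^sub>\<infinity>m. of_int m * sgn_pow m * q ^ tri m) * (1 / euler q)"
    by (rule LIMSEQ_Suc)
  moreover have "(\<lambda>N. \<Sum>\<^sub>\<infinity>m. of_int m * sgn_pow m * q ^ tri m * qbinom q (2 * Suc N) (int (Suc N) + m)) \<longlonglongrightarrow>
     - euler q * euler q"
  proof -
    have "(\<lambda>N. - qpoch q q N * qpoch q q (Suc N)) \<longlonglongrightarrow> - euler q * euler q"
      by (intro tendsto_intros LIMSEQ_Suc qpoch_tendsto q)
    then show ?thesis
      using infsumI[OF jterm_int_finite[OF q]] unfolding jterm_def by (simp add: mult.assoc)
  qed
  ultimately have "(\<Sum>\<^sub>\<infinity>m. of_int m * sgn_pow m * q ^ tri m) * (1 / euler q) = - euler q * euler q"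
    by (rule LIMSEQ_unique)
  then have "(\<Sum>\<^sub>\<infinity>m. of_int m * sgn_pow m * q ^ tri m) = - (euler q ^ 3)"
    using euler_nonzero[OF q(1)] by (simp add: field_simps power3_eq_cube)
  then have "((\<lambda>m. of_int m * sgn_pow m * q ^ tri m) has_sum (- (euler q ^ 3))) UNIV"
    using abs_summable_summable[OF s] by (simp add: has_sum_iff)
  from has_sum_uminusI[OF this] show ?thesis by simp
qed

section \<open>The Rogers-Ramanujan continued fraction\<close>

text \<open>Exponents of \<open>qser j k\<close>, which is Ramanujan's theta function f(-q^j,
  -q^(k-j)). For \<open>j \<le> k\<close> the integer under \<open>nat\<close> is nonnegative, so
  nothing is truncated.\<close>

definition qexp :: "nat \<Rightarrow> nat \<Rightarrow> int \<Rightarrow> nat" where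
  "qexp j k m = nat (int j * m + int k * int (tri m))"

text \<open>Doubling clears the triangular number, so that equations between exponents reduce to
  polynomial identities over the integers.\<close>

lemma two_qexp:
  assumes "j \<le> k"
  shows "2 * int (qexp j k m) = 2 * int j * m + int k * (m * (m - 1))"
proof -
  have "int j * m + int k * int (tri m) \<ge> 0"
  proof (cases "m \<ge> 0")
    case False
    have "- m * 2 \<le> m * (m - 1)"
      using False mult_left_mono_neg[of "m - 1" "-2" m] by (simp add: algebra_simps)
    then have "- m \<le> int (tri m)" using two_tri[of m] by linarith
    then have "int k * int (tri m) \<ge> int k * (- m)"
      by (intro mult_left_mono) auto
    moreover have "int k * (- m) \<ge> int j * (- m)"
      using assms False by (intro mult_right_mono) auto
    ultimately show ?thesis by simp
  qed simp
  then have "2 * int (qexp j k m) = 2 * int j * m + int k * (2 * int (tri m))"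
    by (simp add: qexp_def)
  then show ?thesis
    by (simp only: two_tri)
qed

lemma qexp_tri: "j \<le> k \<Longrightarrow> int (qexp j k m) = int j * m + int k * int (tri m)"
  using two_qexp[of j k m] unfolding two_tri[symmetric] by (simp add: algebra_simps)

lemma qexp_uminus: "j \<le> k \<Longrightarrow> qexp j k (- m) = qexp (k - j) k m"
  using two_qexp[of j k "- m"] two_qexp[of "k - j" k m] by (simp add: algebra_simps of_nat_diff)

definition qser :: "nat \<Rightarrow> nat \<Rightarrow> 'a::{real_normed_field,banach} \<Rightarrow> 'a" where
  "qser j k q = (\<Sum>\<^sub>\<infinity>m. sgn_pow m * q ^ qexp j k m)"

lemma
  fixes q :: "'a::{real_normed_field,banach}"
  assumes q: "norm q < 1" "q \<noteq> 0" and k: "k > 0" "j \<le> k"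
  shows abs_summable_qexp: "(\<lambda>m. norm (q ^ qexp j k m)) summable_on UNIV"
    and has_sum_qser: "((\<lambda>m. sgn_pow m * q ^ qexp j k m) has_sum qser j k q) UNIV"
    and qser_product: "qser j k q = qpoch_inf (q ^ j) (q ^ k) * qpoch_inf (q ^ (k - j)) (q ^ k) * euler (q ^ k)"
proof -
  have qk: "norm (q ^ k) < 1" "q ^ k \<noteq> 0"
    using q k by (simp_all add: norm_power power_less_one_iff)
  have 1: "q ^ qexp j k m = (q ^ j) powi m * (q ^ k) ^ tri m" for m
  proof -
    have "q ^ qexp j k m = q powi (int j * m + int k * int (tri m))"
      using qexp_tri[OF k(2), of m] by (metis power_int_of_nat)
    also have "\<dots> = (q powi int j) powi m * (q powi int k) powi int (tri m)"
      using q by (simp add: power_int_add power_int_mult)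
    finally show ?thesis by simp
  qed
  show "(\<lambda>m. norm (q ^ qexp j k m)) summable_on UNIV"
    unfolding 1 using abs_summable_theta(2)[OF qk(1)] .
  have "(- (q ^ j)) powi m = sgn_pow m * (q ^ j) powi m" for m
    by (metis mult_minus1 power_int_mult_distrib)
  then have 2: "((\<lambda>m. sgn_pow m * q ^ qexp j k m) has_sum
           (qpoch_inf (q ^ j) (q ^ k) * qpoch_inf (q ^ k / q ^ j) (q ^ k) * euler (q ^ k))) UNIV"
    using jacobi_triple[OF qk, of "q ^ j"] q unfolding 1 by (simp add: mult.assoc)
  then show "((\<lambda>m. sgn_pow m * q ^ qexp j k m) has_sum qser j k q) UNIV"
    unfolding qser_def by (simp add: has_sum_iff)
  show "qser j k q = qpoch_inf (q ^ j) (q ^ k) * qpoch_inf (q ^ (k - j)) (q ^ k) * euler (q ^ k)"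
    using infsumI[OF 2] q k unfolding qser_def by (simp add: power_diff)
qed

lemma norm_sgn_pow [simp]: "norm (sgn_pow m :: 'a::{real_normed_field,banach}) = 1"
  by (simp add: norm_power_int)

lemma sgn_pow_uminus: "sgn_pow (- m) = sgn_pow m"
  by (simp add: power_int_minus flip: power_int_inverse)

lemma qser_sym: "j \<le> k \<Longrightarrow> qser j k q = qser (k - j) k q"
  unfolding qser_def
  by (rule infsum_reindex_bij_witness[where i = uminus and j = uminus]) (simp_all add: sgn_pow_uminus qexp_uminus)

abbreviation "exp_a \<equiv> qexp 1 5"
abbreviation "exp_b \<equiv> qexp 2 5"
abbreviation "rr_a \<equiv> qser 1 5"
abbreviation "rr_b \<equiv> qser 2 5"

text \<open>By the triple product the first factor carries the exponents congruent to 1 and 4 modulo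
  5, the second those congruent to 2 and 3. Both carry the multiples of 5, hence the surplus
  \<open>euler (q ^ 5)\<close>.\<close>

lemma rr_a_mult_rr_b:
  fixes q :: "'a::{real_normed_field,banach}"
  assumes q: "norm q < 1" "q \<noteq> 0"
  shows "rr_a q * rr_b q = euler q * euler (q ^ 5)"
  using qpoch_inf_dissect[OF q(1), of 5 q]
  by (simp add: qser_product q lessThan_Suc numeral_eq_Suc mult_ac)

text \<open>Schur's polynomials: \<open>c = 0\<close> gives the denominators and \<open>c = 2\<close> the numerators of the convergents.
  Applying Pascal's rule twice yields the three-term recurrence up to \<open>schur_rest\<close>, whose terms
  at \<open>l\<close> and \<open>l - 1\<close> cancel.\<close>

definition schur :: "real \<Rightarrow> int \<Rightarrow> nat \<Rightarrow> int \<Rightarrow> real" where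
  "schur q c n l = sgn_pow l * q powi (l * (5 * l + 1 - 2 * c) div 2) * qbinom q n ((int n - 5 * l + c) div 2)"

lemma schur_eq_0:
  assumes "0 \<le> c" "c \<le> 2" "l < - int n - 2 \<or> l > int n + 2"
  shows "schur q c n l = 0"
proof -
  have "(int n - 5 * l + c) div 2 < 0 \<or> (int n - 5 * l + c) div 2 > int n"
    using assms by auto
  then show ?thesis by (simp add: schur_def qbinom_eq_0)
qed

lemma summable_schur: "0 \<le> c \<Longrightarrow> c \<le> 2 \<Longrightarrow> schur q c n summable_on UNIV"
  using schur_eq_0 by (intro summable_finite_supp[of "- int n - 2" "int n + 2"]) auto

text \<open>What two applications of Pascal's rule leave over. The parity tells where the rounded
  lower index moves: from \<open>n + 1\<close> to \<open>n + 2\<close> in the even case, from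
  \<open>n\<close> to \<open>n + 1\<close> in the odd case. Accordingly the two forms of the rule
  are used in opposite order.\<close>

definition schur_rest :: "real \<Rightarrow> int \<Rightarrow> nat \<Rightarrow> int \<Rightarrow> real" where
  "schur_rest q c n l = (let k = (int n + 2 - 5 * l + c) div 2 in
     sgn_pow l * q powi (l * (5 * l + 1 - 2 * c) div 2) *
       (if even (int n + 2 - 5 * l + c) then q powi k * qbinom q n k else q powi (int n + 2 - k) * qbinom q n (k - 2)))"

lemma schur_Suc_Suc:
  assumes q: "0 < q" "q < 1"
  shows "schur q c (Suc (Suc n)) l = schur q c (Suc n) l + q ^ Suc n * schur q c n l + schur_rest q c n l"
proof -
  have q': "norm q < 1" "q \<noteq> 0" using q by auto
  define k where "k = (int n + 2 - 5 * l + c) div 2"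
  have k1: "(int (Suc (Suc n)) - 5 * l + c) div 2 = k" "(int n - 5 * l + c) div 2 = k - 1"
    unfolding k_def by presburger+
  note p1 = qbinom_pascal[OF q'] and p2 = qbinom_pascal'[OF q']
  show ?thesis
  proof (cases "even (int n + 2 - 5 * l + c)")
    case True
    then have "int n + 2 - 5 * l + c = 2 * k" by (simp add: k_def)
    then have "int (Suc n) - 5 * l + c = 2 * (k - 1) + 1" by simp
    then have k2: "(int (Suc n) - 5 * l + c) div 2 = k - 1" by simp
    have "q powi k * q powi (int n + 1 - k) = q ^ Suc n"
      using q' by (simp flip: power_int_add power_int_of_nat add: add.commute)
    then have "qbinom q (Suc (Suc n)) k = qbinom q (Suc n) (k - 1) + q ^ Suc n * qbinom q n (k - 1) + q powi k * qbinom q n k"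
      using p1[of "Suc n" k] p2[of n k] by (simp add: distrib_left mult.assoc[symmetric] del: power_Suc)
    then show ?thesis
      unfolding schur_def schur_rest_def Let_def k1 k2 k_def[symmetric] if_P[OF True] by (simp add: algebra_simps)
  next
    case False
    then have "int n + 2 - 5 * l + c = 2 * k + 1" unfolding k_def by (metis odd_two_times_div_two_succ)
    then have "int (Suc n) - 5 * l + c = 2 * k" by simp
    then have k2: "(int (Suc n) - 5 * l + c) div 2 = k" by simp
    have "q powi (int n + 2 - k) * q powi (k - 1) = q ^ Suc n"
      using q' by (simp flip: power_int_add power_int_of_nat add: add.commute)
    then have "qbinom q (Suc (Suc n)) k = qbinom q (Suc n) k + q ^ Suc n * qbinom q n (k - 1) + q powi (int n + 2 - k) * qbinom q n (k - 2)"
      using p2[of "Suc n" k] p1[of n "k - 1"] by (simp add: algebra_simps)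
    then show ?thesis
      unfolding schur_def schur_rest_def Let_def k1 k2 k_def[symmetric] if_not_P[OF False] by (simp add: algebra_simps)
  qed
qed

text \<open>Passing to \<open>l - 1\<close> adds 5 to the numerator, so the parity flips and
  \<open>k\<close> becomes \<open>k + 2\<close>. The odd branch then contains the same
  \<open>qbinom q n k\<close>, the quadratic exponent compensates the powers of \<open>q\<close>,
  and only the sign changes.\<close>

lemma schur_rest_pair:
  assumes q: "0 < q" "q < 1" and ev: "even (int n + 2 - 5 * l + c)"
  shows "schur_rest q c n (l - 1) = - schur_rest q c n l"
proof -
  define k where "k = (int n + 2 - 5 * l + c) div 2"
  have k: "int n + 2 - 5 * l + c = 2 * k" using ev by (simp add: k_def)
  have 1: "(int n + 2 - 5 * (l - 1) + c) div 2 = k + 2" "odd (int n + 2 - 5 * (l - 1) + c)"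
    using k by presburger+
  define e where "e = l * (5 * l + 1 - 2 * c) div 2"
  have "even (l * (5 * l + 1 - 2 * c))" by auto
  then have e: "l * (5 * l + 1 - 2 * c) = 2 * e" by (simp add: e_def)
  have "(l - 1) * (5 * (l - 1) + 1 - 2 * c) = l * (5 * l + 1 - 2 * c) - 2 * (5 * l - 2 - c)"
    by (simp add: algebra_simps)
  then have e': "(l - 1) * (5 * (l - 1) + 1 - 2 * c) div 2 = e - (5 * l - 2 - c)"
    unfolding e by simp
  have "q powi (e - (5 * l - 2 - c)) * q powi (int n - k) = q powi e * q powi k"
  proof -
    have "e - (5 * l - 2 - c) + (int n - k) = e + k" using k by linarith
    then show ?thesis
      using q by (metis less_irrefl power_int_add)
  qed
  moreover have "sgn_pow (l - 1) = - (sgn_pow l :: real)"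
    by (simp add: power_int_diff)
  ultimately show ?thesis
    unfolding schur_rest_def Let_def e' 1(1) using ev 1(2) by (simp add: k_def[symmetric] e_def[symmetric])
qed

lemma schur_rest_sum:
  assumes q: "0 < q" "q < 1"
  shows "infsum (schur_rest q c n) UNIV = 0"
proof -
  define \<sigma> where "\<sigma> = (\<lambda>l. if even (int n + 2 - 5 * l + c) then l - 1 else l + 1)"
  have \<sigma>: "\<sigma> (\<sigma> l) = l" "schur_rest q c n (\<sigma> l) = - schur_rest q c n l" for l
  proof -
    show "\<sigma> (\<sigma> l) = l" by (auto simp: \<sigma>_def)
    show "schur_rest q c n (\<sigma> l) = - schur_rest q c n l"
    proof (cases "even (int n + 2 - 5 * l + c)")
      case False
      then have "even (int n + 2 - 5 * (l + 1) + c)" by auto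
      then show ?thesis
        using schur_rest_pair[OF q, of n "l + 1" c] False by (simp add: \<sigma>_def)
    qed (use schur_rest_pair[OF q] in \<open>auto simp: \<sigma>_def\<close>)
  qed
  have "infsum (schur_rest q c n) UNIV = infsum (\<lambda>l. schur_rest q c n (\<sigma> l)) UNIV"
    by (rule infsum_reindex_bij_witness[where i = \<sigma> and j = \<sigma>]) (simp_all add: \<sigma>(1))
  also have "\<dots> = - infsum (schur_rest q c n) UNIV"
    by (simp add: \<sigma>(2) infsum_uminus)
  finally show ?thesis by simp
qed

definition schur_poly :: "real \<Rightarrow> int \<Rightarrow> nat \<Rightarrow> real" where
  "schur_poly q c n = infsum (schur q c n) UNIV"

lemma schur_poly_rec:
  assumes q: "0 < q" "q < 1" and c: "0 \<le> c" "c \<le> 2"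
  shows "schur_poly q c (Suc (Suc n)) = schur_poly q c (Suc n) + q ^ Suc n * schur_poly q c n"
proof -
  have "((\<lambda>l. schur q c (Suc (Suc n)) l - (schur q c (Suc n) l + q ^ Suc n * schur q c n l)) has_sum
      (schur_poly q c (Suc (Suc n)) - (schur_poly q c (Suc n) + q ^ Suc n * schur_poly q c n))) UNIV"
    unfolding schur_poly_def
    by (intro has_sum_diff has_sum_add has_sum_cmult_right has_sum_infsum summable_schur c)
  moreover have "(\<lambda>l. schur q c (Suc (Suc n)) l - (schur q c (Suc n) l + q ^ Suc n * schur q c n l)) = schur_rest q c n"
    using schur_Suc_Suc[OF q] by (auto simp: fun_eq_iff)
  ultimately show ?thesis
    using schur_rest_sum[OF q, of c n] infsumI by fastforce
qed

lemma schur_poly_finite: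
  assumes "0 \<le> c" "c \<le> 2"
  shows "schur_poly q c n = (\<Sum>l\<in>{- int n - 2..int n + 2}. schur q c n l)"
proof -
  have "(schur q c n has_sum (\<Sum>l\<in>{- int n - 2..int n + 2}. schur q c n l)) UNIV"
    using schur_eq_0[OF assms] by (intro has_sum_finite_neutralI[of "{- int n - 2..int n + 2}"]) auto
  then show ?thesis
    unfolding schur_poly_def by (rule infsumI)
qed

lemma schur_poly_init:
  assumes q: "0 < q" "q < 1"
  shows "schur_poly q 0 0 = 1" "schur_poly q 0 1 = 1" "schur_poly q 2 0 = 0" "schur_poly q 2 1 = 1"
proof -
  have "qbinom q 0 0 = 1" "qbinom q 1 0 = 1" "qbinom q 1 1 = 1"
    using q qbinom_0[of q] qbinom_same[of q 1] by auto
  then show "schur_poly q 0 0 = 1" "schur_poly q 0 1 = 1" "schur_poly q 2 0 = 0" "schur_poly q 2 1 = 1"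
    by (simp_all add: schur_poly_finite simp_from_to schur_def qbinom_eq_0)
qed

text \<open>The recurrence has nonnegative coefficients. The bound survives in the limit and keeps
  the limit of the denominators away from 0.\<close>

lemma schur_poly_ge_1:
  assumes q: "0 < q" "q < 1"
  shows "schur_poly q 0 n \<ge> 1"
proof (induction n rule: induct_nat_012)
  case (ge2 n)
  show ?case
  proof -
    have "q ^ Suc n * schur_poly q 0 n \<ge> 0"
      using q ge2 by (intro mult_nonneg_nonneg) auto
    then show ?thesis
      using schur_poly_rec[OF q, of 0 n] ge2 by linarith
  qed
qed (use schur_poly_init[OF q] in auto)

lemma schur_poly_tendsto:
  assumes q: "0 < q" "q < 1"
  shows "schur_poly q 0 \<longlonglongrightarrow> rr_b q / euler q" "schur_poly q 2 \<longlonglongrightarrow> rr_a q / euler q"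
proof -
  have q': "norm q < 1" "q \<noteq> 0" using q by auto
  obtain B where B: "\<And>n k. norm (qbinom q n k) \<le> B"
    using qbinom_bounded[OF q'(1)] by blast
  have lim: "(\<lambda>n. qbinom q n ((int n - 5 * l + c) div 2)) \<longlonglongrightarrow> 1 / euler q" for l c
  proof (rule qbinom_tendsto[OF q'(1)])
    show "filterlim (\<lambda>i. (int i - 5 * l + c) div 2) at_top sequentially"
      unfolding filterlim_at_top eventually_at_top_linorder
    proof safe
      fix Z show "\<exists>N. \<forall>n\<ge>N. Z \<le> (int n - 5 * l + c) div 2"
        by (rule exI[of _ "nat \<bar>2 * Z + 5 * l - c\<bar>"]) auto
    qed
    show "filterlim (\<lambda>i. int i - (int i - 5 * l + c) div 2) at_top sequentially"
      unfolding filterlim_at_top eventually_at_top_linorder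
    proof safe
      fix Z show "\<exists>N. \<forall>n\<ge>N. Z \<le> int n - (int n - 5 * l + c) div 2"
        by (rule exI[of _ "nat \<bar>2 * Z - 5 * l + c\<bar>"]) auto
    qed
  qed
  \<comment> \<open>For \<open>c = 2\<close> and \<open>c = 0\<close> the exponents are l(5l - 3)/2
    and l(5l + 1)/2; the second is \<open>exp_b\<close> at the reversed index.\<close>
  have ea: "l * (5 * l + 1 - 2 * 2) div 2 = int (exp_a l)" and eb: "l * (5 * l + 1 - 2 * 0) div 2 = int (exp_b (- l))" for l
  proof -
    have "l * (5 * l + 1 - 2 * 2) = 2 * int (exp_a l)"
      using two_tri[of l] by (simp add: qexp_tri algebra_simps)
    then show "l * (5 * l + 1 - 2 * 2) div 2 = int (exp_a l)" by simp
    have "l * (5 * l + 1 - 2 * 0) = 2 * int (exp_b (- l))"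
      using two_tri[of "- l"] by (simp add: qexp_tri algebra_simps)
    then show "l * (5 * l + 1 - 2 * 0) div 2 = int (exp_b (- l))" by simp
  qed
  have inv: "(f has_sum s) UNIV \<longleftrightarrow> ((\<lambda>l. f (- l)) has_sum s) UNIV" for f :: "int \<Rightarrow> real" and s
    by (rule has_sum_reindex_bij_witness[where i = uminus and j = uminus]) auto
  have b: "((\<lambda>l. sgn_pow l * q ^ exp_b (- l)) has_sum rr_b q) UNIV"
    using has_sum_qser[OF q', of 5 2] inv[of "\<lambda>l. sgn_pow l * q ^ exp_b l"] by (simp add: power_int_minus flip: power_int_inverse)
  have inj: "inj (uminus :: int \<Rightarrow> int)" by (simp add: inj_def)
  have "(\<lambda>l. norm (q ^ exp_b (- l))) summable_on UNIV"
    using abs_summable_qexp[OF q', of 5 2]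
      summable_on_reindex_bij_witness[where S = UNIV and T = UNIV and i = uminus and j = uminus and g = "\<lambda>l. norm (q ^ exp_b (-l))" and h = "\<lambda>l. norm (q ^ exp_b l)"] by simp
  then have sb: "(\<lambda>l. norm (sgn_pow l * q ^ exp_b (- l))) summable_on UNIV"
    by (simp add: norm_mult del: real_norm_def)
  have sa: "(\<lambda>l. norm (sgn_pow l * q ^ exp_a l)) summable_on UNIV"
    using abs_summable_qexp[OF q', of 5 1] by (simp add: norm_mult del: real_norm_def)
  show "schur_poly q 0 \<longlonglongrightarrow> rr_b q / euler q"
    using tannery_int[OF sb B lim[of _ 0]] infsumI[OF b]
    unfolding schur_poly_def schur_def eb by (simp add: fun_eq_iff)
  show "schur_poly q 2 \<longlonglongrightarrow> rr_a q / euler q"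
    using tannery_int[OF sa B lim[of _ 2]]
    unfolding schur_poly_def schur_def ea qser_def by (simp add: fun_eq_iff)
qed

text \<open>\<open>rr_tail\<close> recurses at its outer end, while the recurrence for convergents
  adds a level at the inner end. With an arbitrary innermost value \<open>t\<close>, one more level
  is just a change of \<open>t\<close>.\<close>

primrec rr_ext :: "real \<Rightarrow> nat \<Rightarrow> nat \<Rightarrow> real \<Rightarrow> real" where
  "rr_ext q m 0 t = t"
| "rr_ext q m (Suc n) t = q ^ m / (1 + rr_ext q (Suc m) n t)"

lemma rr_tail_eq_ext: "rr_tail q m n = rr_ext q m n 0"
  by (induction n arbitrary: m) auto

lemma rr_ext_Suc: "rr_ext q m (Suc n) t = rr_ext q m n (q ^ (m + n) / (1 + t))"
proof (induction n arbitrary: m)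
  case (Suc n)
  have "rr_ext q m (Suc (Suc n)) t = q ^ m / (1 + rr_ext q (Suc m) (Suc n) t)"
    by (rule rr_ext.simps)
  then show ?case
    unfolding Suc.IH by simp
qed simp

text \<open>A convergent is a fractional linear function of its tail. All \<open>t \<ge> 0\<close>
  are needed at once because the induction replaces \<open>t\<close> by
  \<open>q ^ Suc n / (1 + t)\<close>.\<close>

lemma rr_ext_schur:
  assumes q: "0 < q" "q < 1" and "t \<ge> 0"
  shows "1 / (1 + rr_ext q 1 n t) = (schur_poly q 2 (Suc n) + t * schur_poly q 2 n) / (schur_poly q 0 (Suc n) + t * schur_poly q 0 n)"
  using assms(3)
proof (induction n arbitrary: t)
  case 0
  then show ?case using schur_poly_init[OF q] by simp
next
  case (Suc n)
  define s where "s = q ^ Suc n / (1 + t)"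
  have s: "s \<ge> 0" using q Suc by (simp add: s_def)
  have step: "(1 + t) * (schur_poly q c (Suc n) + s * schur_poly q c n) = schur_poly q c (Suc (Suc n)) + t * schur_poly q c (Suc n)"
    if "0 \<le> c" "c \<le> 2" for c
    using Suc.prems schur_poly_rec[OF q that] by (simp add: s_def field_simps)
  have "1 / (1 + rr_ext q 1 (Suc n) t) = 1 / (1 + rr_ext q 1 n s)"
    unfolding rr_ext_Suc s_def by simp
  also have "\<dots> = ((1 + t) * (schur_poly q 2 (Suc n) + s * schur_poly q 2 n)) / ((1 + t) * (schur_poly q 0 (Suc n) + s * schur_poly q 0 n))"
    using Suc.prems by (simp only: Suc.IH[OF s]) simp
  also have "\<dots> = (schur_poly q 2 (Suc (Suc n)) + t * schur_poly q 2 (Suc n)) / (schur_poly q 0 (Suc (Suc n)) + t * schur_poly q 0 (Suc n))"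
    unfolding step[of 0, OF order_refl zero_le_numeral] step[of 2, OF zero_le_numeral order_refl] ..
  finally show ?case .
qed

text \<open>The limits of the numerators and denominators are the Rogers-Ramanujan functions H(q) =
  \<open>rr_a q / euler q\<close> and G(q) = \<open>rr_b q / euler q\<close>; the Euler product
  cancels in their quotient.\<close>

theorem rogers_ramanujan_eq:
  assumes q: "0 < q" "q < 1"
  shows "rogers_ramanujan q = root 5 q * rr_a q / rr_b q" "rr_b q / euler q \<ge> 1"
proof -
  have q': "norm q < 1" using q by auto
  show ge: "rr_b q / euler q \<ge> 1"
    using schur_poly_tendsto(1)[OF q] schur_poly_ge_1[OF q] by (intro LIMSEQ_le_const) auto
  have "(\<lambda>n. root 5 q * (schur_poly q 2 (Suc n) / schur_poly q 0 (Suc n))) \<longlonglongrightarrow> root 5 q * ((rr_a q / euler q) / (rr_b q / euler q))"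
    using ge by (intro tendsto_intros LIMSEQ_Suc schur_poly_tendsto q) auto
  moreover have "root 5 q / (1 + rr_tail q 1 n) = root 5 q * (schur_poly q 2 (Suc n) / schur_poly q 0 (Suc n))" for n
    using rr_ext_schur[OF q, of 0 n] by (simp add: rr_tail_eq_ext divide_inverse)
  ultimately show "rogers_ramanujan q = root 5 q * rr_a q / rr_b q"
    unfolding rogers_ramanujan_def using euler_nonzero[OF q'] by (simp add: limI)
qed

section \<open>Five-dissection of the Euler product\<close>

lemma
  fixes f :: "'i \<Rightarrow> 'a::{real_normed_field,banach}" and g :: "'j \<Rightarrow> 'a"
  assumes f: "(\<lambda>x. norm (f x)) summable_on A" and g: "(\<lambda>x. norm (g x)) summable_on B"
  shows abs_summable_times: "(\<lambda>z. norm (f (fst z) * g (snd z))) summable_on A \<times> B"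
    and has_sum_times: "((\<lambda>z. f (fst z) * g (snd z)) has_sum (infsum f A * infsum g B)) (A \<times> B)"
proof -
  show 1: "(\<lambda>z. norm (f (fst z) * g (snd z))) summable_on A \<times> B"
  proof (rule summable_on_SigmaI[where g = "\<lambda>x. norm (f x) * infsum (\<lambda>y. norm (g y)) B"])
    show "((\<lambda>y. norm (f (fst (x, y)) * g (snd (x, y)))) has_sum norm (f x) * (\<Sum>\<^sub>\<infinity>y\<in>B. norm (g y))) B" for x
      using g by (auto simp: norm_mult intro!: has_sum_cmult_right has_sum_infsum)
    show "(\<lambda>x. norm (f x) * (\<Sum>\<^sub>\<infinity>y\<in>B. norm (g y))) summable_on A"
      using f by (rule summable_on_cmult_left)
  qed auto
  have fs: "f summable_on A" and gs: "g summable_on B"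
    using f g by (auto intro: abs_summable_summable)
  show "((\<lambda>z. f (fst z) * g (snd z)) has_sum (infsum f A * infsum g B)) (A \<times> B)"
  proof (rule has_sum_SigmaI[where g = "\<lambda>x. f x * infsum g B"])
    show "((\<lambda>y. f (fst (x, y)) * g (snd (x, y))) has_sum f x * infsum g B) B" for x
      using gs by (auto intro!: has_sum_cmult_right has_sum_infsum)
    show "((\<lambda>x. f x * infsum g B) has_sum infsum f A * infsum g B) A"
      using fs by (intro has_sum_cmult_left has_sum_infsum)
    show "(\<lambda>z. f (fst z) * g (snd z)) summable_on A \<times> B"
      using 1 by (rule abs_summable_summable)
  qed
qed

lemma infsum_finite_partition:
  fixes f :: "'i \<Rightarrow> 'a::banach"
  assumes bij: "bij_betw (\<lambda>(w, z). \<phi> w z) (W \<times> UNIV) UNIV" and W: "finite W" and f: "f summable_on UNIV"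
  shows "infsum f UNIV = (\<Sum>w\<in>W. \<Sum>\<^sub>\<infinity>z. f (\<phi> w z))"
proof -
  have "(\<lambda>x. f (\<phi> (fst x) (snd x))) summable_on (W \<times> UNIV)"
    using f summable_on_reindex_bij_betw[OF bij, of f] by (simp add: case_prod_unfold)
  then have "(\<Sum>\<^sub>\<infinity>w\<in>W. \<Sum>\<^sub>\<infinity>z. f (\<phi> w z)) = (\<Sum>\<^sub>\<infinity>x\<in>W \<times> UNIV. f (\<phi> (fst x) (snd x)))"
    using infsum_Sigma_banach[of "\<lambda>x. f (\<phi> (fst x) (snd x))" W "\<lambda>_. UNIV"] by simp
  also have "\<dots> = infsum f UNIV"
    using infsum_reindex_bij_betw[OF bij, of f] by (simp add: case_prod_unfold)
  finally show ?thesis using W by simp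
qed

section \<open>Double theta series split by parity\<close>

abbreviation even_pairs :: "(int \<times> int) set" where
  "even_pairs \<equiv> {z. even (fst z + snd z)}"

lemma infsum_parity_split:
  fixes f :: "int \<times> int \<Rightarrow> 'a::{real_normed_field,banach}"
  assumes "f summable_on UNIV"
  shows "(\<Sum>\<^sub>\<infinity>z. sgn_pow (fst z + snd z) * f z) = infsum f even_pairs - infsum f (- even_pairs)"
proof -
  have s: "f summable_on A" for A
    by (rule summable_on_subset_banach[OF assms]) simp
  have 1: "((\<lambda>z. sgn_pow (fst z + snd z) * f z) has_sum c) even_pairs \<longleftrightarrow> (f has_sum c) even_pairs" for c
    by (rule has_sum_cong) (simp del: even_add)
  have 2: "((\<lambda>z. sgn_pow (fst z + snd z) * f z) has_sum c) (- even_pairs) \<longleftrightarrow> ((\<lambda>z. - f z) has_sum c) (- even_pairs)" for c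
    by (rule has_sum_cong) (simp del: even_add)
  have "((\<lambda>z. sgn_pow (fst z + snd z) * f z) has_sum infsum f even_pairs) even_pairs"
    unfolding 1 by (rule has_sum_infsum[OF s])
  moreover have "((\<lambda>z. sgn_pow (fst z + snd z) * f z) has_sum (- infsum f (- even_pairs))) (- even_pairs)"
    unfolding 2 by (rule has_sum_uminusI[OF has_sum_infsum[OF s]])
  ultimately have "((\<lambda>z. sgn_pow (fst z + snd z) * f z) has_sum (infsum f even_pairs + - infsum f (- even_pairs)))
     (even_pairs \<union> - even_pairs)"
    by (rule has_sum_Un_disjoint) auto
  then have "((\<lambda>z. sgn_pow (fst z + snd z) * f z) has_sum (infsum f even_pairs - infsum f (- even_pairs))) UNIV"
    by (simp only: Compl_partition diff_conv_add_uminus)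
  then show ?thesis
    by (rule infsumI)
qed

text \<open>A signed series is its even class minus its odd class. The hypotheses match the even
  classes of \<open>f1\<close> and \<open>f3\<close>, the odd classes of \<open>f1\<close> and
  \<open>f2\<close>, and the even class of \<open>f2\<close> with the odd class of
  \<open>f3\<close>; the two odd classes that are left then cancel.\<close>

lemma eisenstein_rearrangement:
  fixes f1 f2 f3 :: "int \<times> int \<Rightarrow> 'a::{real_normed_field,banach}"
  assumes s: "f1 summable_on UNIV" "f2 summable_on UNIV" "f3 summable_on UNIV"
    and 1: "\<And>a b m n. a + b = 2 * m \<Longrightarrow> b - 3 * a = 2 * n \<Longrightarrow> f1 (a, b) = f3 (m, n)"
    and 2: "\<And>a b c d. b - a = 2 * c + 1 \<Longrightarrow> 3 * a + b + 1 = - 2 * d \<Longrightarrow> f1 (a, b) = f2 (c, d)"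
    and 3: "\<And>c d m n. c - d = 2 * m \<Longrightarrow> 3 * c + d + 2 = 2 * n \<Longrightarrow> f2 (c, d) = f3 (m, n)"
  shows "(\<Sum>\<^sub>\<infinity>z. sgn_pow (fst z + snd z) * f1 z) - (\<Sum>\<^sub>\<infinity>z. sgn_pow (fst z + snd z) * f2 z)
       = (\<Sum>\<^sub>\<infinity>z. sgn_pow (fst z + snd z) * f3 z)"
proof -
  have ev: thesis if "z \<in> even_pairs" "\<And>m. fst z + snd z = 2 * m \<Longrightarrow> thesis" for thesis z
    using that unfolding mem_Collect_eq by (metis evenE)
  have od: thesis if "z \<in> - even_pairs" "\<And>m. fst z + snd z = 2 * m + 1 \<Longrightarrow> thesis" for thesis z
    using that unfolding mem_Collect_eq Compl_iff by (metis oddE)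
  \<comment> \<open>Each map and its primed partner parametrise two matched classes by the same pair
    of integers, so the sums can be compared term by term. Here b = 2m - a and n = m - 2a solve the
    first pair of equations.\<close>
  have b1: "bij_betw (\<lambda>(a, m). (a, 2 * m - a)) UNIV even_pairs"
  proof (rule bij_betwI')
    fix z :: "int \<times> int" assume "z \<in> even_pairs"
    then obtain m where "fst z + snd z = 2 * m" by (rule ev)
    then show "\<exists>x\<in>UNIV. z = (case x of (a, m) \<Rightarrow> (a, 2 * m - a))"
      by (intro bexI[of _ "(fst z, m)"]) (auto simp: prod_eq_iff)
  qed auto
  have b1': "bij_betw (\<lambda>(a, m). (m, m - 2 * a)) UNIV even_pairs"
  proof (rule bij_betwI')
    fix z :: "int \<times> int" assume "z \<in> even_pairs"
    then obtain m where "fst z + snd z = 2 * m" by (rule ev)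
    then show "\<exists>x\<in>UNIV. z = (case x of (a, m) \<Rightarrow> (m, m - 2 * a))"
      by (intro bexI[of _ "(fst z - m, fst z)"]) (auto simp: prod_eq_iff)
  qed auto
  have b2: "bij_betw (\<lambda>(a, c). (a, a + 2 * c + 1)) UNIV (- even_pairs)"
  proof (rule bij_betwI')
    fix z :: "int \<times> int" assume "z \<in> - even_pairs"
    then obtain m where "fst z + snd z = 2 * m + 1" by (rule od)
    then show "\<exists>x\<in>UNIV. z = (case x of (a, c) \<Rightarrow> (a, a + 2 * c + 1))"
      by (intro bexI[of _ "(fst z, m - fst z)"]) (auto simp: prod_eq_iff)
  qed auto
  have b2': "bij_betw (\<lambda>(a, c). (c, - 2 * a - c - 1)) UNIV (- even_pairs)"
  proof (rule bij_betwI')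
    fix z :: "int \<times> int" assume "z \<in> - even_pairs"
    then obtain m where "fst z + snd z = 2 * m + 1" by (rule od)
    then show "\<exists>x\<in>UNIV. z = (case x of (a, c) \<Rightarrow> (c, - 2 * a - c - 1))"
      by (intro bexI[of _ "(- m - 1, fst z)"]) (auto simp: prod_eq_iff)
  qed auto
  have b3: "bij_betw (\<lambda>(d, m). (d + 2 * m, d)) UNIV even_pairs"
  proof (rule bij_betwI')
    fix z :: "int \<times> int" assume "z \<in> even_pairs"
    then obtain m where "fst z + snd z = 2 * m" by (rule ev)
    then show "\<exists>x\<in>UNIV. z = (case x of (d, m) \<Rightarrow> (d + 2 * m, d))"
      by (intro bexI[of _ "(snd z, m - snd z)"]) (auto simp: prod_eq_iff)
  qed auto
  have b3': "bij_betw (\<lambda>(d, m). (m, 2 * d + 3 * m + 1)) UNIV (- even_pairs)"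
  proof (rule bij_betwI')
    fix z :: "int \<times> int" assume "z \<in> - even_pairs"
    then obtain m where "fst z + snd z = 2 * m + 1" by (rule od)
    then show "\<exists>x\<in>UNIV. z = (case x of (d, m) \<Rightarrow> (m, 2 * d + 3 * m + 1))"
      by (intro bexI[of _ "(m - 2 * fst z, fst z)"]) (auto simp: prod_eq_iff)
  qed auto
  have "infsum f1 even_pairs = infsum f3 even_pairs"
    unfolding infsum_reindex_bij_betw[OF b1, symmetric, of f1] infsum_reindex_bij_betw[OF b1', symmetric, of f3]
    by (intro infsum_cong) (auto intro!: 1)
  moreover have "infsum f1 (- even_pairs) = infsum f2 (- even_pairs)"
    unfolding infsum_reindex_bij_betw[OF b2, symmetric, of f1] infsum_reindex_bij_betw[OF b2', symmetric, of f2]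
    by (intro infsum_cong) (auto intro!: 2)
  moreover have "infsum f2 even_pairs = infsum f3 (- even_pairs)"
    unfolding infsum_reindex_bij_betw[OF b3, symmetric, of f2] infsum_reindex_bij_betw[OF b3', symmetric, of f3]
    by (intro infsum_cong) (auto intro!: 3)
  ultimately show ?thesis
    by (simp add: infsum_parity_split s)
qed

lemma has_sum_sgn_times:
  fixes f g :: "int \<Rightarrow> 'a::{real_normed_field,banach}"
  assumes "(\<lambda>m. norm (f m)) summable_on UNIV" "(\<lambda>m. norm (g m)) summable_on UNIV"
  shows "(\<lambda>z. f (fst z) * g (snd z)) summable_on UNIV"
    and "(\<Sum>\<^sub>\<infinity>z. sgn_pow (fst z + snd z) * (f (fst z) * g (snd z)))
          = (\<Sum>\<^sub>\<infinity>m. sgn_pow m * f m) * (\<Sum>\<^sub>\<infinity>m. sgn_pow m * g m)"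
proof -
  show "(\<lambda>z. f (fst z) * g (snd z)) summable_on UNIV"
    using abs_summable_summable[OF abs_summable_times[OF assms]] by simp
  have "((\<lambda>z. sgn_pow (fst z) * f (fst z) * (sgn_pow (snd z) * g (snd z))) has_sum
     (\<Sum>\<^sub>\<infinity>m. sgn_pow m * f m) * (\<Sum>\<^sub>\<infinity>m. sgn_pow m * g m)) (UNIV \<times> UNIV)"
    by (rule has_sum_times) (use assms in \<open>simp_all add: norm_mult\<close>)
  from infsumI[OF this] show "(\<Sum>\<^sub>\<infinity>z. sgn_pow (fst z + snd z) * (f (fst z) * g (snd z)))
          = (\<Sum>\<^sub>\<infinity>m. sgn_pow m * f m) * (\<Sum>\<^sub>\<infinity>m. sgn_pow m * g m)"
    by (simp add: power_int_add mult_ac)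
qed

lemma two_int_cancel: "2 * int m = 2 * int n \<Longrightarrow> m = n"
  by simp

lemma ten_qexp: "10 * int (qexp 2 3 m) = 5 * (4 * m + 3 * (m * (m - 1)))"
  using two_qexp[of 2 3 m] by simp

text \<open>Writing the exponents through \<open>s\<^sup>2 + 3 t\<^sup>2\<close>, the three hypotheses on exponents are multiplication of
  \<open>s + t \<surd>-3\<close> by the cube roots of unity.\<close>

lemma qser_eisenstein:
  fixes q :: "'a::{real_normed_field,banach}"
  assumes q: "norm q < 1" "q \<noteq> 0" and j: "i \<le> 15" "j \<le> 5" "l \<le> 5"
    and f: "(\<lambda>c. norm (q ^ f c)) summable_on UNIV"
    and 1: "\<And>a m. qexp i 15 a + qexp j 5 (2 * m - a) = 5 * qexp 2 3 m + qexp l 5 (m - 2 * a)"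
    and 2: "\<And>a c. qexp i 15 a + qexp j 5 (a + 2 * c + 1) = f c + qexp j 5 (- 2 * a - c - 1)"
    and 3: "\<And>d m. f (d + 2 * m) + qexp j 5 d = 5 * qexp 2 3 m + qexp l 5 (2 * d + 3 * m + 1)"
  shows "(qser i 15 q - (\<Sum>\<^sub>\<infinity>c. sgn_pow c * q ^ f c)) * qser j 5 q = qser 2 3 (q ^ 5) * qser l 5 q"
proof -
  have q5: "norm (q ^ 5) < 1" "q ^ 5 \<noteq> 0"
    using q by (simp_all add: norm_power power_less_one_iff)
  have s: "(\<lambda>m. norm (q ^ qexp i 15 m)) summable_on UNIV" "(\<lambda>m. norm (q ^ qexp j 5 m)) summable_on UNIV"
    "(\<lambda>m. norm (q ^ qexp l 5 m)) summable_on UNIV" "(\<lambda>m. norm ((q ^ 5) ^ qexp 2 3 m)) summable_on UNIV"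
    by (rule abs_summable_qexp[OF q] abs_summable_qexp[OF q5]; use j in simp)+
  have "(\<Sum>\<^sub>\<infinity>z. sgn_pow (fst z + snd z) * (q ^ qexp i 15 (fst z) * q ^ qexp j 5 (snd z)))
      - (\<Sum>\<^sub>\<infinity>z. sgn_pow (fst z + snd z) * (q ^ f (fst z) * q ^ qexp j 5 (snd z)))
      = (\<Sum>\<^sub>\<infinity>z. sgn_pow (fst z + snd z) * ((q ^ 5) ^ qexp 2 3 (fst z) * q ^ qexp l 5 (snd z)))"
  proof (rule eisenstein_rearrangement; (intro has_sum_sgn_times s f)?)
    fix a b m n :: int
    assume "a + b = 2 * m" "b - 3 * a = 2 * n"
    then have "b = 2 * m - a" "n = m - 2 * a" by auto
    then show "q ^ qexp i 15 (fst (a, b)) * q ^ qexp j 5 (snd (a, b)) = (q ^ 5) ^ qexp 2 3 (fst (m, n)) * q ^ qexp l 5 (snd (m, n))"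
      using 1[of a m] by (simp flip: power_add power_mult)
  next
    fix a b c d :: int
    assume "b - a = 2 * c + 1" "3 * a + b + 1 = - 2 * d"
    then have "b = a + 2 * c + 1" "d = - 2 * a - c - 1" by auto
    then show "q ^ qexp i 15 (fst (a, b)) * q ^ qexp j 5 (snd (a, b)) = q ^ f (fst (c, d)) * q ^ qexp j 5 (snd (c, d))"
      using 2[of a c] by (simp flip: power_add)
  next
    fix c d m n :: int
    assume "c - d = 2 * m" "3 * c + d + 2 = 2 * n"
    then have "c = d + 2 * m" "n = 2 * d + 3 * m + 1" by auto
    then show "q ^ f (fst (c, d)) * q ^ qexp j 5 (snd (c, d)) = (q ^ 5) ^ qexp 2 3 (fst (m, n)) * q ^ qexp l 5 (snd (m, n))"
      using 3[of d m] by (simp flip: power_add power_mult)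
  qed
  then show ?thesis
    unfolding has_sum_sgn_times(2)[OF s(1,2)] has_sum_sgn_times(2)[OF f s(2)] has_sum_sgn_times(2)[OF s(4,3)]
    by (simp add: qser_def algebra_simps)
qed

text \<open>An instance of the quintuple product identity; for q = p^5 the bracket is the part of
  \<open>euler p\<close> with exponents divisible by 5.\<close>

lemma qser_quintuple_a:
  fixes q :: "'a::{real_normed_field,banach}"
  assumes q: "norm q < 1" "q \<noteq> 0"
  shows "(qser 8 15 q + q * qser 13 15 q) * rr_a q = qser 2 3 (q ^ 5) * rr_b q"
proof -
  \<comment> \<open>Reflecting the index by c -> -c - 1 reverses \<open>sgn_pow\<close>, which turns
    the series subtracted in \<open>qser_eisenstein\<close> into the one added here.\<close>
  let ?f = "\<lambda>c::int. Suc (qexp 13 15 (- c - 1))"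
  have bij: "bij_betw (\<lambda>c::int. - c - 1) UNIV UNIV"
    by (rule bij_betwI[where g = "\<lambda>c. - c - 1"]) auto
  have "(\<lambda>c. norm (q ^ qexp 13 15 (- c - 1))) summable_on UNIV"
    using abs_summable_qexp[OF q, of 15 13] summable_on_reindex_bij_betw[OF bij, of "\<lambda>c. norm (q ^ qexp 13 15 c)"] by simp
  from summable_on_cmult_right[OF this, of "norm q"]
  have f: "(\<lambda>c. norm (q ^ ?f c)) summable_on UNIV"
    by (simp add: norm_mult)
  have "(\<Sum>\<^sub>\<infinity>c. sgn_pow c * q ^ ?f c) = (\<Sum>\<^sub>\<infinity>c. - q * (sgn_pow (- c - 1) * q ^ qexp 13 15 (- c - 1)))"
    by (intro infsum_cong) (simp add: power_int_diff sgn_pow_uminus)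
  also have "\<dots> = (\<Sum>\<^sub>\<infinity>c. - q * (sgn_pow c * q ^ qexp 13 15 c))"
    by (rule infsum_reindex_bij_betw[OF bij])
  also have "\<dots> = - q * qser 13 15 q"
    unfolding qser_def by (rule infsum_cmult_right')
  finally have S: "(\<Sum>\<^sub>\<infinity>c. sgn_pow c * q ^ ?f c) = - q * qser 13 15 q" .
  \<comment> \<open>The residues 4 and 3 stand for 1 and 2 with reversed index; in this form the
    three linear substitutions match the exponents.\<close>
  have "(qser 8 15 q - (\<Sum>\<^sub>\<infinity>c. sgn_pow c * q ^ ?f c)) * qser 4 5 q = qser 2 3 (q ^ 5) * qser 3 5 q"
    by (rule qser_eisenstein[OF q _ _ _ f]; (rule two_int_cancel)?)
       (simp_all add: two_qexp ten_qexp algebra_simps)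
  then show ?thesis
    unfolding S using qser_sym[of 4 5 q] qser_sym[of 3 5 q] by simp
qed

text \<open>The companion for the exponents congruent to 2 modulo 5. No reflection occurs, so the
  series keeps its minus sign.\<close>

lemma qser_quintuple_b:
  fixes q :: "'a::{real_normed_field,banach}"
  assumes q: "norm q < 1" "q \<noteq> 0"
  shows "(qser 11 15 q - q * qser 14 15 q) * rr_b q = qser 2 3 (q ^ 5) * rr_a q"
proof -
  let ?f = "\<lambda>c::int. Suc (qexp 14 15 c)"
  have f: "(\<lambda>c. norm (q ^ ?f c)) summable_on UNIV"
    using summable_on_cmult_right[OF abs_summable_qexp[OF q, of 15 14], of "norm q"] by (simp add: norm_mult)
  have S: "(\<Sum>\<^sub>\<infinity>c. sgn_pow c * q ^ ?f c) = q * qser 14 15 q"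
    unfolding qser_def infsum_cmult_right'[symmetric] by (simp add: mult.left_commute)
  have "(qser 11 15 q - (\<Sum>\<^sub>\<infinity>c. sgn_pow c * q ^ ?f c)) * qser 3 5 q = qser 2 3 (q ^ 5) * qser 1 5 q"
    by (rule qser_eisenstein[OF q _ _ _ f]; (rule two_int_cancel)?)
       (simp_all add: two_qexp ten_qexp algebra_simps)
  then show ?thesis
    unfolding S using qser_sym[of 3 5 q] by simp
qed

section \<open>Pentagonal exponents modulo 5\<close>

lemma euler_pentagonal:
  fixes q :: "'a::{real_normed_field,banach}"
  assumes q: "norm q < 1" "q \<noteq> 0"
  shows "qser 1 3 q = euler q"
  using qpoch_inf_dissect[OF q(1), of 3 q]
  by (simp add: qser_product q lessThan_Suc numeral_eq_Suc mult_ac)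

lemma infsum_int_residues5:
  fixes f :: "int \<Rightarrow> 'a::{real_normed_field,banach}"
  assumes "f summable_on UNIV"
  shows "infsum f UNIV = (\<Sum>r\<in>{0,1,-1,-2,-3}. \<Sum>\<^sub>\<infinity>k. f (r - 5 * k))"
proof -
  have bij: "bij_betw (\<lambda>(r, k). r - 5 * k) ({0,1,-1,-2,-3} \<times> UNIV) (UNIV :: int set)"
  proof (rule bij_betwI')
    fix x y :: "int \<times> int"
    assume "x \<in> {0,1,-1,-2,-3} \<times> UNIV" "y \<in> {0,1,-1,-2,-3} \<times> UNIV"
    then show "((case x of (r, k) \<Rightarrow> r - 5 * k) = (case y of (r, k) \<Rightarrow> r - 5 * k)) = (x = y)"
      by auto presburger+
  next
    fix m :: int
    have "m mod 5 \<in> {0,1,2,3,4}" by auto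
    then consider "m = 0 + 5 * (m div 5)" | "m = 1 + 5 * (m div 5)" | "m = 2 + 5 * (m div 5)"
      | "m = 3 + 5 * (m div 5)" | "m = 4 + 5 * (m div 5)"
      by (metis empty_iff insert_iff mult_div_mod_eq add.commute)
    then show "\<exists>x\<in>{0,1,-1,-2,-3} \<times> UNIV. m = (case x of (r, k) \<Rightarrow> r - 5 * k)"
    proof cases
      case 1 then show ?thesis by (intro bexI[of _ "(0, - (m div 5))"]) auto
    next
      case 2 then show ?thesis by (intro bexI[of _ "(1, - (m div 5))"]) auto
    next
      case 3 then show ?thesis by (intro bexI[of _ "(-3, - (m div 5) - 1)"]) auto
    next
      case 4 then show ?thesis by (intro bexI[of _ "(-2, - (m div 5) - 1)"]) auto
    next
      case 5 then show ?thesis by (intro bexI[of _ "(-1, - (m div 5) - 1)"]) auto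
    qed
  qed auto
  show ?thesis
    by (rule infsum_finite_partition[OF bij _ assms]) simp
qed

text \<open>Pentagonal exponents e satisfy 24e + 1 = (6m - 1)^2, so they are 0, 1 or 2 modulo 5. If
  m is 1 modulo 5 then 6m - 1 is a multiple of 5, and that class is again a pentagonal series, in
  p^25.\<close>

lemma euler_dissection:
  fixes p :: "'a::{real_normed_field,banach}"
  assumes p: "norm p < 1" "p \<noteq> 0"
  shows "euler p = (qser 8 15 (p ^ 5) + p ^ 5 * qser 13 15 (p ^ 5)) - p * euler ((p ^ 5) ^ 5)
     - p\<^sup>2 * (qser 11 15 (p ^ 5) - p ^ 5 * qser 14 15 (p ^ 5))"
proof -
  have q: "norm (p ^ 5) < 1" "p ^ 5 \<noteq> 0" "norm ((p ^ 5) ^ 5) < 1" "(p ^ 5) ^ 5 \<noteq> 0"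
    using p by (simp_all add: norm_power power_less_one_iff)
  let ?f = "\<lambda>m. sgn_pow m * p ^ qexp 1 3 m"
  have bij: "bij_betw (\<lambda>c::int. - c - 1) UNIV UNIV"
    by (rule bij_betwI[where g = "\<lambda>c. - c - 1"]) auto
  have sgn: "sgn_pow (r - 5 * k) = (sgn_pow r * sgn_pow k :: 'a)" for r k
  proof -
    have "(sgn_pow (5 * k) :: 'a) = sgn_pow k"
      by (cases "even k") auto
    then show ?thesis
      using power_int_diff[of "-1 :: 'a" r "5 * k"] by (cases "even k") auto
  qed
  have part: "(\<Sum>\<^sub>\<infinity>k. ?f (r - 5 * k)) = sgn_pow r * p ^ c * qser i j (p ^ l)"
    if "\<And>k. int (qexp 1 3 (r - 5 * k)) = int c + int l * int (qexp i j k)" for r c i j l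
  proof -
    have "qexp 1 3 (r - 5 * k) = c + l * qexp i j k" for k
      using that[of k] by (metis of_nat_add of_nat_eq_iff of_nat_mult)
    then have "?f (r - 5 * k) = sgn_pow r * p ^ c * (sgn_pow k * (p ^ l) ^ qexp i j k)" for k
      by (simp add: sgn power_add power_mult)
    then show ?thesis
      by (simp add: infsum_cmult_right' qser_def)
  qed
  have "(\<Sum>\<^sub>\<infinity>k. ?f (0 - 5 * k)) = qser 8 15 (p ^ 5)"
  proof -
    have "int (qexp 1 3 (0 - 5 * k)) = int 0 + int 5 * int (qexp 8 15 k)" for k
      using two_qexp[of 1 3 "0 - 5 * k"] two_qexp[of 8 15 k] by (simp add: algebra_simps)
    from part[OF this] show ?thesis by simp
  qed
  moreover have "(\<Sum>\<^sub>\<infinity>k. ?f (1 - 5 * k)) = - p * euler ((p ^ 5) ^ 5)"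
  proof -
    have "int (qexp 1 3 (1 - 5 * k)) = int 1 + int 25 * int (qexp 1 3 k)" for k
      using two_qexp[of 1 3 "1 - 5 * k"] two_qexp[of 1 3 k] by (simp add: algebra_simps)
    from part[OF this] show ?thesis using euler_pentagonal[OF q(3,4)] by (simp flip: power_mult)
  qed
  moreover have "(\<Sum>\<^sub>\<infinity>k. ?f (-1 - 5 * k)) = - (p\<^sup>2 * qser 11 15 (p ^ 5))"
  proof -
    have "int (qexp 1 3 (-1 - 5 * k)) = int 2 + int 5 * int (qexp 11 15 k)" for k
      using two_qexp[of 1 3 "-1 - 5 * k"] two_qexp[of 11 15 k] by (simp add: algebra_simps)
    from part[OF this] show ?thesis by (simp add: power_int_minus)
  qed
  moreover have "(\<Sum>\<^sub>\<infinity>k. ?f (-2 - 5 * k)) = p ^ 7 * qser 14 15 (p ^ 5)"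
  proof -
    have "int (qexp 1 3 (-2 - 5 * k)) = int 7 + int 5 * int (qexp 14 15 k)" for k
      using two_qexp[of 1 3 "-2 - 5 * k"] two_qexp[of 14 15 k] by (simp add: algebra_simps)
    from part[OF this] show ?thesis by (simp add: power_int_minus)
  qed
  moreover have "(\<Sum>\<^sub>\<infinity>k. ?f (-3 - 5 * k)) = p ^ 5 * qser 13 15 (p ^ 5)"
  proof -
    \<comment> \<open>The reflection k -> -k - 1 changes the representative -3 into 2, whose
      exponents are 5 plus five times those of \<open>qser 13 15\<close>; it leaves the overall sign
      positive.\<close>
    have "(\<Sum>\<^sub>\<infinity>k. ?f (-3 - 5 * k)) = (\<Sum>\<^sub>\<infinity>k. ?f (-3 - 5 * (- k - 1)))"
      using infsum_reindex_bij_betw[OF bij, of "\<lambda>k. ?f (-3 - 5 * k)"] by simp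
    also have "\<dots> = (\<Sum>\<^sub>\<infinity>k. p ^ 5 * (sgn_pow k * (p ^ 5) ^ qexp 13 15 k))"
    proof (rule infsum_cong)
      fix k :: int
      have "2 * int (qexp 1 3 (-3 - 5 * (- k - 1))) = 2 * int (5 + 5 * qexp 13 15 k)"
        using two_qexp[of 1 3 "-3 - 5 * (- k - 1)"] two_qexp[of 13 15 k] by (simp add: algebra_simps)
      then have "qexp 1 3 (-3 - 5 * (- k - 1)) = 5 + 5 * qexp 13 15 k" by (rule two_int_cancel)
      moreover have "sgn_pow (-3 - 5 * (- k - 1)) = (sgn_pow k :: 'a)"
        by (cases "even k") auto
      ultimately show "?f (-3 - 5 * (- k - 1)) = p ^ 5 * (sgn_pow k * (p ^ 5) ^ qexp 13 15 k)"
        by (simp add: power_add power_mult)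
    qed
    also have "\<dots> = p ^ 5 * qser 13 15 (p ^ 5)"
      unfolding qser_def by (rule infsum_cmult_right')
    finally show ?thesis .
  qed
  moreover have "euler p = (\<Sum>r\<in>{0,1,-1,-2,-3}. \<Sum>\<^sub>\<infinity>k. ?f (r - 5 * k))"
    unfolding euler_pentagonal[OF p, symmetric] qser_def
    by (rule infsum_int_residues5) (use has_sum_qser[OF p, of 3 1] in \<open>auto simp: has_sum_iff\<close>)
  ultimately show ?thesis
    by (simp add: algebra_simps eval_nat_numeral)
qed

text \<open>The two quintuple identities make the outer coefficients
  \<open>euler ((p ^ 5) ^ 5)\<close> times T and 1/T, so the dissection has a single parameter. For
  the real fifth root p of q, T is p divided by the continued fraction.\<close>

lemma euler_dissection_quotient:
  fixes p :: "'a::{real_normed_field,banach}"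
  assumes p: "norm p < 1" "p \<noteq> 0" and T: "T = rr_b (p ^ 5) / rr_a (p ^ 5)"
  shows "T \<noteq> 0" "euler p = euler ((p ^ 5) ^ 5) * (T - p - p\<^sup>2 / T)"
proof -
  define q where "q = p ^ 5"
  have q: "norm q < 1" "q \<noteq> 0" "norm (q ^ 5) < 1" "q ^ 5 \<noteq> 0"
    using p by (simp_all add: norm_power power_less_one_iff q_def)
  have nz: "rr_a q \<noteq> 0" "rr_b q \<noteq> 0"
    using rr_a_mult_rr_b[OF q(1,2)] euler_nonzero[OF q(1)] euler_nonzero[OF q(3)] by auto
  then show "T \<noteq> 0" using T by (simp add: q_def)
  have T': "T = rr_b q / rr_a q" using T by (simp add: q_def)
  have e: "qser 2 3 (q ^ 5) = euler (q ^ 5)"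
    using qser_sym[of 2 3 "q ^ 5"] euler_pentagonal[OF q(3,4)] by simp
  have "qser 8 15 q + q * qser 13 15 q = euler (q ^ 5) * T"
    using qser_quintuple_a[OF q(1,2)] nz unfolding T' e
    by (metis nonzero_eq_divide_eq times_divide_eq_right)
  moreover have "qser 11 15 q - q * qser 14 15 q = euler (q ^ 5) / T"
    using qser_quintuple_b[OF q(1,2)] nz unfolding T' e
    by (metis nonzero_eq_divide_eq divide_divide_eq_right)
  ultimately show "euler p = euler ((p ^ 5) ^ 5) * (T - p - p\<^sup>2 / T)"
    using euler_dissection[OF p] unfolding q_def by (simp add: algebra_simps)
qed

section \<open>Products over the fifth roots of unity\<close>

lemma prod_fifth_roots:
  fixes \<omega> x y :: "'a::field"
  assumes "1 + \<omega> + \<omega>\<^sup>2 + \<omega> ^ 3 + \<omega> ^ 4 = 0"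
  shows "(\<Prod>j<5. x - \<omega> ^ j * y) = x ^ 5 - y ^ 5"
proof -
  have "(\<Prod>j<5. x - \<omega> ^ j * y) = (x - y) * (x - \<omega> * y) * (x - \<omega>\<^sup>2 * y) * (x - \<omega> ^ 3 * y) * (x - \<omega> ^ 4 * y)"
    by (simp add: eval_nat_numeral lessThan_Suc mult_ac)
  also have "\<dots> = x ^ 5 - y ^ 5"
    using assms by algebra
  finally show ?thesis .
qed

lemma qpoch_inf_prod_fifth_roots:
  fixes \<omega> q :: "'a::{real_normed_field,banach}"
  assumes "norm q < 1" and \<omega>: "1 + \<omega> + \<omega>\<^sup>2 + \<omega> ^ 3 + \<omega> ^ 4 = 0"
  shows "(\<Prod>j<5. qpoch_inf (\<omega> ^ j * y) q) = qpoch_inf (y ^ 5) (q ^ 5)"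
proof (rule LIMSEQ_unique)
  show "(\<lambda>n. \<Prod>j<5. qpoch (\<omega> ^ j * y) q n) \<longlonglongrightarrow> (\<Prod>j<5. qpoch_inf (\<omega> ^ j * y) q)"
    by (intro tendsto_prod qpoch_tendsto assms)
  have "(\<Prod>j<5. qpoch (\<omega> ^ j * y) q n) = qpoch (y ^ 5) (q ^ 5) n" for n
  proof -
    have "(\<Prod>j<5. qpoch (\<omega> ^ j * y) q n) = (\<Prod>i<n. \<Prod>j<5. 1 - \<omega> ^ j * (y * q ^ i))"
      unfolding qpoch_def by (subst prod.swap) (simp add: mult.assoc)
    then show ?thesis
      by (simp add: prod_fifth_roots[OF \<omega>] qpoch_def power_mult_distrib power_mult[symmetric] mult.commute[of 5])
  qed
  moreover have "norm (q ^ 5) < 1"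
    using assms by (simp add: norm_power power_less_one_iff)
  ultimately show "(\<lambda>n. \<Prod>j<5. qpoch (\<omega> ^ j * y) q n) \<longlonglongrightarrow> qpoch_inf (y ^ 5) (q ^ 5)"
    by (simp add: qpoch_tendsto)
qed

lemma fifth_root_powers:
  fixes \<zeta> :: "'a::field"
  assumes "\<zeta> ^ 5 = 1" "\<zeta> \<noteq> 1" "0 < c" "c < 5"
  shows "1 + \<zeta> ^ c + (\<zeta> ^ c)\<^sup>2 + (\<zeta> ^ c) ^ 3 + (\<zeta> ^ c) ^ 4 = 0"
proof -
  have "c \<in> {1,2,3,4}" using assms by auto
  moreover have "\<zeta>\<^sup>2 \<noteq> 1"
  proof
    assume h: "\<zeta>\<^sup>2 = 1"
    have "\<zeta> ^ 5 = \<zeta>\<^sup>2 * (\<zeta>\<^sup>2 * \<zeta>)" by (simp add: eval_nat_numeral)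
    then show False using assms(1,2) unfolding h by simp
  qed
  moreover have "\<zeta> ^ 3 \<noteq> 1"
  proof
    assume h: "\<zeta> ^ 3 = 1"
    have "\<zeta> ^ 5 * \<zeta> = \<zeta> ^ 3 * \<zeta> ^ 3" by (simp add: eval_nat_numeral)
    then show False using assms(1,2) unfolding h by simp
  qed
  moreover have "\<zeta> ^ 4 \<noteq> 1"
  proof
    assume h: "\<zeta> ^ 4 = 1"
    have "\<zeta> ^ 5 = \<zeta> ^ 4 * \<zeta>" by (simp add: eval_nat_numeral)
    then show False using assms(1,2) unfolding h by simp
  qed
  ultimately have "\<zeta> ^ c \<noteq> 1"
    using assms(2) by auto
  moreover have "(\<zeta> ^ c - 1) * (1 + \<zeta> ^ c + (\<zeta> ^ c)\<^sup>2 + (\<zeta> ^ c) ^ 3 + (\<zeta> ^ c) ^ 4) = (\<zeta> ^ 5) ^ c - 1"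
    by (simp add: algebra_simps eval_nat_numeral power_mult_distrib)
  ultimately show ?thesis
    using assms(1) by simp
qed

text \<open>Put q = p^5 and split every factor by residues of exponents modulo 5. The multiples of 5
  do not see the root of unity and give \<open>euler q ^ 5\<close>. In each other class the product
  over \<open>j\<close> runs through all fifth roots, and the four classes together give
  \<open>euler q\<close> without its multiples of 5, which is
  \<open>euler q / euler (q ^ 5)\<close>.\<close>

lemma euler_prod_fifth_roots:
  fixes p \<zeta> :: "'a::{real_normed_field,banach}"
  assumes "norm p < 1" and \<zeta>: "\<zeta> ^ 5 = 1" "\<zeta> \<noteq> 1"
  shows "(\<Prod>j<5. euler (\<zeta> ^ j * p)) = euler (p ^ 5) ^ 6 / euler ((p ^ 5) ^ 5)"
proof -
  define q where "q = p ^ 5"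
  have q: "norm q < 1" "norm (q ^ 5) < 1"
    using assms by (simp_all add: norm_power power_less_one_iff q_def)
  have n: "norm (\<zeta> ^ j * p) < 1" for j
  proof -
    have "norm \<zeta> ^ 5 = 1" using \<zeta> by (metis norm_one norm_power)
    then have "norm \<zeta> = 1" using power_eq_iff_eq_base[of 5 "norm \<zeta>" 1] by simp
    then show ?thesis using assms by (simp add: norm_mult norm_power)
  qed
  have swap: "(x ^ a) ^ b = (x ^ b) ^ a" for x :: 'a and a b
    by (simp add: mult.commute flip: power_mult)
  have "euler (\<zeta> ^ j * p) = (\<Prod>i<5. qpoch_inf ((\<zeta> ^ Suc i) ^ j * p ^ Suc i) q)" for j
  proof -
    have "(\<zeta> ^ j * p) ^ 5 = q"
      using \<zeta>(1) swap[of \<zeta> j 5] by (simp add: q_def power_mult_distrib)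
    moreover have "\<zeta> ^ j * p * (\<zeta> ^ j * p) ^ i = (\<zeta> ^ Suc i) ^ j * p ^ Suc i" for i
      by (simp add: power_mult_distrib swap[of \<zeta> j] mult_ac)
    ultimately show ?thesis
      using qpoch_inf_dissect[OF n[of j], of 5 "\<zeta> ^ j * p", OF zero_less_numeral] by (simp only:)
  qed
  then have "(\<Prod>j<5. euler (\<zeta> ^ j * p)) = (\<Prod>j<5. \<Prod>i<5. qpoch_inf ((\<zeta> ^ Suc i) ^ j * p ^ Suc i) q)"
    by (simp only:)
  also have "\<dots> = (\<Prod>i<5. \<Prod>j<5. qpoch_inf ((\<zeta> ^ Suc i) ^ j * p ^ Suc i) q)"
    by (rule prod.swap)
  \<comment> \<open>Index 4 belongs to the multiples of 5: \<open>\<zeta> ^ 5 = 1\<close> makes its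
    five factors all equal to \<open>euler q\<close>.\<close>
  also have "\<dots> = (\<Prod>i<4. \<Prod>j<5. qpoch_inf ((\<zeta> ^ Suc i) ^ j * p ^ Suc i) q) * euler q ^ 5"
    using \<zeta>(1) by (simp add: prod.lessThan_Suc[of _ 4, simplified] q_def flip: power_Suc)
      (intro disjI2, simp add: eval_nat_numeral mult_ac)
  also have "(\<Prod>i<4. \<Prod>j<5. qpoch_inf ((\<zeta> ^ Suc i) ^ j * p ^ Suc i) q) = (\<Prod>i<4. qpoch_inf (q * q ^ i) (q ^ 5))"
  proof (rule prod.cong[OF refl])
    fix i :: nat assume "i \<in> {..<4}"
    then have "(\<Prod>j<5. qpoch_inf ((\<zeta> ^ Suc i) ^ j * p ^ Suc i) q) = qpoch_inf ((p ^ Suc i) ^ 5) (q ^ 5)"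
      by (intro qpoch_inf_prod_fifth_roots q fifth_root_powers \<zeta>) auto
    also have "(p ^ Suc i) ^ 5 = q * q ^ i"
      by (simp add: q_def power_mult_distrib swap[of p i])
    finally show "(\<Prod>j<5. qpoch_inf ((\<zeta> ^ Suc i) ^ j * p ^ Suc i) q) = qpoch_inf (q * q ^ i) (q ^ 5)" .
  qed
  also have "\<dots> = euler q / euler (q ^ 5)"
    using qpoch_inf_dissect[OF q(1), of 5 q] euler_nonzero[OF q(2)]
    by (simp add: prod.lessThan_Suc[of _ 4, simplified] flip: power_Suc)
  finally show ?thesis
    by (simp add: q_def eval_nat_numeral)
qed

text \<open>The factor \<open>T - z - z\<^sup>2 / T\<close> splits over \<open>\<rat>(\<surd>5)\<close>, and the fifth powers of the two
  roots \<open>(\<plusminus>\<surd>5 - 1) / 2\<close> add up to \<open>-11\<close>.\<close>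

lemma golden_prod:
  fixes T p \<zeta> :: complex
  assumes \<zeta>: "\<zeta> ^ 5 = 1" "\<zeta> \<noteq> 1" and T: "T \<noteq> 0"
  shows "(\<Prod>j<5. T - \<zeta> ^ j * p - (\<zeta> ^ j * p)\<^sup>2 / T) = T ^ 5 - 11 * p ^ 5 - (p ^ 5)\<^sup>2 / T ^ 5"
proof -
  define \<alpha> :: complex where "\<alpha> = (csqrt 5 - 1) / 2"
  define \<beta> where "\<beta> = - 1 - \<alpha>"
  have a2: "\<alpha>\<^sup>2 = 1 - \<alpha>"
    using power2_csqrt[of 5] by (simp add: \<alpha>_def power2_eq_square field_simps)
  have ab: "\<alpha> * \<beta> = - 1"
    using a2 by (simp add: \<beta>_def algebra_simps power2_eq_square)
  have a5: "\<alpha> ^ 5 = 5 * \<alpha> - 3" and b5: "\<beta> ^ 5 = 5 * \<beta> - 3"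
    using a2 unfolding \<beta>_def by algebra+
  have w: "1 + \<zeta> + \<zeta>\<^sup>2 + \<zeta> ^ 3 + \<zeta> ^ 4 = 0"
    using fifth_root_powers[OF \<zeta>, of 1] by simp
  have "T - z - z\<^sup>2 / T = - (1 / T) * ((\<alpha> * T - z) * (\<beta> * T - z))" for z
  proof -
    have "(\<alpha> * T - z) * (\<beta> * T - z) = (\<alpha> * \<beta>) * T\<^sup>2 - (\<alpha> + \<beta>) * T * z + z\<^sup>2"
      by (simp add: algebra_simps power2_eq_square)
    also have "\<dots> = - T\<^sup>2 + T * z + z\<^sup>2"
      by (simp add: ab) (simp add: \<beta>_def)
    finally show ?thesis
      using T by (simp only:) (simp add: field_simps power2_eq_square)
  qed
  then have "(\<Prod>j<5. T - \<zeta> ^ j * p - (\<zeta> ^ j * p)\<^sup>2 / T) =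
      (\<Prod>j<5::nat. - (1 / T)) * ((\<Prod>j<5. \<alpha> * T - \<zeta> ^ j * p) * (\<Prod>j<5. \<beta> * T - \<zeta> ^ j * p))"
    by (simp only: prod.distrib)
  also have "\<dots> = - (1 / T ^ 5) * ((\<alpha> ^ 5 * T ^ 5 - p ^ 5) * (\<beta> ^ 5 * T ^ 5 - p ^ 5))"
    by (simp add: prod_fifth_roots[OF w] power_mult_distrib power_divide power_minus_odd)
  also have "(\<alpha> ^ 5 * T ^ 5 - p ^ 5) * (\<beta> ^ 5 * T ^ 5 - p ^ 5)
      = (\<alpha> * \<beta>) ^ 5 * (T ^ 5)\<^sup>2 - (\<alpha> ^ 5 + \<beta> ^ 5) * T ^ 5 * p ^ 5 + (p ^ 5)\<^sup>2"
    by (simp add: algebra_simps power2_eq_square power_mult_distrib)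
  also have "\<dots> = - (T ^ 5)\<^sup>2 + 11 * T ^ 5 * p ^ 5 + (p ^ 5)\<^sup>2"
    unfolding a5 b5 ab by (simp add: \<beta>_def algebra_simps)
  finally show ?thesis
    using T by (simp add: field_simps power2_eq_square)
qed

lemma qser_of_real:
  assumes "\<bar>q\<bar> < 1" "q \<noteq> 0" "k > 0" "j \<le> k"
  shows "qser j k (of_real q :: 'a::{real_normed_field,banach}) = of_real (qser j k q)"
proof -
  have "\<bar>q ^ k\<bar> < 1" using assms by (simp add: power_abs power_less_one_iff)
  then show ?thesis
    using assms by (simp add: qser_product qpoch_inf_of_real flip: of_real_power)
qed

text \<open>The quotient formula is multiplied over the five values zeta^j p. They have the same
  fifth power, hence the same T, so one side is evaluated by \<open>euler_prod_fifth_roots\<close>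
  and the other by \<open>golden_prod\<close>.\<close>

theorem rogers_ramanujan_eleven:
  assumes q: "0 < q" "q < 1"
  defines "R \<equiv> rogers_ramanujan q"
  shows "1 / R ^ 5 - 11 - R ^ 5 = euler q ^ 6 / (q * euler (q ^ 5) ^ 6)"
proof -
  define p where "p = root 5 q"
  have p: "0 < p" "p < 1" "p ^ 5 = q"
    using q by (simp_all add: p_def real_root_pow_pos2)
  have q': "norm q < 1" "q \<noteq> 0" "norm (q ^ 5) < 1" "q ^ 5 \<noteq> 0"
    using q by (simp_all add: power_less_one_iff)
  define T where "T = rr_b q / rr_a q"
  have nz: "rr_a q \<noteq> 0" "rr_b q \<noteq> 0" "euler q \<noteq> 0" "euler (q ^ 5) \<noteq> 0"
    using rr_a_mult_rr_b[OF q'(1,2)] euler_nonzero[OF q'(1)] euler_nonzero[OF q'(3)] by auto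
  define \<zeta> where "\<zeta> = cis (2 * pi / 5)"
  have \<zeta>: "\<zeta> ^ 5 = 1" "\<zeta> \<noteq> 1"
  proof -
    have "cis (2 * pi / 5) ^ 5 = cis (real 5 * (2 * pi / 5))" by (rule Complex.DeMoivre)
    then show "\<zeta> ^ 5 = 1" by (simp add: \<zeta>_def)
    have "sin (2 * pi / 5) > 0" by (rule sin_gt_zero) auto
    then show "\<zeta> \<noteq> 1" by (auto simp: \<zeta>_def complex_eq_iff)
  qed
  let ?c = complex_of_real
  have swap: "(x ^ a) ^ b = (x ^ b) ^ a" for x :: complex and a b
    by (simp add: mult.commute flip: power_mult)
  have T': "?c T = rr_b (?c q) / rr_a (?c q)"
    using q by (simp add: T_def qser_of_real)
  have "euler (\<zeta> ^ j * ?c p) = ?c (euler (q ^ 5)) * (?c T - \<zeta> ^ j * ?c p - (\<zeta> ^ j * ?c p)\<^sup>2 / ?c T)" for j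
  proof -
    have "norm (\<zeta> ^ j * ?c p) < 1" "\<zeta> ^ j * ?c p \<noteq> 0"
      using p \<zeta> by (auto simp: norm_mult norm_power \<zeta>_def)
    moreover have e: "(\<zeta> ^ j * ?c p) ^ 5 = ?c q"
      using \<zeta>(1) swap[of \<zeta> j 5] unfolding p(3)[symmetric] by (simp add: power_mult_distrib)
    moreover have "euler (?c q ^ 5) = ?c (euler (q ^ 5))"
      using q' by (simp add: qpoch_inf_of_real flip: of_real_power)
    ultimately show ?thesis
      using euler_dissection_quotient(2)[of "\<zeta> ^ j * ?c p" "?c T"] T' by simp
  qed
  then have "(\<Prod>j<5. euler (\<zeta> ^ j * ?c p)) = ?c (euler (q ^ 5)) ^ 5 * (?c T ^ 5 - 11 * ?c p ^ 5 - (?c p ^ 5)\<^sup>2 / ?c T ^ 5)"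
    using golden_prod[OF \<zeta>, of "?c T" "?c p"] nz by (simp add: prod.distrib T_def)
  moreover have "(\<Prod>j<5. euler (\<zeta> ^ j * ?c p)) = ?c (euler q ^ 6 / euler (q ^ 5))"
    using euler_prod_fifth_roots[OF _ \<zeta>, of "?c p"] p q' by (simp add: qpoch_inf_of_real flip: of_real_power)
  ultimately have "?c (euler (q ^ 5) ^ 5 * (T ^ 5 - 11 * q - q\<^sup>2 / T ^ 5)) = ?c (euler q ^ 6 / euler (q ^ 5))"
    unfolding p(3)[symmetric] by simp
  then have *: "euler (q ^ 5) ^ 5 * (T ^ 5 - 11 * q - q\<^sup>2 / T ^ 5) = euler q ^ 6 / euler (q ^ 5)"
    by (simp only: of_real_eq_iff)
  have "R = p / T"
    unfolding R_def rogers_ramanujan_eq[OF q] T_def p_def by simp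
  then have R5: "R ^ 5 = q / T ^ 5"
    by (simp add: power_divide p)
  have "1 / R ^ 5 - 11 - R ^ 5 = (T ^ 5 - 11 * q - q\<^sup>2 / T ^ 5) / q"
    unfolding R5 using q by (simp add: field_simps power2_eq_square)
  also have "\<dots> = euler q ^ 6 / (q * euler (q ^ 5) ^ 6)"
  proof -
    have "(T ^ 5 - 11 * q - q\<^sup>2 / T ^ 5) = euler q ^ 6 / euler (q ^ 5) ^ 6"
      using * nz by (simp add: field_simps eval_nat_numeral)
    then show ?thesis by simp
  qed
  finally show ?thesis .
qed

section \<open>The logarithmic derivative of the continued fraction\<close>

text \<open>With q = s^2, one factor s^e absorbs the weight because n s^n is bounded, and the other
  factor remains summable.\<close>

lemma summable_weight:
  fixes e :: "'i \<Rightarrow> nat" and q :: real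
  assumes "\<And>r::real. 0 < r \<Longrightarrow> r < 1 \<Longrightarrow> (\<lambda>i. r ^ e i) summable_on A" and q: "0 < q" "q < 1"
  shows "(\<lambda>i. real (e i) * q ^ e i) summable_on A"
proof -
  define s where "s = sqrt q"
  have s01: "0 < s" "s < 1" and q_eq: "q = s * s"
    using q by (auto simp: s_def)
  have "(\<lambda>n. real n * s ^ n) \<longlonglongrightarrow> 0"
    using powser_times_n_limit_0[of s] s01 by simp
  then obtain C where C: "\<And>n. norm (real n * s ^ n) \<le> C"
    using convergent_imp_Bseq[OF convergentI[of "\<lambda>n. real n * s ^ n" 0]] by (auto simp: Bseq_def)
  show ?thesis
  proof (rule summable_on_comparison_test)
    show "(\<lambda>i. C * s ^ e i) summable_on A"
      by (intro summable_on_cmult_right assms s01)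
    show "real (e i) * q ^ e i \<le> C * s ^ e i" for i
    proof -
      have "real (e i) * q ^ e i = (real (e i) * s ^ e i) * s ^ e i"
        by (simp add: q_eq power_mult_distrib)
      also have "\<dots> \<le> C * s ^ e i"
        using C[of "e i"] s01 by (intro mult_right_mono) (auto simp: abs_le_iff)
      finally show ?thesis .
    qed
  qed (use q in auto)
qed

text \<open>In \<open>euler_cube\<close> the indices -2k and 2k + 1 share an exponent, and their
  coefficients 2k and 2k + 1 add up to u = 4k + 1. The cube thus becomes the sum of u q^((u^2-1)/8)
  over u congruent to 1 modulo 4, without signs, ready for arithmetic with u^2 + v^2.\<close>

lemma euler_cube_odd:
  fixes q :: real
  assumes q: "0 < q" "q < 1"
  shows "(\<Sum>\<^sub>\<infinity>k. of_int (4 * k + 1) * q ^ qexp 3 4 k) = euler q ^ 3"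
    and "(\<lambda>k. (real_of_int (4 * k + 1))\<^sup>2 * q ^ qexp 3 4 k) summable_on UNIV"
    and "(\<lambda>k. norm (real_of_int (4 * k + 1) * q ^ qexp 3 4 k)) summable_on UNIV"
    and "(\<lambda>k. q ^ qexp 3 4 k) summable_on UNIV"
proof -
  let ?f = "\<lambda>m. - real_of_int m * sgn_pow m * q ^ tri m"
  have q': "norm q < 1" "q \<noteq> 0" using q by auto
  have bij: "bij_betw (\<lambda>(w, k). if w then - 2 * k else 2 * k + 1) ({True, False} \<times> UNIV) (UNIV :: int set)"
  proof (rule bij_betwI')
    fix m :: int
    show "\<exists>x\<in>{True, False} \<times> UNIV. m = (case x of (w, k) \<Rightarrow> if w then - 2 * k else 2 * k + 1)"
    proof (cases "even m")
      case True
      then show ?thesis by (intro bexI[of _ "(True, - (m div 2))"]) auto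
    next
      case False
      then show ?thesis by (intro bexI[of _ "(False, m div 2)"]) auto
    qed
  next
    fix x y :: "bool \<times> int"
    show "((case x of (w, k) \<Rightarrow> if w then - 2 * k else 2 * k + 1) = (case y of (w, k) \<Rightarrow> if w then - 2 * k else 2 * k + 1)) = (x = y)"
      by (cases x; cases y) (auto; presburger)
  qed auto
  have t1: "tri (- 2 * k) = qexp 3 4 k" and t2: "tri (2 * k + 1) = qexp 3 4 k" for k
    using two_tri[of "- 2 * k"] two_tri[of "2 * k + 1"] two_qexp[of 3 4 k] by (simp_all add: algebra_simps)
  have base: "(\<lambda>k. r ^ qexp 3 4 k) summable_on UNIV" if "0 < r" "r < 1" for r :: real
    using abs_summable_qexp[of r 4 3] that by simp
  then show base_q: "(\<lambda>k. q ^ qexp 3 4 k) summable_on UNIV" using q .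
  have "(\<lambda>k. 8 * (real (qexp 3 4 k) * q ^ qexp 3 4 k) + q ^ qexp 3 4 k) summable_on UNIV"
    by (intro summable_on_add summable_on_cmult_right summable_weight base q)
  \<comment> \<open>The squared coefficient is linear in the exponent, so its summability is a case
    of \<open>summable_weight\<close>.\<close>
  moreover have sq: "(real_of_int (4 * k + 1))\<^sup>2 = 8 * real (qexp 3 4 k) + 1" for k
  proof -
    have "(4 * k + 1)\<^sup>2 = 8 * int (qexp 3 4 k) + 1"
      using two_qexp[of 3 4 k] by (simp add: algebra_simps power2_eq_square)
    then have "real_of_int ((4 * k + 1)\<^sup>2) = real_of_int (8 * int (qexp 3 4 k) + 1)" by (simp only:)
    then show ?thesis by simp
  qed
  ultimately show s2: "(\<lambda>k. (real_of_int (4 * k + 1))\<^sup>2 * q ^ qexp 3 4 k) summable_on UNIV"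
    unfolding sq by (simp add: algebra_simps)
  show s1: "(\<lambda>k. norm (real_of_int (4 * k + 1) * q ^ qexp 3 4 k)) summable_on UNIV"
  proof (rule summable_on_comparison_test[OF s2])
    fix k :: int
    have "\<bar>4 * k + 1\<bar> * 1 \<le> \<bar>4 * k + 1\<bar> * \<bar>4 * k + 1\<bar>"
      by (intro mult_left_mono) presburger+
    then have "\<bar>4 * k + 1\<bar> \<le> (4 * k + 1)\<^sup>2" by (simp add: power2_eq_square)
    then have "real_of_int \<bar>4 * k + 1\<bar> \<le> real_of_int ((4 * k + 1)\<^sup>2)" by (simp only: of_int_le_iff)
    then have "\<bar>real_of_int (4 * k + 1)\<bar> \<le> (real_of_int (4 * k + 1))\<^sup>2" by simp
    then show "norm (real_of_int (4 * k + 1) * q ^ qexp 3 4 k) \<le> (real_of_int (4 * k + 1))\<^sup>2 * q ^ qexp 3 4 k"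
      using q by (simp add: abs_mult mult_right_mono)
  qed simp
  have f: "?f summable_on UNIV" "infsum ?f UNIV = euler q ^ 3"
    using euler_cube[OF q'] by (auto simp: has_sum_iff)
  have "euler q ^ 3 = (\<Sum>w\<in>{True, False}. \<Sum>\<^sub>\<infinity>k. ?f (if w then - 2 * k else 2 * k + 1))"
    using infsum_finite_partition[OF bij _ f(1)] f(2) by simp
  also have "\<dots> = (\<Sum>\<^sub>\<infinity>k. ?f (- 2 * k)) + (\<Sum>\<^sub>\<infinity>k. ?f (2 * k + 1))"
    by (simp add: algebra_simps)
  also have "\<dots> = (\<Sum>\<^sub>\<infinity>k. ?f (- 2 * k) + ?f (2 * k + 1))"
  proof (rule infsum_add[symmetric])
    have i: "inj (\<lambda>k::int. - 2 * k)" "inj (\<lambda>k::int. 2 * k + 1)" by (auto simp: inj_def)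
    have "?f summable_on range (\<lambda>k::int. - 2 * k)" "?f summable_on range (\<lambda>k::int. 2 * k + 1)"
      using f(1) by (auto intro: summable_on_subset_banach)
    then show "(\<lambda>k. ?f (- 2 * k)) summable_on UNIV" "(\<lambda>k. ?f (2 * k + 1)) summable_on UNIV"
      unfolding summable_on_reindex[OF i(1)] summable_on_reindex[OF i(2)] o_def .
  qed
  also have "\<dots> = (\<Sum>\<^sub>\<infinity>k. of_int (4 * k + 1) * q ^ qexp 3 4 k)"
    unfolding t1 t2 by (intro infsum_cong) (simp add: algebra_simps)
  finally show "(\<Sum>\<^sub>\<infinity>k. of_int (4 * k + 1) * q ^ qexp 3 4 k) = euler q ^ 3" ..
qed

text \<open>Rearrangement by Gaussian integers: with \<open>u = 4m + 1\<close>, \<open>v = 4n + 1\<close> put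
  \<open>X = 2u + v\<close>, \<open>Y = 2v - u\<close>, so that \<open>X\<^sup>2 + Y\<^sup>2 = 5 (u\<^sup>2 + v\<^sup>2)\<close> and
  \<open>(X\<^sup>2 - Y\<^sup>2) / 8 = u v + 3 (u\<^sup>2 - v\<^sup>2) / 8\<close>. The residue \<open>w\<close> of \<open>m - 2n\<close> modulo 5 decides which unit
  multiple of \<open>X + i Y\<close> has the form \<open>(10 l + 3) + i (10 k + 1)\<close>; for \<open>w = 4\<close> there is none, and
  that class sums to zero by antisymmetry.\<close>

lemma bij_gauss_source:
  "bij_betw (\<lambda>(w, z). (2 * fst z - snd z + w, fst z + 2 * snd z)) ({0..4} \<times> UNIV) (UNIV :: (int \<times> int) set)"
proof (rule bij_betwI')
  fix x y :: "int \<times> int \<times> int"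
  assume *: "x \<in> {0..4} \<times> UNIV" "y \<in> {0..4} \<times> UNIV"
  obtain w a b w' a' b' where xy: "x = (w, a, b)" "y = (w', a', b')" by (cases x; cases y) auto
  have "w = w' \<and> a = a' \<and> b = b'" if "2 * a - b + w = 2 * a' - b' + w'" "a + 2 * b = a' + 2 * b'"
  proof -
    have "w - w' = 5 * (b - b')" using that by presburger
    then have "b = b'" using * xy by auto
    then show ?thesis using that by auto
  qed
  then show "((case x of (w, z) \<Rightarrow> (2 * fst z - snd z + w, fst z + 2 * snd z)) =
      (case y of (w, z) \<Rightarrow> (2 * fst z - snd z + w, fst z + 2 * snd z))) = (x = y)"
    unfolding xy by auto
next
  fix z :: "int \<times> int"
  define d where "d = fst z - 2 * snd z"
  have d: "d = d mod 5 + 5 * (d div 5)" by simp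
  show "\<exists>x\<in>{0..4} \<times> UNIV. z = (case x of (w, z) \<Rightarrow> (2 * fst z - snd z + w, fst z + 2 * snd z))"
  proof (intro bexI[of _ "(d mod 5, snd z + 2 * (d div 5), - (d div 5))"])
    have "fst z = 2 * snd z + (d mod 5 + 5 * (d div 5))" using d unfolding d_def by linarith
    then show "z = (case (d mod 5, snd z + 2 * (d div 5), - (d div 5)) of (w, z) \<Rightarrow> (2 * fst z - snd z + w, fst z + 2 * snd z))"
      by (simp add: prod_eq_iff)
    have "0 \<le> d mod 5" "d mod 5 < 5" by simp_all
    then show "(d mod 5, snd z + 2 * (d div 5), - (d div 5)) \<in> {0..4} \<times> UNIV" by auto
  qed
qed auto

text \<open>For w = 0, 1, 2, 3 the image consists of the pairs with parities (even, even), (even,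
  odd), (odd, even), (odd, odd); so the four classes tile the plane.\<close>

definition gauss_target :: "int \<Rightarrow> int \<times> int \<Rightarrow> int \<times> int" where
  "gauss_target w z =
    (if w = 0 then (2 * fst z, 2 * snd z) else if w = 1 then (- 2 * snd z, 2 * fst z + 1)
     else if w = 2 then (2 * snd z - 1, - 2 * fst z - 2) else (- 2 * fst z - 3, 1 - 2 * snd z))"

lemma bij_gauss_target: "bij_betw (\<lambda>(w, z). gauss_target w z) ({0..3} \<times> UNIV) UNIV"
proof (rule bij_betwI')
  fix x y :: "int \<times> int \<times> int"
  assume "x \<in> {0..3} \<times> UNIV" "y \<in> {0..3} \<times> UNIV"
  moreover have "w \<in> {0..3} \<Longrightarrow> w = 0 \<or> w = 1 \<or> w = 2 \<or> w = 3" for w :: int by auto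
  ultimately have *: "fst x = 0 \<or> fst x = 1 \<or> fst x = 2 \<or> fst x = 3" "fst y = 0 \<or> fst y = 1 \<or> fst y = 2 \<or> fst y = 3"
    by (auto simp: mem_Times_iff)
  obtain w a b w' a' b' where xy: "x = (w, a, b)" "y = (w', a', b')" by (cases x; cases y) auto
  show "((case x of (w, z) \<Rightarrow> gauss_target w z) = (case y of (w, z) \<Rightarrow> gauss_target w z)) = (x = y)"
    using * unfolding xy gauss_target_def by (elim disjE; simp; presburger)
next
  fix z :: "int \<times> int"
  obtain l m where z: "z = (l, m)" by (cases z) auto
  show "\<exists>x\<in>{0..3} \<times> UNIV. z = (case x of (w, z) \<Rightarrow> gauss_target w z)"
  proof (cases "even l"; cases "even m")
    assume "even l" "even m"
    then show ?thesis unfolding z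
      by (intro bexI[of _ "(0, l div 2, m div 2)"]) (auto simp: gauss_target_def)
  next
    assume "even l" "odd m"
    then show ?thesis unfolding z
      by (intro bexI[of _ "(1, m div 2, - (l div 2))"]) (auto simp: gauss_target_def)
  next
    assume "odd l" "even m"
    then show ?thesis unfolding z
      by (intro bexI[of _ "(2, - (m div 2) - 1, l div 2 + 1)"]) (auto simp: gauss_target_def elim!: oddE)
  next
    assume "odd l" "odd m"
    then show ?thesis unfolding z
      by (intro bexI[of _ "(3, - (l div 2) - 2, - (m div 2))"]) (auto simp: gauss_target_def elim!: oddE)
  qed
qed auto

text \<open>The series of q d/dq applied to \<open>qser j k\<close>, see
  \<open>qser_has_derivative\<close>.\<close>

definition qser_deriv :: "nat \<Rightarrow> nat \<Rightarrow> real \<Rightarrow> real" where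
  "qser_deriv j k q = (\<Sum>\<^sub>\<infinity>m. sgn_pow m * real (qexp j k m) * q ^ qexp j k m)"

lemma qser_deriv_sym: "j \<le> k \<Longrightarrow> qser_deriv j k q = qser_deriv (k - j) k q"
  unfolding qser_deriv_def
  by (rule infsum_reindex_bij_witness[where i = uminus and j = uminus]) (simp_all add: sgn_pow_uminus qexp_uminus)

lemma summable_qexp_weight:
  assumes "0 < q" "q < 1" "0 < k" "j \<le> k"
  shows "(\<lambda>m. real (qexp j k m) * q ^ qexp j k m) summable_on UNIV"
proof (rule summable_weight)
  show "(\<lambda>i. r ^ qexp j k i) summable_on UNIV" if "0 < r" "r < 1" for r :: real
    using abs_summable_qexp[of r k j] that assms by simp
qed (use assms in auto)

text \<open>The right side is \<open>rr_a q * rr_b q\<close> times 5 q R'/R for R = q^(1/5) a/b, so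
  this is the logarithmic derivative of the continued fraction in disguise. The left side is treated
  as the square of \<open>euler_cube_odd\<close>.\<close>

theorem euler_sixth_power:
  fixes q :: real
  assumes q: "0 < q" "q < 1"
  shows "euler q ^ 6 = rr_a q * rr_b q + 5 * (rr_b q * qser_deriv 1 5 q - rr_a q * qser_deriv 2 5 q)"
proof -
  have q': "norm q < 1" "q \<noteq> 0" using q by auto
  define A where "A = qexp 4 5"
  define B where "B = qexp 3 5"
  define C where "C = qexp 3 4"
  \<comment> \<open>The weight is (X^2 - Y^2)/8 for X = 10l + 3 and Y = 10k + 1, because X^2 = 40
    A(l) + 9 and Y^2 = 40 B(k) + 1.\<close>
  define g where "g = (\<lambda>z. (1 + 5 * real (A (fst z)) - 5 * real (B (snd z))) * (q ^ A (fst z) * q ^ B (snd z)))"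
  define u where "u m = real_of_int (4 * m + 1)" for m
  \<comment> \<open>The term with 3/8 is antisymmetric in the two indices and sums to 0. It is added
    to turn the product u v of the coefficients into (X^2 - Y^2)/40 times 5, the quadratic form that
    the rearrangement respects.\<close>
  define h where "h = (\<lambda>z. (u (fst z) * u (snd z) + 3 / 8 * ((u (fst z))\<^sup>2 - (u (snd z))\<^sup>2)) * (q ^ C (fst z) * q ^ C (snd z)))"
  define s :: "int \<times> int \<Rightarrow> real" where "s = (\<lambda>z. sgn_pow (fst z + snd z))"
  have sA: "(\<lambda>m. norm (q ^ A m)) summable_on UNIV" "(\<lambda>m. norm (real (A m) * q ^ A m)) summable_on UNIV"
    and sB: "(\<lambda>m. norm (q ^ B m)) summable_on UNIV" "(\<lambda>m. norm (real (B m) * q ^ B m)) summable_on UNIV"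
    unfolding A_def B_def using abs_summable_qexp[OF q', of 5] summable_qexp_weight[OF q, of 5] q by (simp_all add: abs_mult)
  have s_term: "((\<lambda>z. s z * (x (fst z) * y (snd z))) has_sum
      (\<Sum>\<^sub>\<infinity>m. sgn_pow m * x m) * (\<Sum>\<^sub>\<infinity>m. sgn_pow m * y m)) UNIV"
    if "(\<lambda>m. norm (x m)) summable_on UNIV" "(\<lambda>m. norm (y m)) summable_on UNIV" for x y :: "int \<Rightarrow> real"
  proof -
    have "((\<lambda>z. sgn_pow (fst z) * x (fst z) * (sgn_pow (snd z) * y (snd z))) has_sum
      (\<Sum>\<^sub>\<infinity>m. sgn_pow m * x m) * (\<Sum>\<^sub>\<infinity>m. sgn_pow m * y m)) (UNIV \<times> UNIV)"
      by (rule has_sum_times) (use that in \<open>simp_all add: norm_mult del: real_norm_def\<close>)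
    then show ?thesis
      by (simp add: s_def power_int_add mult_ac)
  qed
  have g_sum: "((\<lambda>z. s z * g z) has_sum (rr_a q * rr_b q + 5 * (rr_b q * qser_deriv 1 5 q - rr_a q * qser_deriv 2 5 q))) UNIV"
  proof -
    have "((\<lambda>z. s z * (q ^ A (fst z) * q ^ B (snd z)) + 5 * (s z * ((real (A (fst z)) * q ^ A (fst z)) * q ^ B (snd z)))
        - 5 * (s z * (q ^ A (fst z) * (real (B (snd z)) * q ^ B (snd z))))) has_sum
       (qser 4 5 q * qser 3 5 q + 5 * (qser_deriv 4 5 q * qser 3 5 q) - 5 * (qser 4 5 q * qser_deriv 3 5 q))) UNIV"
      unfolding qser_def qser_deriv_def mult.assoc A_def[symmetric] B_def[symmetric]
      by (intro has_sum_add has_sum_diff has_sum_cmult_right s_term sA sB s_term[of _ "\<lambda>m. q ^ B m", simplified mult.assoc]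
            s_term[of "\<lambda>m. q ^ A m" "\<lambda>m. real (B m) * q ^ B m", simplified mult.assoc]
            s_term[of "\<lambda>m. real (A m) * q ^ A m" "\<lambda>m. q ^ B m", simplified mult.assoc])
    moreover have "(\<lambda>z. s z * (q ^ A (fst z) * q ^ B (snd z)) + 5 * (s z * ((real (A (fst z)) * q ^ A (fst z)) * q ^ B (snd z)))
        - 5 * (s z * (q ^ A (fst z) * (real (B (snd z)) * q ^ B (snd z))))) = (\<lambda>z. s z * g z)"
      by (auto simp: g_def fun_eq_iff algebra_simps)
    moreover have "qser 4 5 q = rr_a q" "qser 3 5 q = rr_b q" "qser_deriv 4 5 q = qser_deriv 1 5 q" "qser_deriv 3 5 q = qser_deriv 2 5 q"
      using qser_sym[of 4 5 q] qser_sym[of 3 5 q] qser_deriv_sym[of 4 5 q] qser_deriv_sym[of 3 5 q] by simp_all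
    ultimately show ?thesis
      by (simp add: algebra_simps)
  qed
  have h_sum: "(h has_sum euler q ^ 6) UNIV"
  proof -
    note c = euler_cube_odd[OF q, folded C_def u_def]
    have c2: "(\<lambda>k. norm ((u k)\<^sup>2 * q ^ C k)) summable_on UNIV" "(\<lambda>k. norm (q ^ C k)) summable_on UNIV"
      using c q by (simp_all add: abs_mult)
    let ?S = "(\<Sum>\<^sub>\<infinity>k. (u k)\<^sup>2 * q ^ C k) * (\<Sum>\<^sub>\<infinity>k. q ^ C k)"
    have 1: "((\<lambda>z. (u (fst z) * q ^ C (fst z)) * (u (snd z) * q ^ C (snd z))) has_sum (euler q ^ 3 * euler q ^ 3)) UNIV"
      using has_sum_times[OF c(3) c(3)] c(1) by simp
    have 2: "((\<lambda>z. ((u (fst z))\<^sup>2 * q ^ C (fst z)) * q ^ C (snd z)) has_sum ?S) UNIV"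
      using has_sum_times[OF c2(1) c2(2)] by simp
    have 3: "((\<lambda>z. q ^ C (fst z) * ((u (snd z))\<^sup>2 * q ^ C (snd z))) has_sum ?S) UNIV"
      using has_sum_times[OF c2(2) c2(1)] by (simp add: mult.commute)
    have "((\<lambda>z. (u (fst z) * q ^ C (fst z)) * (u (snd z) * q ^ C (snd z)) +
        3 / 8 * (((u (fst z))\<^sup>2 * q ^ C (fst z)) * q ^ C (snd z) - q ^ C (fst z) * ((u (snd z))\<^sup>2 * q ^ C (snd z)))) has_sum
        (euler q ^ 3 * euler q ^ 3 + 3 / 8 * (?S - ?S))) UNIV"
      by (intro has_sum_add has_sum_diff has_sum_cmult_right 1 2 3)
    moreover have "(\<lambda>z. (u (fst z) * q ^ C (fst z)) * (u (snd z) * q ^ C (snd z)) +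
        3 / 8 * (((u (fst z))\<^sup>2 * q ^ C (fst z)) * q ^ C (snd z) - q ^ C (fst z) * ((u (snd z))\<^sup>2 * q ^ C (snd z)))) = h"
      by (auto simp: h_def fun_eq_iff algebra_simps)
    ultimately show ?thesis by (simp flip: power_add)
  qed
  have hg: "h (m, n) = c * g (l, k)"
    if eq: "C m + C n = A l + B k"
      and w: "8 * (4 * m + 1) * (4 * n + 1) + 3 * ((4 * m + 1)\<^sup>2 - (4 * n + 1)\<^sup>2) = d * (8 + 40 * int (A l) - 40 * int (B k))"
      and c: "c = real_of_int d" for m n l k d and c :: real
  proof -
    have "real_of_int (8 * (4 * m + 1) * (4 * n + 1) + 3 * ((4 * m + 1)\<^sup>2 - (4 * n + 1)\<^sup>2))
        = real_of_int (d * (8 + 40 * int (A l) - 40 * int (B k)))"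
      unfolding w ..
    then have "u m * u n + 3 / 8 * ((u m)\<^sup>2 - (u n)\<^sup>2) = c * (1 + 5 * real (A l) - 5 * real (B k))"
      unfolding u_def c by (simp add: algebra_simps)
    then show ?thesis
      by (simp add: h_def g_def power_add[symmetric] eq)
  qed
  have AB: "40 * int (A l) = 100 * l\<^sup>2 + 60 * l" "40 * int (B k) = 100 * k\<^sup>2 + 20 * k" "40 * int (C m) = 80 * m\<^sup>2 + 40 * m" for l k m
    unfolding A_def B_def C_def using two_qexp[of 4 5 l] two_qexp[of 3 5 k] two_qexp[of 3 4 m]
    by (simp_all add: algebra_simps power2_eq_square)
  have eqI: "C m + C n = A l + B k" if "40 * int (C m) + 40 * int (C n) = 40 * int (A l) + 40 * int (B k)" for m n l k
    using that by linarith
  \<comment> \<open>Multiplying X + iY by i or -i exchanges the squares and negates the weight. This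
    happens for w = 1 and w = 2, exactly where the target has odd coordinate sum, so the sign of the
    series agrees with the sign of the weight.\<close>
  have sg: "s (gauss_target w (a, b)) = (if w = 0 \<or> w = 3 then 1 else -1)" if "w \<in> {0..3}" for w a b
    using that by (auto simp: s_def gauss_target_def)
  have cls: "h (2 * a - b + w, a + 2 * b) = s (gauss_target w (a, b)) * g (gauss_target w (a, b))" if w: "w \<in> {0..3}" for w a b
  proof -
    have "w = 0 \<or> w = 1 \<or> w = 2 \<or> w = 3" using w by auto
    then show ?thesis
    proof (elim disjE)
      assume [simp]: "w = 0"
      have "h (2 * a - b, a + 2 * b) = 1 * g (2 * a, 2 * b)"
        by (rule hg[where d = 1]; (rule eqI)?; (simp only: AB)?; simp add: algebra_simps power2_eq_square)
      then show ?thesis using sg[OF w, of a b] by (simp add: gauss_target_def)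
    next
      assume [simp]: "w = 1"
      have "h (2 * a - b + 1, a + 2 * b) = - 1 * g (- 2 * b, 2 * a + 1)"
        by (rule hg[where d = "-1"]; (rule eqI)?; (simp only: AB)?; simp add: algebra_simps power2_eq_square)
      then show ?thesis using sg[OF w, of a b] by (simp add: gauss_target_def)
    next
      assume [simp]: "w = 2"
      have "h (2 * a - b + 2, a + 2 * b) = - 1 * g (2 * b - 1, - 2 * a - 2)"
        by (rule hg[where d = "-1"]; (rule eqI)?; (simp only: AB)?; simp add: algebra_simps power2_eq_square)
      then show ?thesis using sg[OF w, of a b] by (simp add: gauss_target_def)
    next
      assume [simp]: "w = 3"
      have "h (2 * a - b + 3, a + 2 * b) = 1 * g (- 2 * a - 3, 1 - 2 * b)"
        by (rule hg[where d = 1]; (rule eqI)?; (simp only: AB)?; simp add: algebra_simps power2_eq_square)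
      then show ?thesis using sg[OF w, of a b] by (simp add: gauss_target_def)
    qed
  qed
  have anti: "(\<Sum>\<^sub>\<infinity>z. h (2 * fst z - snd z + 4, fst z + 2 * snd z)) = 0"
  proof -
    let ?k = "\<lambda>z. h (2 * fst z - snd z + 4, fst z + 2 * snd z)"
    \<comment> \<open>For w = 4, X = 5(4a + 7) and Y = 5(4b - 3). This involution sends (X, Y) to
      (-Y, -X), keeping the exponent and negating the weight.\<close>
    let ?\<sigma> = "\<lambda>z::int \<times> int. (- snd z - 1, - fst z - 1)"
    have k: "?k (?\<sigma> z) = - ?k z" for z
    proof -
      obtain a b where z: "z = (a, b)" by (cases z)
      have "40 * int (C (2 * a - b + 4)) + 40 * int (C (a + 2 * b)) = 40 * int (C (2 * (- b - 1) - (- a - 1) + 4)) + 40 * int (C ((- b - 1) + 2 * (- a - 1)))"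
        unfolding AB by (simp add: algebra_simps power2_eq_square)
      then have e: "C (2 * a - b + 4) + C (a + 2 * b) = C (2 * (- b - 1) - (- a - 1) + 4) + C ((- b - 1) + 2 * (- a - 1))"
        by linarith
      show ?thesis
        unfolding z h_def fst_conv snd_conv power_add[symmetric] e
        by (simp add: u_def algebra_simps power2_eq_square)
    qed
    have "infsum ?k UNIV = infsum (\<lambda>z. ?k (?\<sigma> z)) UNIV"
      by (rule infsum_reindex_bij_witness[where i = ?\<sigma> and j = ?\<sigma>]) auto
    also have "\<dots> = - infsum ?k UNIV"
      unfolding k by (rule infsum_uminus)
    finally show ?thesis by simp
  qed
  have sets: "{0..4::int} = {0,1,2,3,4}" "{0..3::int} = {0,1,2,3}" by auto
  have "euler q ^ 6 = infsum h UNIV"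
    using h_sum by (simp add: infsumI)
  also have "\<dots> = (\<Sum>w\<in>{0..4}. \<Sum>\<^sub>\<infinity>z. h (2 * fst z - snd z + w, fst z + 2 * snd z))"
    by (rule infsum_finite_partition[OF bij_gauss_source]) (use h_sum in \<open>auto simp: has_sum_iff\<close>)
  also have "\<dots> = (\<Sum>w\<in>{0..3}. \<Sum>\<^sub>\<infinity>z. h (2 * fst z - snd z + w, fst z + 2 * snd z))"
    unfolding sets using anti by simp
  also have "\<dots> = (\<Sum>w\<in>{0..3}. \<Sum>\<^sub>\<infinity>z. s (gauss_target w z) * g (gauss_target w z))"
    by (intro sum.cong infsum_cong refl) (use cls in \<open>auto\<close>)
  also have "\<dots> = infsum (\<lambda>z. s z * g z) UNIV"
    by (rule infsum_finite_partition[OF bij_gauss_target, symmetric]) (use g_sum in \<open>auto simp: has_sum_iff\<close>)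
  also have "\<dots> = rr_a q * rr_b q + 5 * (rr_b q * qser_deriv 1 5 q - rr_a q * qser_deriv 2 5 q)"
    using g_sum by (rule infsumI)
  finally show ?thesis .
qed

section \<open>Positivity, termwise derivatives and limits at 0\<close>

lemma euler_pos:
  assumes "0 \<le> q" "q < 1"
  shows "0 < euler (q :: real)"
proof -
  have "0 \<le> qpoch q q n" for n
  proof -
    have "q * q ^ i \<le> 1" for i
      using assms power_le_one[of q "Suc i"] by simp
    then show ?thesis unfolding qpoch_def by (intro prod_nonneg) (simp add: )
  qed
  then have "0 \<le> euler q"
    using qpoch_tendsto[of q q] assms by (intro LIMSEQ_le_const) auto
  then show ?thesis
    using euler_nonzero[of q] assms by simp
qed

lemma has_derivative_transform_nhds:
  assumes "(f has_real_derivative d) (at q)" "eventually (\<lambda>x. f x = g x) (nhds q)"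
  shows "(g has_real_derivative d) (at q)"
  using assms(1) DERIV_cong_ev[OF refl assms(2) refl, of d] by simp

lemma abs_sgn_pow: "\<bar>sgn_pow m :: real\<bar> = 1"
  using norm_sgn_pow[where 'a = real] by simp

lemma qser_has_derivative:
  assumes q: "0 < q" "q < 1" and k: "0 < k" "j \<le> k"
  shows "(qser j k has_real_derivative (qser_deriv j k q / q)) (at q)"
proof -
  \<comment> \<open>A point strictly between q and 1: the differentiated series at r majorises those
    on the whole interval (0, r), as the M-test requires.\<close>
  define r where "r = (1 + q) / 2"
  have r: "0 < r" "r < 1" "q < r" using q by (auto simp: r_def field_simps)
  define e where "e = (\<lambda>n. qexp j k (int_decode n))"
  define c where "c = (\<lambda>n. sgn_pow (int_decode n) :: real)"
  have c: "\<bar>c n\<bar> = 1" for n unfolding c_def using norm_sgn_pow[where 'a = real] by simp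
  have eq: "qser j k x = (\<Sum>n. c n * x ^ e n)" "summable (\<lambda>n. c n * x ^ e n)" if "0 < x" "x < 1" for x
  proof -
    have "(\<lambda>m. norm (sgn_pow m * x ^ qexp j k m)) summable_on UNIV"
    proof -
      have "norm x < 1" "x \<noteq> 0" using that by auto
      from abs_summable_qexp[OF this k] show ?thesis by (simp add: abs_mult abs_sgn_pow)
    qed
    note * = abs_summable_int_suminf[OF this]
    show "qser j k x = (\<Sum>n. c n * x ^ e n)" "summable (\<lambda>n. c n * x ^ e n)"
      using * summable_norm_cancel[OF *(1)] by (simp_all add: qser_def c_def e_def)
  qed
  have eq': "qser_deriv j k q = (\<Sum>n. c n * real (e n) * q ^ e n)"
  proof -
    have "(\<lambda>m. norm (sgn_pow m * real (qexp j k m) * q ^ qexp j k m)) summable_on UNIV"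
      using summable_qexp_weight[OF q k] q by (simp add: abs_mult abs_sgn_pow)
    from abs_summable_int_suminf(2)[OF this] show ?thesis
      by (simp add: qser_deriv_def c_def e_def)
  qed
  have M: "summable (\<lambda>n. real (e n) * r ^ e n / r)"
  proof -
    have "(\<lambda>m. norm (real (qexp j k m) * r ^ qexp j k m)) summable_on UNIV"
      using summable_qexp_weight[OF r(1,2) k] r by simp
    from abs_summable_int_suminf(1)[OF this] show ?thesis
      using r by (intro summable_divide) (simp add: e_def)
  qed
  have "((\<lambda>x. \<Sum>n. c n * x ^ e n) has_real_derivative (\<Sum>n. c n * (real (e n) * q ^ (e n - 1)))) (at q)"
  proof (rule has_field_derivative_series'(2)[where S = "{0<..<r}" and x0 = q])
    show "((\<lambda>x. c n * x ^ e n) has_real_derivative c n * (real (e n) * x ^ (e n - 1))) (at x within {0<..<r})" for n x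
      by (auto intro!: derivative_eq_intros)
    show "uniformly_convergent_on {0<..<r} (\<lambda>n x. \<Sum>i<n. c i * (real (e i) * x ^ (e i - 1)))"
    proof (rule Weierstrass_m_test'[OF _ M])
      fix n x assume x: "x \<in> {0<..<r}"
      have "real (e n) * x ^ (e n - 1) \<le> real (e n) * r ^ e n / r"
      proof (cases "e n")
        case (Suc i)
        then show ?thesis using x r by (auto intro!: mult_left_mono power_mono)
      qed simp
      then show "norm (c n * (real (e n) * x ^ (e n - 1))) \<le> real (e n) * r ^ e n / r"
        using c[of n] x by (simp add: abs_mult)
    qed
    show "summable (\<lambda>n. c n * q ^ e n)" using eq(2) q by simp
  qed (use q r in auto)
  moreover have "(\<Sum>n. c n * (real (e n) * q ^ (e n - 1))) = qser_deriv j k q / q"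
  proof -
    have "c n * (real (e n) * q ^ (e n - 1)) = c n * real (e n) * q ^ e n / q" for n
      using q by (cases "e n") auto
    moreover have "summable (\<lambda>n. c n * real (e n) * q ^ e n)"
    proof -
      have "(\<lambda>m. norm (sgn_pow m * real (qexp j k m) * q ^ qexp j k m)) summable_on UNIV"
        using summable_qexp_weight[OF q k] q by (simp add: abs_mult abs_sgn_pow)
      from summable_norm_cancel[OF abs_summable_int_suminf(1)[OF this]] show ?thesis
        by (simp add: c_def e_def)
    qed
    ultimately show ?thesis
      unfolding eq' by (simp add: suminf_divide)
  qed
  ultimately have "((\<lambda>x. \<Sum>n. c n * x ^ e n) has_real_derivative (qser_deriv j k q / q)) (at q)"
    by simp
  moreover have "eventually (\<lambda>x. (\<Sum>n. c n * x ^ e n) = qser j k x) (nhds q)"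
    using eventually_nhds_in_open[of "{0<..<1}" q] q by (auto elim!: eventually_mono simp: eq)
  ultimately show ?thesis
    by (rule has_derivative_transform_nhds)
qed

text \<open>For \<open>j = 0\<close> or \<open>j = k\<close> a second index would have exponent 0.
  The strict bounds exclude this, so the constant term of the series is exactly 1.\<close>

lemma qexp_pos:
  assumes "1 \<le> j" "j < k" "m \<noteq> 0"
  shows "1 \<le> qexp j k m"
proof -
  have "2 * int (qexp j k m) > 0"
  proof (cases "m \<ge> 1")
    case True
    then have "int k * (m * (m - 1)) \<ge> 0" "int j * m > 0"
      using assms by (auto intro!: mult_nonneg_nonneg mult_pos_pos)
    then show ?thesis
      using two_qexp[of j k m] assms by simp
  next
    case False
    then have "m < 0" using assms by simp
    have "int k * 2 \<le> int k * (1 - m)"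
      using \<open>m < 0\<close> by (intro mult_left_mono) auto
    moreover have "2 * int j < int k * 2" using assms by simp
    ultimately have "int k * (1 - m) - 2 * int j > 0" by linarith
    moreover have "2 * int (qexp j k m) = (- m) * (int k * (1 - m) - 2 * int j)"
      using two_qexp[of j k m] assms by (simp add: algebra_simps)
    ultimately show ?thesis
      using \<open>m < 0\<close> by (simp add: mult_neg_pos)
  qed
  then show ?thesis by simp
qed

lemma tendsto_0_at_right_bound:
  fixes f :: "real \<Rightarrow> real"
  assumes "\<And>x. 0 < x \<Longrightarrow> x \<le> 1/2 \<Longrightarrow> \<bar>f x\<bar> \<le> x * C"
  shows "(f \<longlongrightarrow> 0) (at_right 0)"
proof (rule tendsto_0_le[where K = 1])
  show "((\<lambda>x. x * C) \<longlongrightarrow> 0) (at_right 0)"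
    by (auto intro!: tendsto_eq_intros)
  have "eventually (\<lambda>x::real. x \<in> {0<..<1/2}) (at_right 0)"
    by (rule eventually_at_right_real) simp
  then show "eventually (\<lambda>x. norm (f x) \<le> norm (x * C) * 1) (at_right 0)"
    by eventually_elim (use assms in \<open>force simp: abs_le_iff\<close>)
qed

lemma
  assumes jk: "1 \<le> j" "j < k"
  shows qser_at_right_0: "(qser j k \<longlongrightarrow> (1::real)) (at_right 0)"
    and qser_deriv_at_right_0: "(qser_deriv j k \<longlongrightarrow> 0) (at_right 0)"
proof -
  let ?e = "qexp j k"
  have e0: "?e 0 = 0" using two_qexp[of j k 0] jk by simp
  \<comment> \<open>One factor \<open>x\<close> is split off and the rest compared with its value at
    1/2, which bounds the whole series linearly in \<open>x\<close>.\<close>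
  have pw: "x ^ n \<le> x * (2 * (1/2) ^ n)" if xn: "0 < x" "x \<le> 1/2" "n \<ge> 1" for x :: real and n
  proof -
    obtain i where n: "n = Suc i" using xn(3) by (cases n) auto
    have "x ^ i \<le> (1/2) ^ i" using xn by (intro power_mono) auto
    then show ?thesis unfolding n using xn by simp
  qed
  have s: "(\<lambda>m. norm ((1/2::real) ^ ?e m)) summable_on UNIV"
    using jk by (intro abs_summable_qexp) auto
  have s': "(\<lambda>m. real (?e m) * (1/2) ^ ?e m) summable_on UNIV"
    using jk by (intro summable_qexp_weight) auto
  have "\<bar>qser j k x - 1\<bar> \<le> x * (\<Sum>\<^sub>\<infinity>m. 2 * (1/2) ^ ?e m)" if x: "0 < x" "x \<le> 1/2" for x :: real
  proof -
    have 1: "((\<lambda>m. sgn_pow m * x ^ ?e m) has_sum qser j k x) UNIV"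
      using jk x by (intro has_sum_qser) auto
    have 2: "((\<lambda>m. if m = 0 then 1 else 0) has_sum (1::real)) (UNIV :: int set)"
      by (rule has_sum_finite_neutralI[of "{0}"]) auto
    have 3: "((\<lambda>m. sgn_pow m * x ^ ?e m - (if m = 0 then 1 else 0)) has_sum (qser j k x - 1)) UNIV"
      by (rule has_sum_diff[OF 1 2])
    have sm: "(\<lambda>m. x * (2 * (1/2) ^ ?e m)) summable_on UNIV"
      using s by (intro summable_on_cmult_right) simp
    have b: "norm (sgn_pow m * x ^ ?e m - (if m = 0 then 1 else 0)) \<le> x * (2 * (1/2) ^ ?e m)" for m
      using pw[OF x, of "?e m"] qexp_pos[OF jk, of m] x e0
      by (auto simp: abs_mult abs_sgn_pow)
    have "norm (qser j k x - 1) \<le> (\<Sum>\<^sub>\<infinity>m. x * (2 * (1/2) ^ ?e m))"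
      by (rule norm_infsum_le[OF 3 has_sum_infsum[OF sm]]) (rule b)
    then show ?thesis
      using infsum_cmult_right'[of x "\<lambda>m. 2 * (1/2) ^ ?e m" UNIV] by simp
  qed
  from tendsto_0_at_right_bound[of "\<lambda>x. qser j k x - 1", OF this]
  show "(qser j k \<longlongrightarrow> (1::real)) (at_right 0)"
    by (simp add: LIM_zero_cancel)
  have "\<bar>qser_deriv j k x\<bar> \<le> x * (\<Sum>\<^sub>\<infinity>m. 2 * (real (?e m) * (1/2) ^ ?e m))" if x: "0 < x" "x \<le> 1/2" for x :: real
  proof -
    have xs: "(\<lambda>m. real (?e m) * x ^ ?e m) summable_on UNIV"
      using jk x by (intro summable_qexp_weight) auto
    have "(\<lambda>m. norm (sgn_pow m * real (?e m) * x ^ ?e m)) summable_on UNIV"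
      using xs x by (simp add: abs_mult abs_sgn_pow)
    from has_sum_infsum[OF abs_summable_summable[OF this]]
    have 3: "((\<lambda>m. sgn_pow m * real (?e m) * x ^ ?e m) has_sum qser_deriv j k x) UNIV"
      by (simp only: qser_deriv_def)
    have sm: "(\<lambda>m. x * (2 * (real (?e m) * (1/2) ^ ?e m))) summable_on UNIV"
      using s' by (intro summable_on_cmult_right) simp
    have b: "norm (sgn_pow m * real (?e m) * x ^ ?e m) \<le> x * (2 * (real (?e m) * (1/2) ^ ?e m))" for m
    proof -
      have "real (?e m) * x ^ ?e m \<le> real (?e m) * (x * (2 * (1/2) ^ ?e m))"
        using pw[OF x, of "?e m"] by (cases "?e m = 0") (auto intro!: mult_left_mono)
      then show ?thesis using x by (simp add: abs_mult abs_sgn_pow mult_ac)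
    qed
    have "norm (qser_deriv j k x) \<le> (\<Sum>\<^sub>\<infinity>m. x * (2 * (real (?e m) * (1/2) ^ ?e m)))"
      by (rule norm_infsum_le[OF 3 has_sum_infsum[OF sm]]) (rule b)
    then show ?thesis
      using infsum_cmult_right'[of x "\<lambda>m. 2 * (real (?e m) * (1/2) ^ ?e m)" UNIV] by simp
  qed
  then show "(qser_deriv j k \<longlongrightarrow> 0) (at_right 0)"
    by (rule tendsto_0_at_right_bound)
qed

lemma rr_pos:
  assumes q: "0 < q" "q < 1"
  shows "rr_a q > (0::real)" "rr_b q > (0::real)"
proof -
  have q': "norm q < 1" "q \<noteq> 0" "0 \<le> q" "q ^ 5 < 1" using q by (auto simp: power_less_one_iff)
  note E = euler_pos[OF q'(3) q(2)]
  show b: "rr_b q > 0"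
    using rogers_ramanujan_eq(2)[OF q] E by (simp add: field_simps)
  have "rr_a q * rr_b q > 0"
    using rr_a_mult_rr_b[OF q'(1,2)] E euler_pos[OF _ q'(4)] q by simp
  then show "rr_a q > 0" using b by (simp add: zero_less_mult_iff)
qed

text \<open>Differentiating q^(1/5) a/b produces the expression of \<open>euler_sixth_power\<close>
  over 5 q a b; since a b = \<open>euler q * euler (q ^ 5)\<close>, one of the six Euler factors
  cancels.\<close>

theorem rogers_ramanujan_deriv:
  assumes q: "0 < q" "q < 1"
  shows "rogers_ramanujan q > 0"
    "(rogers_ramanujan has_real_derivative (rogers_ramanujan q * euler q ^ 5 / (5 * q * euler (q ^ 5)))) (at q)"
proof -
  have q': "norm q < 1" "q \<noteq> 0" "0 \<le> q" "q ^ 5 < 1" using q by (auto simp: power_less_one_iff)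
  have E: "euler q > 0" "euler (q ^ 5) > 0"
    using euler_pos[OF q'(3) q(2)] euler_pos[OF _ q'(4)] q by auto
  note pos = rr_pos[OF q]
  let ?a = "rr_a q" and ?b = "rr_b q"
  let ?a' = "qser_deriv 1 5 q" and ?b' = "qser_deriv 2 5 q"
  show "rogers_ramanujan q > 0"
    using q pos by (simp add: rogers_ramanujan_eq[OF q])
  have R: "rogers_ramanujan x = x powr (1/5) * rr_a x / rr_b x" if "0 < x" "x < 1" for x
    using that by (simp add: rogers_ramanujan_eq root_powr_inverse)
  have "((\<lambda>x. x powr (1/5) * rr_a x / rr_b x) has_real_derivative
      (((1/5) * q powr (1/5 - 1) * ?a + q powr (1/5) * (?a' / q)) * ?b - q powr (1/5) * ?a * (?b' / q)) / (?b * ?b)) (at q)"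
    using q pos
    by (auto intro!: derivative_eq_intros qser_has_derivative simp: algebra_simps)
  also have "q powr (1/5 - 1) = q powr (1/5) / q"
    using powr_add[of q "1/5 - 1" 1] q by simp
  also have "(((1/5) * (q powr (1/5) / q) * ?a + q powr (1/5) * (?a' / q)) * ?b - q powr (1/5) * ?a * (?b' / q)) / (?b * ?b)
      = (q powr (1/5) * ?a / ?b) * ((?a * ?b + 5 * (?b * ?a' - ?a * ?b')) / (5 * q * (?a * ?b)))"
    using q pos by (simp add: field_simps)
  also have "\<dots> = rogers_ramanujan q * euler q ^ 5 / (5 * q * euler (q ^ 5))"
    unfolding euler_sixth_power[OF q, symmetric]
    unfolding rr_a_mult_rr_b[OF q'(1,2)] R[OF q, symmetric]
  proof -
    have "euler q ^ 6 = euler q * euler q ^ 5" by (simp flip: power_Suc)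
    then show "rogers_ramanujan q * (euler q ^ 6 / (5 * q * (euler q * euler (q ^ 5))))
        = rogers_ramanujan q * euler q ^ 5 / (5 * q * euler (q ^ 5))"
      using E by simp
  qed
  finally have *: "((\<lambda>x. x powr (1/5) * rr_a x / rr_b x) has_real_derivative rogers_ramanujan q * euler q ^ 5 / (5 * q * euler (q ^ 5))) (at q)" .
  moreover have "eventually (\<lambda>x. x powr (1/5) * rr_a x / rr_b x = rogers_ramanujan x) (nhds q)"
    using eventually_nhds_in_open[of "{0<..<1}" q] q by (auto elim!: eventually_mono simp: R)
  ultimately show "(rogers_ramanujan has_real_derivative (rogers_ramanujan q * euler q ^ 5 / (5 * q * euler (q ^ 5)))) (at q)"
    by (rule has_derivative_transform_nhds)
qed

lemma rogers_ramanujan_at_right_0: "(rogers_ramanujan \<longlongrightarrow> 0) (at_right 0)"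
proof -
  have "((\<lambda>x. root 5 x * rr_a x / rr_b x) \<longlongrightarrow> root 5 0 * 1 / 1) (at_right 0)"
    by (intro tendsto_intros qser_at_right_0) auto
  moreover have "eventually (\<lambda>x::real. x \<in> {0<..<1}) (at_right 0)"
    by (rule eventually_at_right_real) simp
  then have "eventually (\<lambda>x. root 5 x * rr_a x / rr_b x = rogers_ramanujan x) (at_right 0)"
    by eventually_elim (simp add: rogers_ramanujan_eq)
  ultimately show ?thesis
    using tendsto_cong by force
qed

section \<open>Theta constants and the modulus\<close>

lemma qpoch_inf_times_neg:
  fixes q :: "'a::{real_normed_field,banach}"
  assumes "norm q < 1"
  shows "qpoch_inf z q * qpoch_inf (- z) q = qpoch_inf (z\<^sup>2) (q\<^sup>2)"
proof (rule LIMSEQ_unique)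
  show "(\<lambda>n. qpoch z q n * qpoch (- z) q n) \<longlonglongrightarrow> qpoch_inf z q * qpoch_inf (- z) q"
    by (intro tendsto_mult qpoch_tendsto assms)
  have "qpoch z q n * qpoch (- z) q n = qpoch (z\<^sup>2) (q\<^sup>2) n" for n
    unfolding qpoch_def prod.distrib[symmetric]
    by (intro prod.cong) (simp_all add: algebra_simps power2_eq_square power_mult_distrib)
  moreover have "norm (q\<^sup>2) < 1"
    using assms by (simp add: norm_power power_less_one_iff)
  ultimately show "(\<lambda>n. qpoch z q n * qpoch (- z) q n) \<longlonglongrightarrow> qpoch_inf (z\<^sup>2) (q\<^sup>2)"
    by (simp add: qpoch_tendsto)
qed

section \<open>Theta constants as Euler products\<close>

definition qser_plus :: "nat \<Rightarrow> nat \<Rightarrow> real \<Rightarrow> real" where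
  "qser_plus j k q = (\<Sum>\<^sub>\<infinity>m. q ^ qexp j k m)"

lemma qser_plus_product:
  assumes q: "0 < q" "q < 1" and k: "k > 0" "j \<le> k"
  shows "qser_plus j k q = qpoch_inf (- (q ^ j)) (q ^ k) * qpoch_inf (- (q ^ (k - j))) (q ^ k) * euler (q ^ k)"
proof -
  have qk: "norm (q ^ k) < 1" "q ^ k \<noteq> 0"
    using q k by (simp_all add: power_less_one_iff power_abs)
  have "q ^ qexp j k m = (q ^ j) powi m * (q ^ k) ^ tri m" for m
  proof -
    have "q ^ qexp j k m = q powi (int j * m + int k * int (tri m))"
      using qexp_tri[OF k(2), of m] by (metis power_int_of_nat)
    also have "\<dots> = (q powi int j) powi m * (q powi int k) powi int (tri m)"
      using q by (simp add: power_int_add power_int_mult)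
    finally show ?thesis by simp
  qed
  then show ?thesis
    using infsumI[OF jacobi_triple[OF qk, of "- (q ^ j)"]] q k
    unfolding qser_plus_def by (simp add: power_diff)
qed

definition theta3 :: "real \<Rightarrow> real" where "theta3 q = qser_plus 1 2 q"
definition theta4 :: "real \<Rightarrow> real" where "theta4 q = qser 1 2 q"
definition psi2 :: "real \<Rightarrow> real" where "psi2 q = qser_plus 0 2 q"

lemma power_in_unit: "0 < q \<Longrightarrow> q < 1 \<Longrightarrow> n > 0 \<Longrightarrow> 0 < q ^ n \<and> q ^ n < (1::real)"
  by (simp add: power_less_one_iff)

text \<open>Once all three constants are monomials in the Euler products at q, q^2 and q^4,
  multiplicative relations between them are mere cancellation.\<close>

lemma
  assumes q: "0 < q" "q < 1"
  shows theta4_euler: "theta4 q = euler q ^ 2 / euler (q\<^sup>2)"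
    and theta3_euler: "theta3 q = euler (q\<^sup>2) ^ 5 / (euler q ^ 2 * euler (q ^ 4) ^ 2)"
    and psi2_euler: "psi2 q = 2 * euler (q ^ 4) ^ 2 / euler (q\<^sup>2)"
proof -
  have q2: "0 < q\<^sup>2" "q\<^sup>2 < 1" and q4: "0 < q ^ 4" "q ^ 4 < 1"
    using power_in_unit[OF q, of 2] power_in_unit[OF q, of 4] by auto
  have pos: "euler q > 0" "euler (q\<^sup>2) > 0" "euler (q ^ 4) > 0"
    using euler_pos[of q] euler_pos[of "q\<^sup>2"] euler_pos[of "q ^ 4"] q q2 q4 by auto
  have q4': "(q\<^sup>2)\<^sup>2 = q ^ 4" by simp
  have dis: "euler x = qpoch_inf x (x\<^sup>2) * euler (x\<^sup>2)" if "0 < x" "x < 1" for x :: real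
    using qpoch_inf_dissect[of x 2 x] that by (simp add: lessThan_Suc numeral_2_eq_2)
  note d = dis[OF q] and d2 = dis[OF q2, unfolded q4']
  have n1: "qpoch_inf q (q\<^sup>2) * qpoch_inf (- q) (q\<^sup>2) = qpoch_inf (q\<^sup>2) (q ^ 4)"
    using qpoch_inf_times_neg[of "q\<^sup>2" q] q2 by simp
  have n2: "euler (q\<^sup>2) * qpoch_inf (- (q\<^sup>2)) (q\<^sup>2) = euler (q ^ 4)"
    using qpoch_inf_times_neg[of "q\<^sup>2" "q\<^sup>2"] q2 by simp
  have n3: "qpoch_inf (- 1) (q\<^sup>2) = 2 * qpoch_inf (- (q\<^sup>2)) (q\<^sup>2)"
    using qpoch_inf_Suc[of "q\<^sup>2" "-1"] q2 by simp
  have e1: "qpoch_inf q (q\<^sup>2) = euler q / euler (q\<^sup>2)"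
    using d pos by simp
  have X: "qpoch_inf (q\<^sup>2) (q ^ 4) = euler (q\<^sup>2) / euler (q ^ 4)"
    using d2 pos by simp
  have e2: "qpoch_inf (- q) (q\<^sup>2) = euler (q\<^sup>2) / euler (q ^ 4) / (euler q / euler (q\<^sup>2))"
    unfolding n1[unfolded e1 X, symmetric] using pos by simp
  have e3: "qpoch_inf (- (q\<^sup>2)) (q\<^sup>2) = euler (q ^ 4) / euler (q\<^sup>2)"
    unfolding n2[symmetric] using pos by simp
  define x y z where xyz: "x = euler q" "y = euler (q\<^sup>2)" "z = euler (q ^ 4)"
  have pos': "x > 0" "y > 0" "z > 0" using pos by (simp_all add: xyz)
  have "theta4 q = qpoch_inf q (q\<^sup>2) * qpoch_inf q (q\<^sup>2) * euler (q\<^sup>2)"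
    unfolding theta4_def using qser_product[of q 2 1] q by simp
  then show "theta4 q = euler q ^ 2 / euler (q\<^sup>2)"
    unfolding e1 xyz[symmetric] using pos' by (simp add: power2_eq_square)
  have "theta3 q = qpoch_inf (- q) (q\<^sup>2) * qpoch_inf (- q) (q\<^sup>2) * euler (q\<^sup>2)"
    unfolding theta3_def using qser_plus_product[of q 2 1] q by simp
  then show "theta3 q = euler (q\<^sup>2) ^ 5 / (euler q ^ 2 * euler (q ^ 4) ^ 2)"
    unfolding e2 xyz[symmetric] using pos' by (simp add: eval_nat_numeral mult_ac)
  have "psi2 q = qpoch_inf (- 1) (q\<^sup>2) * qpoch_inf (- (q\<^sup>2)) (q\<^sup>2) * euler (q\<^sup>2)"
    unfolding psi2_def using qser_plus_product[of q 2 0] q by simp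
  then show "psi2 q = 2 * euler (q ^ 4) ^ 2 / euler (q\<^sup>2)"
    unfolding n3 e3 xyz[symmetric] using pos' by (simp add: power2_eq_square)
qed

text \<open>(a, b) -> (a + b, a - b) maps integer pairs onto those of even sum and doubles a^2 +
  b^2; pairs of odd sum arise in the same way from half-integers, which is where \<open>psi2\<close>
  enters. The signs of \<open>theta4\<close> subtract the second class instead of adding it.\<close>

lemma theta_sums_of_squares:
  assumes q: "0 < q" "q < 1"
  shows "theta3 q ^ 2 = theta3 (q\<^sup>2) ^ 2 + q * psi2 (q\<^sup>2) ^ 2"
    and "theta4 q ^ 2 = theta3 (q\<^sup>2) ^ 2 - q * psi2 (q\<^sup>2) ^ 2"
proof -
  define f where "f = (\<lambda>z. q ^ qexp 1 2 (fst z) * q ^ qexp 1 2 (snd z))"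
  have q2: "0 < q\<^sup>2" "q\<^sup>2 < 1"
    using power_in_unit[OF q, of 2] by auto
  have s: "(\<lambda>m. norm (r ^ qexp j 2 m)) summable_on UNIV" if "0 < r" "r < 1" "j \<le> 2" for r :: real and j
    by (rule abs_summable_qexp) (use that in auto)
  have s1: "(\<lambda>m. norm (sgn_pow m * q ^ qexp 1 2 m)) summable_on UNIV"
    using s[OF q, of 1] by (simp add: abs_mult abs_sgn_pow)
  have f: "(f has_sum theta3 q ^ 2) UNIV"
    using has_sum_times[OF s[OF q, of 1] s[OF q, of 1]]
    by (simp add: f_def theta3_def qser_plus_def power2_eq_square)
  have f4: "(\<Sum>\<^sub>\<infinity>z. sgn_pow (fst z + snd z) * f z) = theta4 q ^ 2"
    using infsumI[OF has_sum_times[OF s1 s1]]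
    by (simp add: f_def theta4_def qser_def power2_eq_square power_int_add mult_ac)
  have b1: "bij_betw (\<lambda>(a, b). (a + b, a - b)) UNIV even_pairs"
  proof (rule bij_betwI')
    fix z :: "int \<times> int" assume "z \<in> even_pairs"
    then obtain m where "fst z + snd z = 2 * m" unfolding mem_Collect_eq by (metis evenE)
    then show "\<exists>x\<in>UNIV. z = (case x of (a, b) \<Rightarrow> (a + b, a - b))"
      by (intro bexI[of _ "(m, fst z - m)"]) (auto simp: prod_eq_iff)
  qed auto
  have b2: "bij_betw (\<lambda>(a, b). (a + b - 1, a - b)) UNIV (- even_pairs)"
  proof (rule bij_betwI')
    fix z :: "int \<times> int" assume "z \<in> - even_pairs"
    then obtain m where "fst z + snd z = 2 * m + 1" unfolding mem_Collect_eq Compl_iff by (metis oddE)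
    then show "\<exists>x\<in>UNIV. z = (case x of (a, b) \<Rightarrow> (a + b - 1, a - b))"
      by (intro bexI[of _ "(m + 1, fst z - m)"]) (auto simp: prod_eq_iff)
  qed auto
  have E: "infsum f even_pairs = theta3 (q\<^sup>2) ^ 2"
  proof -
    have "f (a + b, a - b) = (q\<^sup>2) ^ qexp 1 2 a * (q\<^sup>2) ^ qexp 1 2 b" for a b
    proof -
      have "2 * int (qexp 1 2 (a + b) + qexp 1 2 (a - b)) = 2 * int (2 * qexp 1 2 a + 2 * qexp 1 2 b)"
        using two_qexp[of 1 2 "a + b"] two_qexp[of 1 2 "a - b"] two_qexp[of 1 2 a] two_qexp[of 1 2 b]
        by (simp add: algebra_simps)
      then have "qexp 1 2 (a + b) + qexp 1 2 (a - b) = 2 * qexp 1 2 a + 2 * qexp 1 2 b"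
        by (rule two_int_cancel)
      then show ?thesis
        by (simp add: f_def flip: power_add power_mult)
    qed
    then have "infsum f even_pairs = (\<Sum>\<^sub>\<infinity>z. (q\<^sup>2) ^ qexp 1 2 (fst z) * (q\<^sup>2) ^ qexp 1 2 (snd z))"
      unfolding infsum_reindex_bij_betw[OF b1, symmetric, of f] by (simp add: case_prod_unfold)
    also have "\<dots> = theta3 (q\<^sup>2) ^ 2"
      using infsumI[OF has_sum_times[OF s[OF q2, of 1] s[OF q2, of 1]]]
      by (simp add: theta3_def qser_plus_def power2_eq_square)
    finally show ?thesis .
  qed
  have O: "infsum f (- even_pairs) = q * psi2 (q\<^sup>2) ^ 2"
  proof -
    have "f (a + b - 1, a - b) = q * ((q\<^sup>2) ^ qexp 0 2 a * (q\<^sup>2) ^ qexp 0 2 b)" for a b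
    proof -
      have "2 * int (qexp 1 2 (a + b - 1) + qexp 1 2 (a - b)) = 2 * int (1 + (2 * qexp 0 2 a + 2 * qexp 0 2 b))"
        using two_qexp[of 1 2 "a + b - 1"] two_qexp[of 1 2 "a - b"] two_qexp[of 0 2 a] two_qexp[of 0 2 b]
        by (simp add: algebra_simps)
      then have "qexp 1 2 (a + b - 1) + qexp 1 2 (a - b) = 1 + (2 * qexp 0 2 a + 2 * qexp 0 2 b)"
        by (rule two_int_cancel)
      then show ?thesis
        by (simp add: f_def flip: power_add power_mult power_Suc)
    qed
    then have "infsum f (- even_pairs) = (\<Sum>\<^sub>\<infinity>z. q * ((q\<^sup>2) ^ qexp 0 2 (fst z) * (q\<^sup>2) ^ qexp 0 2 (snd z)))"
      unfolding infsum_reindex_bij_betw[OF b2, symmetric, of f] by (simp add: case_prod_unfold)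
    also have "\<dots> = q * psi2 (q\<^sup>2) ^ 2"
      unfolding infsum_cmult_right' using infsumI[OF has_sum_times[OF s[OF q2, of 0] s[OF q2, of 0]]]
      by (simp add: psi2_def qser_plus_def power2_eq_square)
    finally show ?thesis .
  qed
  have fs: "f summable_on A" for A
    using has_sum_imp_summable[OF f] by (rule summable_on_subset_banach) simp
  have "infsum f (even_pairs \<union> - even_pairs) = infsum f even_pairs + infsum f (- even_pairs)"
    by (rule infsum_Un_disjoint[OF fs fs]) auto
  then show "theta3 q ^ 2 = theta3 (q\<^sup>2) ^ 2 + q * psi2 (q\<^sup>2) ^ 2"
    using infsumI[OF f] E O by (simp only: Compl_partition)
  show "theta4 q ^ 2 = theta3 (q\<^sup>2) ^ 2 - q * psi2 (q\<^sup>2) ^ 2"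
    using infsum_parity_split[OF fs] f4 E O by simp
qed

text \<open>Squares of the theta constants \<open>\<theta>\<^sub>3\<close>, \<open>\<theta>\<^sub>4\<close>, \<open>\<theta>\<^sub>2\<close> at nome \<open>q\<close>; \<open>psi2\<close> is \<open>q\<close> to the power \<open>-1/4\<close> times
  \<open>\<theta>\<^sub>2\<close>.\<close>

definition thA :: "real \<Rightarrow> real" where "thA q = theta3 q ^ 2"
definition thB :: "real \<Rightarrow> real" where "thB q = theta4 q ^ 2"
definition thC :: "real \<Rightarrow> real" where "thC q = sqrt q * psi2 q ^ 2"
definition theta_modulus :: "real \<Rightarrow> real" where "theta_modulus q = thC q / thA q"

lemma
  assumes q: "0 < q" "q < 1"
  shows thA_pos: "thA q > 0" and thB_pos: "thB q > 0" and thC_pos: "thC q > 0"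
proof -
  have q2: "0 < q\<^sup>2" "q\<^sup>2 < 1" and q4: "0 < q ^ 4" "q ^ 4 < 1"
    using power_in_unit[OF q, of 2] power_in_unit[OF q, of 4] by auto
  have "euler q > 0" "euler (q\<^sup>2) > 0" "euler (q ^ 4) > 0"
    using euler_pos[of q] euler_pos[of "q\<^sup>2"] euler_pos[of "q ^ 4"] q q2 q4 by auto
  then show "thA q > 0" "thB q > 0" "thC q > 0"
    using q unfolding thA_def thB_def thC_def theta3_euler[OF q] theta4_euler[OF q] psi2_euler[OF q] by simp_all
qed

text \<open>From q to q^2, the pair (\<open>thA\<close>, \<open>thB\<close>) makes one
  arithmetic-geometric mean step. The pair (\<open>thA\<close>, \<open>thC\<close>) makes that step,
  up to a factor 2, in the opposite direction, from q^2 to q.\<close>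

lemma
  assumes q: "0 < q" "q < 1"
  shows thA_square_arg: "thA q = thA (q\<^sup>2) + thC (q\<^sup>2)"
    and thB_square_arg: "thB q = thA (q\<^sup>2) - thC (q\<^sup>2)"
    and thA_thB: "thA q * thB q = (thB (q\<^sup>2))\<^sup>2"
    and thC_squared: "(thC q)\<^sup>2 = 4 * thA (q\<^sup>2) * thC (q\<^sup>2)"
proof -
  have q2: "0 < q\<^sup>2" "q\<^sup>2 < 1" and q4: "0 < q ^ 4" "q ^ 4 < 1" and q8: "0 < q ^ 8" "q ^ 8 < 1"
    using power_in_unit[OF q, of 2] power_in_unit[OF q, of 4] power_in_unit[OF q, of 8] by auto
  have pos: "euler q > 0" "euler (q\<^sup>2) > 0" "euler (q ^ 4) > 0" "euler (q ^ 8) > 0"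
    using euler_pos[of q] euler_pos[of "q\<^sup>2"] euler_pos[of "q ^ 4"] euler_pos[of "q ^ 8"] q q2 q4 q8 by auto
  have pw: "(q\<^sup>2)\<^sup>2 = q ^ 4" "(q\<^sup>2) ^ 4 = q ^ 8" by simp_all
  define x y z w where xyz: "x = euler q" "y = euler (q\<^sup>2)" "z = euler (q ^ 4)" "w = euler (q ^ 8)"
  have pos': "x > 0" "y > 0" "z > 0" "w > 0" using pos by (simp_all add: xyz)
  show "thA q = thA (q\<^sup>2) + thC (q\<^sup>2)" "thB q = thA (q\<^sup>2) - thC (q\<^sup>2)"
    using theta_sums_of_squares[OF q] q unfolding thA_def thB_def thC_def by simp_all
  have "theta3 q * theta4 q = theta4 (q\<^sup>2) ^ 2"
    unfolding theta3_euler[OF q] theta4_euler[OF q] theta4_euler[OF q2] pw xyz[symmetric] using pos'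
    by (simp add: field_simps eval_nat_numeral)
  then show "thA q * thB q = (thB (q\<^sup>2))\<^sup>2"
    unfolding thA_def thB_def by (simp flip: power_mult_distrib)
  have "psi2 q ^ 2 = 2 * theta3 (q\<^sup>2) * psi2 (q\<^sup>2)"
    unfolding theta3_euler[OF q2] psi2_euler[OF q] psi2_euler[OF q2] pw xyz[symmetric] using pos'
    by (simp add: field_simps eval_nat_numeral)
  then have "(psi2 q ^ 2)\<^sup>2 = 4 * (theta3 (q\<^sup>2))\<^sup>2 * (psi2 (q\<^sup>2))\<^sup>2"
    by (simp add: power_mult_distrib)
  then show "(thC q)\<^sup>2 = 4 * thA (q\<^sup>2) * thC (q\<^sup>2)"
    using q unfolding thA_def thC_def by (simp add: power_mult_distrib)
qed

text \<open>Jacobi's quartic identity. At the nome sqrt q the values of \<open>thA\<close> and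
  \<open>thB\<close> are the sum and difference of \<open>thA q\<close> and \<open>thC q\<close>,
  and their product is a square already known.\<close>

lemma thA_eq_thB_thC:
  assumes q: "0 < q" "q < 1"
  shows "(thA q)\<^sup>2 = (thB q)\<^sup>2 + (thC q)\<^sup>2"
proof -
  define s where "s = sqrt q"
  have s: "0 < s" "s < 1" "s\<^sup>2 = q" using q by (simp_all add: s_def)
  have "(thA q + thC q) * (thA q - thC q) = (thB q)\<^sup>2"
    using thA_square_arg[OF s(1,2)] thB_square_arg[OF s(1,2)] thA_thB[OF s(1,2)] unfolding s(3) by simp
  then show ?thesis by (simp add: algebra_simps power2_eq_square)
qed

lemma theta_modulus_bounds:
  assumes q: "0 < q" "q < 1"
  shows "0 < theta_modulus q" "theta_modulus q < 1" "1 - (theta_modulus q)\<^sup>2 = (thB q / thA q)\<^sup>2"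
proof -
  note pos = thA_pos[OF q] thB_pos[OF q] thC_pos[OF q]
  show "0 < theta_modulus q" using pos by (simp add: theta_modulus_def)
  have "(thC q)\<^sup>2 < (thA q)\<^sup>2" using thA_eq_thB_thC[OF q] pos by simp
  then have "thC q < thA q" using pos by (meson less_imp_le power_less_imp_less_base)
  then show "theta_modulus q < 1" using pos by (simp add: theta_modulus_def)
  show "1 - (theta_modulus q)\<^sup>2 = (thB q / thA q)\<^sup>2"
    using thA_eq_thB_thC[OF q] pos by (simp add: theta_modulus_def field_simps)
qed

text \<open>Landen's relation between k at q and l at q^2: k = 2 sqrt l / (1 + l), with
  complementary modulus k' = (1 - l)/(1 + l) = thB/thA.\<close>

lemma theta_modulus_square_arg:
  assumes q: "0 < q" "q < 1"
  shows "(theta_modulus q)\<^sup>2 = 4 * theta_modulus (q\<^sup>2) / (1 + theta_modulus (q\<^sup>2))\<^sup>2"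
    and "(1 + theta_modulus (q\<^sup>2)) / (1 - theta_modulus (q\<^sup>2)) = thA q / thB q"
proof -
  have q2: "0 < q\<^sup>2" "q\<^sup>2 < 1" using power_in_unit[OF q, of 2] by auto
  note pos = thA_pos[OF q] thB_pos[OF q] thC_pos[OF q] thA_pos[OF q2] thC_pos[OF q2]
  have e: "1 + theta_modulus (q\<^sup>2) = thA q / thA (q\<^sup>2)" "1 - theta_modulus (q\<^sup>2) = thB q / thA (q\<^sup>2)"
    unfolding thA_square_arg[OF q] thB_square_arg[OF q] using pos by (simp_all add: theta_modulus_def field_simps)
  show "(theta_modulus q)\<^sup>2 = 4 * theta_modulus (q\<^sup>2) / (1 + theta_modulus (q\<^sup>2))\<^sup>2"
    unfolding e using thC_squared[OF q] pos
    by (simp add: theta_modulus_def power_divide power2_eq_square[of "thA (q\<^sup>2)"])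
  show "(1 + theta_modulus (q\<^sup>2)) / (1 - theta_modulus (q\<^sup>2)) = thA q / thB q"
    unfolding e using pos by simp
qed

section \<open>Behaviour of the theta constants at 0\<close>

lemma tendsto_power_at_right_0:
  assumes "(f \<longlongrightarrow> L) (at_right 0)" "n > 0"
  shows "((\<lambda>q::real. f (q ^ n)) \<longlongrightarrow> L) (at_right 0)"
proof (rule filterlim_compose[OF assms(1)])
  have "((\<lambda>q::real. q ^ n) \<longlongrightarrow> 0) (at_right 0)"
    using assms(2) by (auto intro!: tendsto_eq_intros)
  moreover have "eventually (\<lambda>q::real. q ^ n \<in> {0<..} \<and> q ^ n \<noteq> 0) (at_right 0)"
    using eventually_at_right_less[of 0] by (rule eventually_mono) simp
  ultimately show "filterlim (\<lambda>q::real. q ^ n) (at_right 0) (at_right 0)"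
    unfolding filterlim_at by blast
qed

lemma euler_at_right_0: "(euler \<longlongrightarrow> (1::real)) (at_right 0)"
proof -
  have "eventually (\<lambda>x::real. x \<in> {0<..<1}) (at_right 0)"
    by (rule eventually_at_right_real) simp
  then have "eventually (\<lambda>x::real. qser 1 3 x = euler x) (at_right 0)"
  proof eventually_elim
    case (elim x)
    then show ?case using euler_pentagonal[of x] by simp
  qed
  with qser_at_right_0[of 1 3] show ?thesis
    using tendsto_cong by force
qed

lemma
  shows thA_at_right_0: "(thA \<longlongrightarrow> 1) (at_right 0)"
    and thB_at_right_0: "(thB \<longlongrightarrow> 1) (at_right 0)"
    and thC_at_right_0: "((\<lambda>q. thC q / sqrt q) \<longlongrightarrow> 4) (at_right 0)"
proof -
  note t = euler_at_right_0 tendsto_power_at_right_0[OF euler_at_right_0]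
  have ev: "eventually (\<lambda>x::real. x \<in> {0<..<1}) (at_right 0)"
    by (rule eventually_at_right_real) simp
  have "((\<lambda>q::real. (euler (q\<^sup>2) ^ 5 / (euler q ^ 2 * euler (q ^ 4) ^ 2)) ^ 2) \<longlongrightarrow> (1 ^ 5 / (1 ^ 2 * 1 ^ 2)) ^ 2) (at_right 0)"
    by (intro tendsto_intros t) auto
  moreover have "eventually (\<lambda>q::real. (euler (q\<^sup>2) ^ 5 / (euler q ^ 2 * euler (q ^ 4) ^ 2)) ^ 2 = thA q) (at_right 0)"
    using ev by eventually_elim (simp add: thA_def theta3_euler)
  ultimately show "(thA \<longlongrightarrow> 1) (at_right 0)"
    using tendsto_cong by force
  have "((\<lambda>q::real. (euler q ^ 2 / euler (q\<^sup>2)) ^ 2) \<longlongrightarrow> (1 ^ 2 / 1) ^ 2) (at_right 0)"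
    by (intro tendsto_intros t) auto
  moreover have "eventually (\<lambda>q::real. (euler q ^ 2 / euler (q\<^sup>2)) ^ 2 = thB q) (at_right 0)"
    using ev by eventually_elim (simp add: thB_def theta4_euler)
  ultimately show "(thB \<longlongrightarrow> 1) (at_right 0)"
    using tendsto_cong by force
  have "((\<lambda>q::real. (2 * euler (q ^ 4) ^ 2 / euler (q\<^sup>2)) ^ 2) \<longlongrightarrow> (2 * 1 ^ 2 / 1) ^ 2) (at_right 0)"
    by (intro tendsto_intros t) auto
  moreover have "eventually (\<lambda>q::real. (2 * euler (q ^ 4) ^ 2 / euler (q\<^sup>2)) ^ 2 = thC q / sqrt q) (at_right 0)"
    using ev by eventually_elim (simp add: thC_def psi2_euler)
  ultimately show "((\<lambda>q. thC q / sqrt q) \<longlongrightarrow> 4) (at_right 0)"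
    using tendsto_cong by force
qed

definition euler_dlog :: "real \<Rightarrow> real" where
  "euler_dlog q = qser_deriv 1 3 q / euler q"

lemma ln_euler_power_deriv:
  assumes q: "0 < q" "q < 1" and n: "n > 0"
  shows "((\<lambda>x. ln (euler (x ^ n))) has_real_derivative (real n * euler_dlog (q ^ n) / q)) (at q)"
proof -
  have qn: "0 < q ^ n" "q ^ n < 1" using power_in_unit[OF q n] by auto
  have "eventually (\<lambda>x::real. qser 1 3 x = euler x) (nhds (q ^ n))"
  proof -
    have "qser 1 3 x = euler x" if "x \<in> {0<..<1}" for x :: real
      using that euler_pentagonal[of x] by simp
    then show ?thesis
      using eventually_nhds_in_open[of "{0<..<1}" "q ^ n"] qn by (auto elim!: eventually_mono)
  qed
  moreover have "(qser 1 3 has_real_derivative (qser_deriv 1 3 (q ^ n) / q ^ n)) (at (q ^ n))"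
    by (rule qser_has_derivative[OF qn]) simp_all
  ultimately have d: "(euler has_real_derivative (qser_deriv 1 3 (q ^ n) / q ^ n)) (at (q ^ n))"
    by (rule has_derivative_transform_nhds[where f = "qser 1 3" and g = euler, rotated])
  have "euler (q ^ n) > 0" using euler_pos[of "q ^ n"] qn by simp
  have "((\<lambda>x. x ^ n) has_real_derivative (real n * q ^ (n - 1))) (at q)"
    by (auto intro!: derivative_eq_intros)
  from DERIV_chain2[where f = euler and g = "\<lambda>x. x ^ n", OF d this]
  have "((\<lambda>x. ln (euler (x ^ n))) has_real_derivative
      (1 / euler (q ^ n) * (qser_deriv 1 3 (q ^ n) / q ^ n * (real n * q ^ (n - 1))))) (at q)"
    by (rule DERIV_chain2[where f = ln and g = "\<lambda>x. euler (x ^ n)", OF DERIV_ln_divide[OF \<open>euler (q ^ n) > 0\<close>]])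
  moreover have "q ^ n = q * q ^ (n - 1)"
    using n by (cases n) auto
  then have "1 / euler (q ^ n) * (qser_deriv 1 3 (q ^ n) / q ^ n * (real n * q ^ (n - 1))) = real n * euler_dlog (q ^ n) / q"
    using q by (simp add: euler_dlog_def)
  ultimately show ?thesis by simp
qed

text \<open>The logarithmic derivative q k'/k read off from k = 4 sqrt q E(q)^4 E(q^4)^8 /
  E(q^2)^12.\<close>

definition theta_weight :: "real \<Rightarrow> real" where
  "theta_weight q = 1 / 2 + 32 * euler_dlog (q ^ 4) + 4 * euler_dlog q - 24 * euler_dlog (q\<^sup>2)"

lemma theta_modulus_deriv_aux:
  assumes q: "0 < q" "q < 1"
  shows "(theta_modulus has_real_derivative (theta_modulus q * theta_weight q / q)) (at q)"
proof -
  define L where "L = (\<lambda>x::real. ln 4 + ln x / 2 + 8 * ln (euler (x ^ 4)) + 4 * ln (euler (x ^ 1)) - 12 * ln (euler (x\<^sup>2)))"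
  have eq: "exp (L x) = theta_modulus x" if x: "0 < x" "x < 1" for x
  proof -
    have x2: "0 < x\<^sup>2" "x\<^sup>2 < 1" and x4: "0 < x ^ 4" "x ^ 4 < 1"
      using power_in_unit[OF x, of 2] power_in_unit[OF x, of 4] by auto
    define a b c where abc: "a = euler x" "b = euler (x\<^sup>2)" "c = euler (x ^ 4)"
    have pos: "a > 0" "b > 0" "c > 0"
      using euler_pos[of x] euler_pos[of "x\<^sup>2"] euler_pos[of "x ^ 4"] x x2 x4 by (auto simp: abc)
    have "L x = ln (4 * sqrt x * c ^ 8 * a ^ 4 / b ^ 12)"
      using x pos unfolding L_def power_one_right abc[symmetric]
      by (simp add: ln_mult ln_div ln_realpow ln_sqrt)
    then have "exp (L x) = 4 * sqrt x * c ^ 8 * a ^ 4 / b ^ 12"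
      using x pos by simp
    also have "\<dots> = theta_modulus x"
      unfolding theta_modulus_def thA_def thC_def theta3_euler[OF x] psi2_euler[OF x] abc[symmetric] using pos
      by (simp add: power_mult_distrib power_divide flip: power_mult)
    finally show ?thesis .
  qed
  have "(L has_real_derivative (1 / q / 2 + 8 * (real 4 * euler_dlog (q ^ 4) / q) + 4 * (real 1 * euler_dlog (q ^ 1) / q)
      - 12 * (real 2 * euler_dlog (q ^ 2) / q))) (at q)"
    unfolding L_def using q
    by (intro DERIV_add DERIV_diff DERIV_cmult ln_euler_power_deriv) (auto intro!: derivative_eq_intros)
  also have "(1 / q / 2 + 8 * (real 4 * euler_dlog (q ^ 4) / q) + 4 * (real 1 * euler_dlog (q ^ 1) / q)
      - 12 * (real 2 * euler_dlog (q ^ 2) / q)) = theta_weight q / q"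
    using q by (simp add: theta_weight_def field_simps)
  finally have "((\<lambda>x. exp (L x)) has_real_derivative (exp (L q) * (theta_weight q / q))) (at q)"
    by (auto intro!: derivative_eq_intros)
  moreover have "eventually (\<lambda>x. exp (L x) = theta_modulus x) (nhds q)"
    using eventually_nhds_in_open[of "{0<..<1}" q] q by (auto elim!: eventually_mono simp: eq)
  ultimately show ?thesis
    using has_derivative_transform_nhds eq[OF q] by fastforce
qed

text \<open>The modular equation of degree two makes \<open>theta_weight q / thB q ^ 2\<close> invariant under
  \<open>q \<mapsto> q\<^sup>2\<close>, so it equals its limit at \<open>0\<close>.\<close>

lemma theta_weight_square_arg:
  assumes q: "0 < q" "q < 1"
  shows "theta_weight (q\<^sup>2) / (thB (q\<^sup>2))\<^sup>2 = theta_weight q / (thB q)\<^sup>2"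
proof -
  have q2: "0 < q\<^sup>2" "q\<^sup>2 < 1" using power_in_unit[OF q, of 2] by auto
  define k l where kl: "k = theta_modulus q" "l = theta_modulus (q\<^sup>2)"
  note bounds = theta_modulus_bounds[OF q, folded kl] theta_modulus_bounds[OF q2, folded kl]
  have d1: "((\<lambda>x. (theta_modulus x)\<^sup>2) has_real_derivative (2 * k * (k * theta_weight q / q))) (at q)"
    using theta_modulus_deriv_aux[OF q] unfolding kl by (auto intro!: derivative_eq_intros)
  have d2: "((\<lambda>x. theta_modulus (x\<^sup>2)) has_real_derivative (2 * l * theta_weight (q\<^sup>2) / q)) (at q)"
  proof -
    have "((\<lambda>x. theta_modulus (x\<^sup>2)) has_real_derivative ((l * theta_weight (q\<^sup>2) / q\<^sup>2) * (2 * q))) (at q)"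
      unfolding kl
      by (rule DERIV_chain2[where g = "\<lambda>x. x^2", OF theta_modulus_deriv_aux[OF q2]]) (auto intro!: derivative_eq_intros)
    then show ?thesis using q by (simp add: field_simps power2_eq_square)
  qed
  have d3: "((\<lambda>x. 4 * theta_modulus (x\<^sup>2) / (1 + theta_modulus (x\<^sup>2))\<^sup>2) has_real_derivative
      (4 * (1 - l) / (1 + l) ^ 3 * (2 * l * theta_weight (q\<^sup>2) / q))) (at q)"
  proof -
    have "((\<lambda>y. 4 * y / (1 + y)\<^sup>2) has_real_derivative (4 * (1 - l) / (1 + l) ^ 3)) (at l)"
    proof -
      have "((\<lambda>y. 4 * y / (1 + y)\<^sup>2) has_real_derivative ((4 * (1 + l)\<^sup>2 - 4 * l * (2 * (1 + l))) / ((1 + l)\<^sup>2 * (1 + l)\<^sup>2))) (at l)"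
        using bounds by (auto intro!: derivative_eq_intros)
      also have "(4 * (1 + l)\<^sup>2 - 4 * l * (2 * (1 + l))) / ((1 + l)\<^sup>2 * (1 + l)\<^sup>2) = 4 * (1 - l) / (1 + l) ^ 3"
      proof -
        have "4 * (1 + l)\<^sup>2 - 4 * l * (2 * (1 + l)) = (4 * (1 - l)) * (1 + l)"
          by (simp add: algebra_simps power2_eq_square)
        moreover have "(1 + l)\<^sup>2 * (1 + l)\<^sup>2 = (1 + l) ^ 3 * (1 + l)"
          by (simp add: eval_nat_numeral)
        ultimately show ?thesis using bounds by simp
      qed
      finally show ?thesis .
    qed
    then show ?thesis
      unfolding kl
      by (rule DERIV_chain2[where f = "\<lambda>y. 4 * y / (1 + y)\<^sup>2" and g = "\<lambda>x. theta_modulus (x\<^sup>2)"])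
         (use d2 in \<open>simp add: kl\<close>)
  qed
  have "eventually (\<lambda>x. 4 * theta_modulus (x\<^sup>2) / (1 + theta_modulus (x\<^sup>2))\<^sup>2 = (theta_modulus x)\<^sup>2) (nhds q)"
    using eventually_nhds_in_open[of "{0<..<1}" q] q theta_modulus_square_arg(1)
    by (auto elim!: eventually_mono)
  from DERIV_unique[OF has_derivative_transform_nhds[OF d3 this] d1]
  have "4 * (1 - l) / (1 + l) ^ 3 * (2 * l * theta_weight (q\<^sup>2) / q) = 2 * k\<^sup>2 * theta_weight q / q"
    by (simp add: power2_eq_square)
  moreover have k2: "k\<^sup>2 = 4 * l / (1 + l)\<^sup>2"
    unfolding kl by (rule theta_modulus_square_arg(1)[OF q])
  ultimately have "4 * (1 - l) / (1 + l) ^ 3 * (2 * l * theta_weight (q\<^sup>2) / q) = 2 * (4 * l / (1 + l)\<^sup>2) * theta_weight q / q"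
    by simp
  moreover have "4 * (1 - l) / (1 + l) ^ 3 * (2 * l * theta_weight (q\<^sup>2) / q)
     = (2 * (4 * l / (1 + l)\<^sup>2) / q) * (theta_weight (q\<^sup>2) * ((1 - l) / (1 + l)))"
  proof -
    have "4 * n / m ^ 3 * (2 * l * t / q) = (2 * (4 * l / m\<^sup>2) / q) * (t * (n / m))" for m n t :: real
      by (simp add: power3_eq_cube power2_eq_square mult_ac)
    then show ?thesis .
  qed
  ultimately have "(2 * (4 * l / (1 + l)\<^sup>2) / q) * (theta_weight (q\<^sup>2) * ((1 - l) / (1 + l))) = (2 * (4 * l / (1 + l)\<^sup>2) / q) * theta_weight q"
    by simp
  then have "theta_weight (q\<^sup>2) * ((1 - l) / (1 + l)) = theta_weight q"
    using bounds q by (subst (asm) mult_cancel_left) auto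
  moreover have "(1 - l) / (1 + l) = thB q / thA q"
    using theta_modulus_square_arg(2)[OF q, folded kl] by (metis inverse_divide)
  ultimately have w: "theta_weight (q\<^sup>2) * (thB q / thA q) = theta_weight q"
    by simp
  show ?thesis
    unfolding w[symmetric] thA_thB[OF q, symmetric] using thA_pos[OF q] thB_pos[OF q]
    by (simp add: field_simps power2_eq_square)
qed

lemma filterlim_power_two_power:
  assumes q: "0 < q" "q < (1::real)"
  shows "filterlim (\<lambda>n. q ^ (2 ^ n)) (at_right 0) sequentially"
proof -
  have "filterlim (\<lambda>n. 2 ^ n :: nat) at_top sequentially"
    by (rule filterlim_at_top_mono[OF filterlim_ident]) (auto intro: always_eventually less_imp_le[OF less_exp])
  moreover have "(\<lambda>n. q ^ n) \<longlonglongrightarrow> 0"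
    using q by (intro LIMSEQ_power_zero) auto
  ultimately have "(\<lambda>n. q ^ (2 ^ n)) \<longlonglongrightarrow> 0"
    using filterlim_compose by blast
  then show ?thesis
    using q by (auto simp: filterlim_at)
qed

text \<open>The invariant quotient is followed along q^(2^n) -> 0. There \<open>thB\<close> tends to
  1 and the Euler terms vanish, leaving the 1/2 that stems from the factor sqrt q.\<close>

theorem theta_modulus_deriv:
  assumes q: "0 < q" "q < 1"
  shows "(theta_modulus has_real_derivative (theta_modulus q * (thB q)\<^sup>2 / (2 * q))) (at q)"
proof -
  have E1: "((\<lambda>x. qser_deriv 1 3 x / euler x) \<longlongrightarrow> 0 / 1) (at_right 0)"
    by (intro tendsto_divide qser_deriv_at_right_0 euler_at_right_0) auto
  then have E: "(euler_dlog \<longlongrightarrow> 0) (at_right 0)"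
    by (simp add: euler_dlog_def[abs_def])
  have "((\<lambda>q. theta_weight q / (thB q)\<^sup>2) \<longlongrightarrow> (1 / 2 + 32 * 0 + 4 * 0 - 24 * 0) / 1\<^sup>2) (at_right 0)"
    unfolding theta_weight_def
    by (intro tendsto_intros E tendsto_power_at_right_0[OF E] thB_at_right_0) auto
  then have "(\<lambda>n. theta_weight (q ^ (2 ^ n)) / (thB (q ^ (2 ^ n)))\<^sup>2) \<longlonglongrightarrow> 1 / 2"
    using filterlim_compose[OF _ filterlim_power_two_power[OF q]] by fastforce
  moreover have "theta_weight (q ^ (2 ^ n)) / (thB (q ^ (2 ^ n)))\<^sup>2 = theta_weight q / (thB q)\<^sup>2" for n
  proof (induction n)
    case (Suc n)
    have "q ^ (2 ^ Suc n) = (q ^ (2 ^ n))\<^sup>2"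
      by (simp flip: power_mult add: mult.commute)
    moreover have "0 < q ^ (2 ^ n) \<and> q ^ (2 ^ n) < 1"
      by (rule power_in_unit[OF q]) simp
    ultimately show ?case
      using theta_weight_square_arg[of "q ^ (2 ^ n)"] Suc by metis
  qed simp
  ultimately have "(\<lambda>n::nat. theta_weight q / (thB q)\<^sup>2) \<longlonglongrightarrow> 1 / 2"
    by simp
  then have "theta_weight q / (thB q)\<^sup>2 = 1 / 2"
    by (simp only: LIMSEQ_const_iff)
  then have e: "theta_weight q = (thB q)\<^sup>2 / 2"
    using thB_pos[OF q] by (simp add: field_simps)
  show ?thesis
    using theta_modulus_deriv_aux[OF q] unfolding e by simp
qed

lemma theta_modulus_at_right_0: "(theta_modulus \<longlongrightarrow> 0) (at_right 0)"
proof -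
  have "((\<lambda>q. (thC q / sqrt q) * sqrt q / thA q) \<longlongrightarrow> 4 * sqrt 0 / 1) (at_right 0)"
    by (intro tendsto_intros thC_at_right_0 thA_at_right_0) auto
  moreover have "eventually (\<lambda>q. (thC q / sqrt q) * sqrt q / thA q = theta_modulus q) (at_right 0)"
    using eventually_at_right_less[of "0::real"] by (rule eventually_mono) (simp add: theta_modulus_def)
  ultimately show ?thesis
    using tendsto_cong by force
qed

text \<open>The monomial that arises as the cube of the hypergeometric derivative; exactly in this
  combination the Euler products at q^2 and q^4 cancel.\<close>

lemma eta_product_theta:
  assumes q: "0 < q" "q < 1"
  shows "thC q * thA q * thB q ^ 4 = 4 * sqrt q * euler q ^ 12"
proof -
  have q2: "0 < q\<^sup>2" "q\<^sup>2 < 1" and q4: "0 < q ^ 4" "q ^ 4 < 1"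
    using power_in_unit[OF q, of 2] power_in_unit[OF q, of 4] by auto
  define a b c where abc: "a = euler q" "b = euler (q\<^sup>2)" "c = euler (q ^ 4)"
  have pos: "a > 0" "b > 0" "c > 0"
    using euler_pos[of q] euler_pos[of "q\<^sup>2"] euler_pos[of "q ^ 4"] q q2 q4 by (auto simp: abc)
  show ?thesis
    unfolding thA_def thB_def thC_def theta3_euler[OF q] theta4_euler[OF q] psi2_euler[OF q] abc[symmetric] using pos
    by (simp add: power_mult_distrib power_divide flip: power_mult) (simp add: field_simps flip: power_add)
qed

section \<open>Landen transformation and the singular modulus\<close>

text \<open>Gauss's algebraic form of the complete elliptic integral. One function of (a, b) covers
  both K(k) and K(k'), and its invariance under the arithmetic-geometric mean step is a rational
  substitution.\<close>

definition agm_integrand :: "real \<Rightarrow> real \<Rightarrow> real \<Rightarrow> real" where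
  "agm_integrand a b t = 1 / (sqrt (a\<^sup>2 + t\<^sup>2) * sqrt (b\<^sup>2 + t\<^sup>2))"

definition agm_integral :: "real \<Rightarrow> real \<Rightarrow> real" where
  "agm_integral a b = (LBINT t=0..\<infinity>. agm_integrand a b t)"

lemma agm_integrand_nonneg: "agm_integrand a b t \<ge> 0"
  by (simp add: agm_integrand_def)

lemma isCont_agm_integrand: "a > 0 \<Longrightarrow> b > 0 \<Longrightarrow> isCont (agm_integrand a b) t"
proof -
  assume "a > 0" "b > 0"
  then have "a\<^sup>2 + t\<^sup>2 > 0" "b\<^sup>2 + t\<^sup>2 > 0" by (simp_all add: add_pos_nonneg)
  then show ?thesis
    unfolding agm_integrand_def[abs_def] by (auto intro!: continuous_intros)
qed

text \<open>Substitute t = b tan \<theta>. Integrability on the half-line is inherited from the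
  trigonometric integrand, which is continuous on a compact interval.\<close>

lemma agm_tan_substitution:
  assumes a: "a > 0" and b: "b > 0"
  shows "set_integrable lborel (einterval 0 \<infinity>) (agm_integrand a b)"
    and "agm_integral a b = (LBINT \<theta>=0..ereal (pi / 2). 1 / sqrt (a\<^sup>2 * (cos \<theta>)\<^sup>2 + b\<^sup>2 * (sin \<theta>)\<^sup>2))"
proof -
  let ?h = "\<lambda>\<theta>. 1 / sqrt (a\<^sup>2 * (cos \<theta>)\<^sup>2 + b\<^sup>2 * (sin \<theta>)\<^sup>2)"
  have cos: "cos \<theta> > 0" "cos \<theta> \<noteq> 0" if "0 < \<theta>" "\<theta> < pi / 2" for \<theta>
    using cos_gt_zero[of \<theta>] that by auto
  have eq: "agm_integrand a b (b * tan \<theta>) * (b * (1 + (tan \<theta>)\<^sup>2)) = ?h \<theta>" if \<theta>: "0 < \<theta>" "\<theta> < pi / 2" for \<theta>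
  proof -
    have c: "cos \<theta> > 0" using cos[OF \<theta>] by simp
    have t1: "1 + (tan \<theta>)\<^sup>2 = 1 / (cos \<theta>)\<^sup>2"
      using tan_sec[of \<theta>] c by (simp add: inverse_eq_divide power_divide)
    have "b\<^sup>2 + (b * tan \<theta>)\<^sup>2 = b\<^sup>2 * (1 + (tan \<theta>)\<^sup>2)"
      by (simp add: algebra_simps)
    then have s1: "sqrt (b\<^sup>2 + (b * tan \<theta>)\<^sup>2) = b / cos \<theta>"
      using b c by (simp add: t1 real_sqrt_divide)
    have "a\<^sup>2 + (b * tan \<theta>)\<^sup>2 = (a\<^sup>2 * (cos \<theta>)\<^sup>2 + b\<^sup>2 * (sin \<theta>)\<^sup>2) / (cos \<theta>)\<^sup>2"
      using c by (simp add: tan_def field_simps)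
    then have s2: "sqrt (a\<^sup>2 + (b * tan \<theta>)\<^sup>2) = sqrt (a\<^sup>2 * (cos \<theta>)\<^sup>2 + b\<^sup>2 * (sin \<theta>)\<^sup>2) / cos \<theta>"
      using c by (simp add: real_sqrt_divide)
    show ?thesis
      unfolding agm_integrand_def s1 s2 t1 using b c by (simp add: power2_eq_square)
  qed
  have pos: "a\<^sup>2 * (cos \<theta>)\<^sup>2 + b\<^sup>2 * (sin \<theta>)\<^sup>2 > 0" for \<theta>
  proof (cases "cos \<theta> = 0")
    case True
    then have "(sin \<theta>)\<^sup>2 = 1" using sin_cos_squared_add[of \<theta>] by simp
    then show ?thesis using b True by simp
  qed (use a in \<open>auto intro!: add_pos_nonneg\<close>)
  have "continuous_on {0..pi / 2} ?h"
    using pos by (auto intro!: continuous_intros simp: less_imp_neq[THEN not_sym])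
  then have "interval_lebesgue_integrable lborel (ereal 0) (ereal (pi / 2)) ?h"
    by (intro interval_integrable_continuous_on) auto
  then have int_h: "set_integrable lborel (einterval 0 (ereal (pi / 2))) ?h"
    by (simp add: interval_lebesgue_integrable_def zero_ereal_def)
  have mem: "x \<in> einterval 0 (ereal (pi / 2)) \<longleftrightarrow> 0 < x \<and> x < pi / 2" for x
    by (simp add: einterval_def zero_ereal_def)
  have int_f: "set_integrable lborel (einterval 0 (ereal (pi / 2))) (\<lambda>\<theta>. agm_integrand a b (b * tan \<theta>) * (b * (1 + (tan \<theta>)\<^sup>2)))"
    using int_h by (rule set_integrable_cong[THEN iffD2, rotated -1]) (auto simp: mem eq)
  have deriv: "((\<lambda>\<theta>. b * tan \<theta>) has_real_derivative b * (1 + (tan \<theta>)\<^sup>2)) (at \<theta>)" if "0 < \<theta>" "\<theta> < pi / 2" for \<theta>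
    using cos[OF that] tan_sec[of \<theta>] by (auto intro!: derivative_eq_intros simp: power_inverse inverse_eq_divide power_divide)
  have lim0: "((ereal \<circ> (\<lambda>\<theta>. b * tan \<theta>) \<circ> real_of_ereal) \<longlongrightarrow> 0) (at_right 0)"
    unfolding zero_ereal_def ereal_tendsto_simps by (auto intro!: tendsto_eq_intros)
  have "filterlim (\<lambda>\<theta>. b * tan \<theta>) at_top (at_left (pi / 2))"
    by (rule filterlim_tendsto_pos_mult_at_top[OF tendsto_const b filterlim_tan_at_left])
  then have lim1: "((ereal \<circ> (\<lambda>\<theta>. b * tan \<theta>) \<circ> real_of_ereal) \<longlongrightarrow> \<infinity>) (at_left (ereal (pi / 2)))"
    unfolding ereal_tendsto_simps .
  note subst = interval_integral_substitution_nonneg[of 0 "ereal (pi / 2)" "\<lambda>\<theta>. b * tan \<theta>" "\<lambda>\<theta>. b * (1 + (tan \<theta>)\<^sup>2)"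
      "agm_integrand a b", OF _ _ _ _ _ _ lim0 lim1 int_f]
  have 1: "isCont (\<lambda>\<theta>. b * (1 + (tan \<theta>)\<^sup>2)) x" if "0 < x" "x < pi / 2" for x
    using cos[OF that] by (auto intro!: continuous_intros)
  show "set_integrable lborel (einterval 0 \<infinity>) (agm_integrand a b)"
    by (rule subst(1)) (use deriv isCont_agm_integrand[OF a b] 1 b agm_integrand_nonneg in \<open>auto simp: zero_ereal_def\<close>)
  have "agm_integral a b = (LBINT x=0..ereal (pi / 2). agm_integrand a b (b * tan x) * (b * (1 + (tan x)\<^sup>2)))"
    unfolding agm_integral_def
    by (rule subst(2)) (use deriv isCont_agm_integrand[OF a b] 1 b agm_integrand_nonneg in \<open>auto simp: zero_ereal_def\<close>)
  also have "\<dots> = (LBINT \<theta>=0..ereal (pi / 2). ?h \<theta>)"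
    by (rule interval_integral_cong) (auto simp: mem eq min_def max_def)
  finally show "agm_integral a b = (LBINT \<theta>=0..ereal (pi / 2). ?h \<theta>)" .
qed

lemma agm_integral_elliptic_K:
  assumes "0 < b" "b \<le> a"
  shows "agm_integral a b = elliptic_K (sqrt (1 - (b / a)\<^sup>2)) / a"
proof -
  have ba: "(b / a)\<^sup>2 \<le> 1"
    using assms by (simp add: power_le_one)
  have "agm_integral a b = (LBINT \<theta>=0..ereal (pi / 2). (1 / a) * (1 / sqrt (1 - (sqrt (1 - (b / a)\<^sup>2))\<^sup>2 * (sin \<theta>)\<^sup>2)))"
    unfolding agm_tan_substitution(2)[OF less_le_trans[OF assms] assms(1)]
  proof (rule interval_integral_cong)
    fix x :: real
    have "a\<^sup>2 * (cos x)\<^sup>2 + b\<^sup>2 * (sin x)\<^sup>2 = a\<^sup>2 * (1 - (1 - (b / a)\<^sup>2) * (sin x)\<^sup>2)"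
      unfolding cos_squared_eq using assms by (simp add: field_simps)
    then have "sqrt (a\<^sup>2 * (cos x)\<^sup>2 + b\<^sup>2 * (sin x)\<^sup>2) = a * sqrt (1 - (1 - (b / a)\<^sup>2) * (sin x)\<^sup>2)"
      using assms by (simp add: real_sqrt_mult)
    then show "1 / sqrt (a\<^sup>2 * (cos x)\<^sup>2 + b\<^sup>2 * (sin x)\<^sup>2) = (1 / a) * (1 / sqrt (1 - (sqrt (1 - (b / a)\<^sup>2))\<^sup>2 * (sin x)\<^sup>2))"
      using ba by simp
  qed
  also have "\<dots> = (1 / a) * elliptic_K (sqrt (1 - (b / a)\<^sup>2))"
    unfolding elliptic_K_def by (rule interval_lebesgue_integral_mult_right)
  finally show ?thesis by simp
qed

lemma agm_integral_scale:
  assumes "0 < b" "b \<le> a" "0 < c"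
  shows "agm_integral (c * a) (c * b) = agm_integral a b / c"
  using assms agm_integral_elliptic_K[of b a] agm_integral_elliptic_K[of "c * b" "c * a"] by simp

text \<open>Substitute \<open>u = (t - a b / t) / 2\<close>, which maps the half-line onto the whole line.\<close>

theorem agm_integral_landen:
  assumes a: "a > 0" and b: "b > 0"
  shows "agm_integral ((a + b) / 2) (sqrt (a * b)) = agm_integral a b"
proof -
  let ?A = "(a + b) / 2" and ?G = "sqrt (a * b)"
  let ?g = "agm_integrand ?A ?G"
  let ?u = "\<lambda>t. (t - a * b / t) / 2" and ?u' = "\<lambda>t. (1 + a * b / t\<^sup>2) / 2"
  have AG: "?A > 0" "?G > 0" using a b by simp_all
  \<comment> \<open>The factor 2 is absorbed at the end: the image is the whole line and
    \<open>?g\<close> is even, so its integral is twice that over the half-line.\<close>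
  have eq: "?g (?u t) * ?u' t = 2 * agm_integrand a b t" if t: "t > 0" for t
  proof -
    have "?A\<^sup>2 + (?u t)\<^sup>2 = (a\<^sup>2 + t\<^sup>2) * (b\<^sup>2 + t\<^sup>2) / (2 * t)\<^sup>2"
      using t by (simp add: field_simps power2_eq_square)
    then have s1: "sqrt (?A\<^sup>2 + (?u t)\<^sup>2) = sqrt (a\<^sup>2 + t\<^sup>2) * sqrt (b\<^sup>2 + t\<^sup>2) / (2 * t)"
      using t by (simp add: real_sqrt_divide real_sqrt_mult)
    have "?G\<^sup>2 + (?u t)\<^sup>2 = ((t + a * b / t) / 2)\<^sup>2"
      using t a b by (simp add: field_simps power2_eq_square)
    then have s2: "sqrt (?G\<^sup>2 + (?u t)\<^sup>2) = (t + a * b / t) / 2"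
      using t a b by simp
    have "?u' t = (t + a * b / t) / (2 * t)"
      using t by (simp add: field_simps power2_eq_square)
    moreover have "t + a * b / t > 0" using t a b by (simp add: add_pos_pos)
    moreover have "1 / (S / (2 * t) * (w / 2)) * (w / (2 * t)) = 2 * (1 / S)" if "w > 0" for S w
      using that t by (simp add: field_simps)
    ultimately show ?thesis
      unfolding agm_integrand_def s1 s2 by (simp only:)
  qed
  have mem: "x \<in> einterval 0 \<infinity> \<longleftrightarrow> 0 < x" for x
    by (simp add: einterval_def zero_ereal_def)
  have "set_integrable lborel (einterval 0 \<infinity>) (\<lambda>t. 2 * agm_integrand a b t)"
    using agm_tan_substitution(1)[OF a b] by simp
  then have int_f: "set_integrable lborel (einterval 0 \<infinity>) (\<lambda>t. ?g (?u t) * ?u' t)"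
    by (rule set_integrable_cong[THEN iffD2, rotated -1]) (simp_all only: mem eq)
  have "filterlim (\<lambda>t::real. a * b / 2 * inverse t) at_top (at_right 0)"
    using a b by (intro filterlim_tendsto_pos_mult_at_top[OF tendsto_const _ filterlim_inverse_at_top_right]) auto
  moreover have "((\<lambda>t::real. - t / 2) \<longlongrightarrow> 0) (at_right 0)"
    by (auto intro!: tendsto_eq_intros)
  ultimately have "filterlim (\<lambda>t::real. - t / 2 + a * b / 2 * inverse t) at_top (at_right 0)"
    by (intro filterlim_tendsto_add_at_top)
  moreover have "- t / 2 + a * b / 2 * inverse t = - ?u t" for t
    by (simp add: field_simps)
  ultimately have "filterlim ?u at_bot (at_right 0)"
    by (simp only: filterlim_uminus_at_bot)
  then have lim0: "((ereal \<circ> ?u \<circ> real_of_ereal) \<longlongrightarrow> - \<infinity>) (at_right 0)"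
    unfolding zero_ereal_def ereal_tendsto_simps .
  have "((\<lambda>t::real. - (a * b / t) / 2) \<longlongrightarrow> 0) at_top"
    using tendsto_divide_0[OF tendsto_const[of "- (a * b) / 2"] filterlim_at_top_imp_at_infinity[OF filterlim_ident]]
    by (simp add: mult.commute)
  moreover have "filterlim (\<lambda>t::real. t / 2) at_top at_top"
    using filterlim_tendsto_pos_mult_at_top[OF tendsto_const[of "1 / 2 :: real"] _ filterlim_ident] by simp
  ultimately have "filterlim (\<lambda>t::real. - (a * b / t) / 2 + t / 2) at_top at_top"
    by (rule filterlim_tendsto_add_at_top)
  then have lim1: "((ereal \<circ> ?u \<circ> real_of_ereal) \<longlongrightarrow> \<infinity>) (at_left \<infinity>)"
    unfolding ereal_tendsto_simps by (simp add: diff_divide_distrib)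
  note subst = interval_integral_substitution_nonneg[of 0 \<infinity> ?u ?u' ?g, OF _ _ _ _ _ _ lim0 lim1 int_f]
  have deriv: "(?u has_real_derivative ?u' t) (at t)" if "t > 0" for t
    using that by (auto intro!: derivative_eq_intros simp: power2_eq_square field_simps)
  have cont: "isCont ?u' t" if "t > 0" for t
    using that by (auto intro!: continuous_intros)
  have nonneg: "0 \<le> ?u' t" for t
    using a b by (simp add: add_nonneg_nonneg)
  have int_g: "set_integrable lborel (einterval (- \<infinity>) \<infinity>) ?g"
    by (rule subst(1)) (use deriv cont nonneg isCont_agm_integrand[OF AG] agm_integrand_nonneg in \<open>auto simp: zero_ereal_def\<close>)
  have "(LBINT x=-\<infinity>..\<infinity>. ?g x) = (LBINT t=0..\<infinity>. ?g (?u t) * ?u' t)"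
    by (rule subst(2)) (use deriv cont nonneg isCont_agm_integrand[OF AG] agm_integrand_nonneg in \<open>auto simp: zero_ereal_def\<close>)
  also have "\<dots> = (LBINT t=0..\<infinity>. 2 * agm_integrand a b t)"
  proof (rule interval_integral_cong)
    fix t :: real assume "t \<in> einterval (min 0 \<infinity>) (max 0 \<infinity>)"
    then have "t > 0" by (simp add: mem)
    then show "?g (?u t) * ?u' t = 2 * agm_integrand a b t" by (rule eq)
  qed
  also have "\<dots> = 2 * agm_integral a b"
    by (simp add: agm_integral_def)
  finally have "(LBINT x=-\<infinity>..\<infinity>. ?g x) = 2 * agm_integral a b" .
  moreover have "(LBINT x=-\<infinity>..0. ?g x) + (LBINT x=0..\<infinity>. ?g x) = (LBINT x=-\<infinity>..\<infinity>. ?g x)"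
    using int_g by (intro interval_integral_sum) (simp add: interval_lebesgue_integrable_def)
  moreover have "(LBINT x=-\<infinity>..0. ?g x) = (LBINT x=0..\<infinity>. ?g x)"
  proof -
    have "(LBINT x=-\<infinity>..0. ?g x) = (LBINT x=0..\<infinity>. ?g (- x))"
      using interval_integral_reflect[of "-\<infinity>" 0 ?g] by simp
    then show ?thesis by (simp add: agm_integrand_def)
  qed
  ultimately show ?thesis by (simp add: agm_integral_def)
qed

section \<open>Bounds by comparison with explicit primitives\<close>

lemma mem_einterval_0_inf: "x \<in> einterval 0 \<infinity> \<longleftrightarrow> 0 < x"
  by (simp add: einterval_def zero_ereal_def)

lemma agm_integral_mono:
  fixes h :: "real \<Rightarrow> real"
  assumes ab: "a > 0" "b > 0"
    and F: "\<And>t. t > 0 \<Longrightarrow> (F has_real_derivative h t) (at t)"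
    and cont: "\<And>t. t > 0 \<Longrightarrow> isCont h t" and nonneg: "\<And>t. t > 0 \<Longrightarrow> h t \<ge> 0"
    and F0: "(F \<longlongrightarrow> L) (at_right 0)" and F1: "(F \<longlongrightarrow> M) at_top"
  shows "(\<And>t. t > 0 \<Longrightarrow> h t \<le> agm_integrand a b t) \<Longrightarrow> M - L \<le> agm_integral a b"
    and "(\<And>t. t > 0 \<Longrightarrow> agm_integrand a b t \<le> h t) \<Longrightarrow> agm_integral a b \<le> M - L"
proof -
  have lims: "((F \<circ> real_of_ereal) \<longlongrightarrow> L) (at_right 0)" "((F \<circ> real_of_ereal) \<longlongrightarrow> M) (at_left \<infinity>)"
    using F0 F1 unfolding zero_ereal_def ereal_tendsto_simps by auto
  have FTC: "set_integrable lborel (einterval 0 \<infinity>) h" "(LBINT t=0..\<infinity>. h t) = M - L"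
    by (rule interval_integral_FTC_nonneg[OF _ _ _ _ lims]; use F cont nonneg in \<open>auto simp: zero_ereal_def\<close>)+
  have le: "(0::ereal) \<le> \<infinity>" by simp
  note i = agm_tan_substitution(1)[OF ab]
  show "M - L \<le> agm_integral a b" if "\<And>t. t > 0 \<Longrightarrow> h t \<le> agm_integrand a b t"
    unfolding FTC(2)[symmetric] agm_integral_def interval_lebesgue_integral_le_eq[OF le]
    by (rule set_integral_mono[OF FTC(1) i]) (simp add: mem_einterval_0_inf that)
  show "agm_integral a b \<le> M - L" if "\<And>t. t > 0 \<Longrightarrow> agm_integrand a b t \<le> h t"
    unfolding FTC(2)[symmetric] agm_integral_def interval_lebesgue_integral_le_eq[OF le]
    by (rule set_integral_mono[OF i FTC(1)]) (simp add: mem_einterval_0_inf that)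
qed

lemma arctan_div_at_top: "a > 0 \<Longrightarrow> ((\<lambda>t::real. arctan (t / a)) \<longlongrightarrow> pi / 2) at_top"
  using filterlim_tendsto_pos_mult_at_top[OF tendsto_const[of "1 / a"] _ filterlim_ident]
  by (intro filterlim_compose[OF tendsto_arctan_at_top]) (simp add: field_simps)

lemma arctan_div_deriv:
  assumes "c > (0::real)"
  shows "((\<lambda>t. arctan (t / c)) has_real_derivative (c / (c\<^sup>2 + t\<^sup>2))) (at t)"
proof -
  have "((\<lambda>t. arctan (t / c)) has_real_derivative (inverse (1 + (t / c)\<^sup>2) * (1 / c))) (at t)"
    using assms by (auto intro!: derivative_eq_intros)
  also have "1 + (t / c)\<^sup>2 = (c\<^sup>2 + t\<^sup>2) / c\<^sup>2"
    using assms by (simp add: field_simps)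
  also have "inverse ((c\<^sup>2 + t\<^sup>2) / c\<^sup>2) * (1 / c) = c / (c\<^sup>2 + t\<^sup>2)"
    using assms by (simp add: power2_eq_square)
  finally show ?thesis .
qed

lemma agm_integral_bounds:
  assumes b: "0 < b" "b \<le> a"
  shows "pi / (2 * a) \<le> agm_integral a b" "agm_integral a b \<le> pi / (2 * b)"
proof -
  have a: "a > 0" using b by simp
  have pos: "c\<^sup>2 + t\<^sup>2 > 0" if "c > 0" for c t :: real using that by (simp add: add_pos_nonneg)
  have F: "((\<lambda>t. arctan (t / c) / c) has_real_derivative (1 / (c\<^sup>2 + t\<^sup>2))) (at t)" if "c > 0" for c t :: real
    using DERIV_cdivide[OF arctan_div_deriv[OF that, of t], of c] that by simp
  have cont: "isCont (\<lambda>t. 1 / (c\<^sup>2 + t\<^sup>2)) t" if "c > 0" for c t :: real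
    using pos[OF that, of t] by (auto intro!: continuous_intros)
  have F0: "((\<lambda>t. arctan (t / c) / c) \<longlongrightarrow> 0) (at_right 0)" if "c > 0" for c :: real
    using that by (auto intro!: tendsto_eq_intros)
  have F1: "((\<lambda>t. arctan (t / c) / c) \<longlongrightarrow> pi / 2 / c) at_top" if "c > 0" for c :: real
    using that by (intro tendsto_divide arctan_div_at_top) auto
  have sq: "1 / (c\<^sup>2 + t\<^sup>2) = 1 / (sqrt (c\<^sup>2 + t\<^sup>2) * sqrt (c\<^sup>2 + t\<^sup>2))" for c t :: real
    by simp
  have le: "sqrt (b\<^sup>2 + t\<^sup>2) \<le> sqrt (a\<^sup>2 + t\<^sup>2)" for t
    using b by (simp add: power_mono)
  have spos: "sqrt (c\<^sup>2 + t\<^sup>2) > 0" if "c > 0" for c t :: real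
    using pos[OF that] by simp
  have "pi / 2 / a - 0 \<le> agm_integral a b"
  proof (rule agm_integral_mono(1)[OF a b(1) F cont _ F0 F1])
    fix t :: real
    show "1 / (a\<^sup>2 + t\<^sup>2) \<le> agm_integrand a b t"
      unfolding agm_integrand_def sq using spos[OF a, of t] spos[OF b(1), of t] le[of t]
      by (intro divide_left_mono mult_left_mono mult_pos_pos) auto
  qed (use a in auto)
  then show "pi / (2 * a) \<le> agm_integral a b" by simp
  have "agm_integral a b \<le> pi / 2 / b - 0"
  proof (rule agm_integral_mono(2)[OF a b(1) F cont _ F0 F1])
    fix t :: real
    show "agm_integrand a b t \<le> 1 / (b\<^sup>2 + t\<^sup>2)"
      unfolding agm_integrand_def sq using spos[OF a, of t] spos[OF b(1), of t] le[of t]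
      by (intro divide_left_mono mult_right_mono mult_pos_pos) auto
  qed (use b in auto)
  then show "agm_integral a b \<le> pi / (2 * b)" by simp
qed

lemma ln_ratio_at_top:
  fixes g :: "real \<Rightarrow> real"
  assumes "0 < b" "0 < a" "filterlim g at_top at_top" "\<And>t. t > 0 \<Longrightarrow> g t > (0::real)"
  shows "((\<lambda>t. ln (b + g t) - ln (a + g t)) \<longlongrightarrow> 0) at_top"
proof -
  have "((\<lambda>t. 1 + (b - a) / (a + g t)) \<longlongrightarrow> 1 + 0) at_top"
    by (intro tendsto_add tendsto_const tendsto_divide_0[OF tendsto_const] filterlim_at_top_imp_at_infinity
        filterlim_tendsto_add_at_top[OF tendsto_const] assms)
  then have "((\<lambda>t. ln (1 + (b - a) / (a + g t))) \<longlongrightarrow> ln 1) at_top"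
    by (intro tendsto_ln) auto
  moreover have e: "ln (1 + (b - a) / (a + g t)) = ln (b + g t) - ln (a + g t)" if "t > 0" for t
  proof -
    have "g t > 0" using that by (rule assms)
    then have "1 + (b - a) / (a + g t) = (b + g t) / (a + g t)"
      using assms(2) by (simp add: field_simps)
    then show ?thesis
      using \<open>g t > 0\<close> assms by (simp add: ln_div)
  qed
  have "eventually (\<lambda>t. ln (1 + (b - a) / (a + g t)) = ln (b + g t) - ln (a + g t)) at_top"
    by (rule eventually_mono[OF eventually_gt_at_top[of "0::real"]]) (rule e)
  ultimately show ?thesis
    using tendsto_cong by force
qed

text \<open>Both bounds replace \<open>sqrt (c\<^sup>2 + t\<^sup>2)\<close> by a rational function, from \<open>sqrt (c\<^sup>2 + t\<^sup>2) \<le> c + t\<close> in the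
  denominator and in the numerator respectively; this keeps the leading logarithm exact.\<close>

lemma agm_integral_log_bounds:
  assumes b: "0 < b" "b < a"
  shows "ln (a / b) / (a - b) \<le> agm_integral a b"
    and "agm_integral a b \<le> ln (a / b) / (a - b) + pi / (a + b)"
proof -
  have a: "a > 0" using b by simp
  have pos: "c\<^sup>2 + t\<^sup>2 > 0" if "c > 0" for c t :: real using that by (simp add: add_pos_nonneg)
  have le: "sqrt (c\<^sup>2 + t\<^sup>2) \<le> c + t" if "c > 0" "t > 0" for c t :: real
    using that by (intro real_le_lsqrt) (auto simp: power2_sum)
  have ln: "ln (a / b) = ln a - ln b" using a b by (simp add: ln_div)
  have "0 - (ln (b + 0) - ln (a + 0)) / (a - b) \<le> agm_integral a b"
  proof (rule agm_integral_mono(1)[OF a b(1), where F = "\<lambda>t. (ln (b + t) - ln (a + t)) / (a - b)" and h = "\<lambda>t. 1 / ((a + t) * (b + t))"])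
    fix t :: real assume t: "t > 0"
    have "((\<lambda>t. (ln (b + t) - ln (a + t)) / (a - b)) has_real_derivative ((1 / (b + t) - 1 / (a + t)) / (a - b))) (at t)"
      using t a b by (auto intro!: derivative_eq_intros)
    moreover have "(1 / (b + t) - 1 / (a + t)) = (a - b) / ((a + t) * (b + t))"
      using t a b by (simp add: field_simps)
    ultimately show "((\<lambda>t. (ln (b + t) - ln (a + t)) / (a - b)) has_real_derivative 1 / ((a + t) * (b + t))) (at t)"
      using b by simp
    show "isCont (\<lambda>t. 1 / ((a + t) * (b + t))) t"
      using t a b by (auto intro!: continuous_intros)
    show "0 \<le> 1 / ((a + t) * (b + t))" using t a b by simp
    show "1 / ((a + t) * (b + t)) \<le> agm_integrand a b t"
      unfolding agm_integrand_def using t a b le[of a t] le[of b t] pos[OF a, of t] pos[OF b(1), of t]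
      by (intro divide_left_mono mult_mono mult_pos_pos) auto
  next
    show "((\<lambda>t. (ln (b + t) - ln (a + t)) / (a - b)) \<longlongrightarrow> (ln (b + 0) - ln (a + 0)) / (a - b)) (at_right 0)"
      using a b by (intro tendsto_intros) auto
    have "((\<lambda>t. (ln (b + t) - ln (a + t)) / (a - b)) \<longlongrightarrow> 0 / (a - b)) at_top"
      using a b by (intro tendsto_divide ln_ratio_at_top filterlim_ident tendsto_const) auto
    then show "((\<lambda>t. (ln (b + t) - ln (a + t)) / (a - b)) \<longlongrightarrow> 0) at_top" by simp
  qed
  then show "ln (a / b) / (a - b) \<le> agm_integral a b"
    unfolding ln by (simp add: diff_divide_distrib)
  \<comment> \<open>The majorant is split by (a + t)(b + t) = t(a + b) + (a b + t^2). The first part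
    integrates to the logarithms, the second to the arctangents, which cause the error pi/(a +
    b).\<close>
  let ?F = "\<lambda>t. (ln (b\<^sup>2 + t\<^sup>2) - ln (a\<^sup>2 + t\<^sup>2)) / (2 * (a - b)) + (arctan (t / a) + arctan (t / b)) / (a + b)"
  let ?h = "\<lambda>t. (a + t) * (b + t) / ((a\<^sup>2 + t\<^sup>2) * (b\<^sup>2 + t\<^sup>2))"
  have "agm_integral a b \<le> (0 / (2 * (a - b)) + (pi / 2 + pi / 2) / (a + b)) - ((ln (b\<^sup>2 + 0\<^sup>2) - ln (a\<^sup>2 + 0\<^sup>2)) / (2 * (a - b)) + (arctan (0 / a) + arctan (0 / b)) / (a + b))"
  proof (rule agm_integral_mono(2)[OF a b(1), where F = ?F and h = ?h])
    fix t :: real assume t: "t > 0"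
    note p = pos[OF a, of t] pos[OF b(1), of t]
    have at: "((\<lambda>t. arctan (t / c)) has_real_derivative (c / (c\<^sup>2 + t\<^sup>2))) (at t)" if "c > 0" for c
      by (rule arctan_div_deriv[OF that])
    have lt: "((\<lambda>t. ln (c\<^sup>2 + t\<^sup>2)) has_real_derivative (2 * t / (c\<^sup>2 + t\<^sup>2))) (at t)" if "c > 0" for c
      using that pos[OF that, of t] by (auto intro!: derivative_eq_intros)
    have "(?F has_real_derivative ((2 * t / (b\<^sup>2 + t\<^sup>2) - 2 * t / (a\<^sup>2 + t\<^sup>2)) / (2 * (a - b)) + (a / (a\<^sup>2 + t\<^sup>2) + b / (b\<^sup>2 + t\<^sup>2)) / (a + b))) (at t)"
      by (intro DERIV_add DERIV_diff DERIV_cdivide at lt a b)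
    also have "(2 * t / (b\<^sup>2 + t\<^sup>2) - 2 * t / (a\<^sup>2 + t\<^sup>2)) / (2 * (a - b)) + (a / (a\<^sup>2 + t\<^sup>2) + b / (b\<^sup>2 + t\<^sup>2)) / (a + b) = ?h t"
    proof -
      define x y where xy: "x = a\<^sup>2 + t\<^sup>2" "y = b\<^sup>2 + t\<^sup>2"
      have xy0: "x > 0" "y > 0" using p by (simp_all add: xy)
      have "2 * t / y - 2 * t / x = 2 * t * (x - y) / (x * y)"
        using xy0 by (simp add: field_simps)
      moreover have "x - y = (a - b) * (a + b)" by (simp add: xy algebra_simps power2_eq_square)
      moreover have "2 * t * (d * s) / P / (2 * d) = t * s / P" if "d \<noteq> 0" for d s P :: real
        using that by simp
      ultimately have 1: "(2 * t / y - 2 * t / x) / (2 * (a - b)) = t * (a + b) / (x * y)"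
        using b by (metis less_irrefl right_minus_eq)
      have "a / x + b / y = (a * y + b * x) / (x * y)"
        using xy0 by (simp add: field_simps)
      moreover have "a * y + b * x = (a + b) * (a * b + t\<^sup>2)" by (simp add: xy algebra_simps power2_eq_square)
      ultimately have 2: "(a / x + b / y) / (a + b) = (a * b + t\<^sup>2) / (x * y)"
        using a b by simp
      have "(2 * t / y - 2 * t / x) / (2 * (a - b)) + (a / x + b / y) / (a + b) = (a + t) * (b + t) / (x * y)"
        unfolding 1 2 add_divide_distrib[symmetric] by (simp add: algebra_simps power2_eq_square)
      then show ?thesis by (simp only: xy)
    qed
    finally show "(?F has_real_derivative ?h t) (at t)" .
    show "isCont ?h t"
      using p by (auto intro!: continuous_intros)
    show "0 \<le> ?h t" using t a b p by simp
    have 1: "1 / sqrt (c\<^sup>2 + t\<^sup>2) \<le> (c + t) / (c\<^sup>2 + t\<^sup>2)" if "c > 0" for c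
    proof -
      define s where "s = sqrt (c\<^sup>2 + t\<^sup>2)"
      have "s > 0" "c\<^sup>2 + t\<^sup>2 = s * s" "s \<le> c + t" using pos[OF that, of t] le[OF that t] by (simp_all add: s_def)
      then have "1 / s \<le> (c + t) / (s * s)" by (simp add: field_simps)
      then have "1 / s \<le> (c + t) / (c\<^sup>2 + t\<^sup>2)" using \<open>c\<^sup>2 + t\<^sup>2 = s * s\<close> by (simp only:)
      then show ?thesis by (simp only: s_def)
    qed
    have "agm_integrand a b t = (1 / sqrt (a\<^sup>2 + t\<^sup>2)) * (1 / sqrt (b\<^sup>2 + t\<^sup>2))"
      by (simp add: agm_integrand_def)
    also have "\<dots> \<le> ((a + t) / (a\<^sup>2 + t\<^sup>2)) * ((b + t) / (b\<^sup>2 + t\<^sup>2))"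
      using t a b p by (intro mult_mono 1) auto
    finally show "agm_integrand a b t \<le> ?h t" by simp
  next
    show "(?F \<longlongrightarrow> (ln (b\<^sup>2 + 0\<^sup>2) - ln (a\<^sup>2 + 0\<^sup>2)) / (2 * (a - b)) + (arctan (0 / a) + arctan (0 / b)) / (a + b)) (at_right 0)"
      using a b by (intro tendsto_intros) auto
    have "filterlim (\<lambda>t::real. t\<^sup>2) at_top at_top"
      by (rule filterlim_pow_at_top) (auto intro: filterlim_ident)
    then show "(?F \<longlongrightarrow> 0 / (2 * (a - b)) + (pi / 2 + pi / 2) / (a + b)) at_top"
      using a b by (intro tendsto_add tendsto_divide ln_ratio_at_top arctan_div_at_top tendsto_const) auto
  qed
  moreover have "ln (a\<^sup>2) = 2 * ln a" "ln (b\<^sup>2) = 2 * ln b"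
    using a b by (simp_all add: ln_realpow)
  then have "(ln (b\<^sup>2) - ln (a\<^sup>2)) / (2 * (a - b)) = - (ln (a / b) / (a - b))"
    unfolding ln using b by (simp add: field_simps)
  ultimately show "agm_integral a b \<le> ln (a / b) / (a - b) + pi / (a + b)"
    by simp
qed

text \<open>Comparing integrands alone gives only a weak inequality. An explicit gap c sin^2, whose
  integral is c pi/4, makes it strict.\<close>

lemma elliptic_K_strict_mono:
  assumes k: "0 < k" "k < l" "l < 1"
  shows "elliptic_K k < elliptic_K l"
proof -
  let ?f = "\<lambda>k x. 1 / sqrt (1 - k\<^sup>2 * (sin x)\<^sup>2)"
  have pos: "1 - m\<^sup>2 * (sin x)\<^sup>2 > 0" if "0 < m" "m < 1" for m x :: real
  proof -
    have "(sin x)\<^sup>2 \<le> 1" by (simp add: abs_square_le_1)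
    then have "m\<^sup>2 * (sin x)\<^sup>2 \<le> m\<^sup>2 * 1" by (intro mult_left_mono) auto
    also have "\<dots> < 1" using that by (simp add: power_less_one_iff)
    finally show ?thesis by simp
  qed
  have int: "set_integrable lborel (einterval (ereal 0) (ereal (pi / 2))) (?f m)" if "0 < m" "m < 1" for m
  proof -
    have "continuous_on {0..pi / 2} (?f m)"
      using pos[OF that] by (auto intro!: continuous_intros simp: less_imp_neq[THEN not_sym])
    then have "interval_lebesgue_integrable lborel (ereal 0) (ereal (pi / 2)) (?f m)"
      by (intro interval_integrable_continuous_on) auto
    then show ?thesis by (simp add: interval_lebesgue_integrable_def)
  qed
  \<comment> \<open>Half the difference of squares: the radicals u and v below satisfy (u - v)(u +
    v) = 2 c sin^2 and u + v \<le> 2, so u - v is at least c sin^2.\<close>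
  define c where "c = (l\<^sup>2 - k\<^sup>2) / 2"
  have c: "c > 0" using k by (simp add: c_def power_strict_mono)
  have int_s: "set_integrable lborel (einterval (ereal 0) (ereal (pi / 2))) (\<lambda>x. c * (sin x)\<^sup>2)"
  proof -
    have "interval_lebesgue_integrable lborel (ereal 0) (ereal (pi / 2)) (\<lambda>x. c * (sin x)\<^sup>2)"
      by (intro interval_integrable_continuous_on) (auto intro!: continuous_intros)
    then show ?thesis by (simp add: interval_lebesgue_integrable_def)
  qed
  have le: "(ereal 0) \<le> ereal (pi / 2)" by simp
  have S: "(LBINT x:einterval (ereal 0) (ereal (pi / 2)). c * (sin x)\<^sup>2) = c * (pi / 4)"
  proof -
    have "(LBINT x=ereal 0..ereal (pi / 2). c * (sin x)\<^sup>2) = c * ((pi / 2 - sin (pi / 2) * cos (pi / 2)) / 2) - c * ((0 - sin 0 * cos 0) / 2)"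
    proof (rule interval_integral_FTC_finite)
      show "continuous_on {min 0 (pi / 2)..max 0 (pi / 2)} (\<lambda>x. c * (sin x)\<^sup>2)"
        by (auto intro!: continuous_intros)
      fix x :: real
      have "((\<lambda>x. c * ((x - sin x * cos x) / 2)) has_real_derivative c * ((1 - (cos x * cos x - sin x * sin x)) / 2)) (at x)"
        by (auto intro!: derivative_eq_intros)
      moreover have "(1 - (cos x * cos x - sin x * sin x)) / 2 = (sin x)\<^sup>2"
        using sin_cos_squared_add[of x] by (simp add: power2_eq_square)
      ultimately have "((\<lambda>x. c * ((x - sin x * cos x) / 2)) has_real_derivative c * (sin x)\<^sup>2) (at x)"
        by simp
      then show "((\<lambda>x. c * ((x - sin x * cos x) / 2)) has_vector_derivative c * (sin x)\<^sup>2) (at x within {min 0 (pi / 2)..max 0 (pi / 2)})"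
        unfolding has_real_derivative_iff_has_vector_derivative by (rule has_vector_derivative_at_within)
    qed
    then show ?thesis
      unfolding interval_lebesgue_integral_le_eq[OF le] by simp
  qed
  have "elliptic_K k + c * (pi / 4) = (LBINT x:einterval (ereal 0) (ereal (pi / 2)). ?f k x + c * (sin x)\<^sup>2)"
    unfolding elliptic_K_def zero_ereal_def interval_lebesgue_integral_le_eq[OF le] S[symmetric]
    using int[of k] int_s k by (subst set_integral_add) auto
  also have "\<dots> \<le> (LBINT x:einterval (ereal 0) (ereal (pi / 2)). ?f l x)"
  proof (rule set_integral_mono)
    show "set_integrable lborel (einterval (ereal 0) (ereal (pi / 2))) (\<lambda>x. ?f k x + c * (sin x)\<^sup>2)"
      using int[of k] int_s k by (intro set_integral_add) auto
    fix x :: real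
    define u v where uv: "u = sqrt (1 - k\<^sup>2 * (sin x)\<^sup>2)" "v = sqrt (1 - l\<^sup>2 * (sin x)\<^sup>2)"
    have uv0: "u > 0" "v > 0" "u \<le> 1" "v \<le> 1"
      using pos[of k x] pos[of l x] k by (simp_all add: uv)
    have d: "(u - v) * (u + v) = 2 * c * (sin x)\<^sup>2"
    proof -
      have "u\<^sup>2 = 1 - k\<^sup>2 * (sin x)\<^sup>2" "v\<^sup>2 = 1 - l\<^sup>2 * (sin x)\<^sup>2"
        using pos[of k x] pos[of l x] k by (simp_all add: uv)
      then show ?thesis
        by (simp add: c_def algebra_simps power2_eq_square)
    qed
    then have "(u - v) * (u + v) \<ge> 0" using c by simp
    then have uv1: "u - v \<ge> 0" using uv0 by (simp add: zero_le_mult_iff)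
    have "2 * c * (sin x)\<^sup>2 \<le> (u - v) * 2"
      unfolding d[symmetric] using uv0 uv1 by (intro mult_left_mono) auto
    then have "c * (sin x)\<^sup>2 \<le> u - v" by simp
    also have "u - v \<le> (u - v) / (u * v)"
    proof -
      have "u * v \<le> 1" using uv0 by (simp add: mult_le_one)
      then have "(u - v) * (u * v) \<le> (u - v) * 1" using uv1 by (intro mult_left_mono) auto
      then show ?thesis using uv0 by (simp add: pos_le_divide_eq)
    qed
    also have "\<dots> = 1 / v - 1 / u" using uv0 by (simp add: field_simps)
    finally show "?f k x + c * (sin x)\<^sup>2 \<le> ?f l x"
      unfolding uv[symmetric] by simp
  qed (use int k in auto)
  also have "\<dots> = elliptic_K l"
    unfolding elliptic_K_def zero_ereal_def interval_lebesgue_integral_le_eq[OF le] ..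
  finally show ?thesis using c by (smt (verit) mult_pos_pos pi_gt_zero divide_pos_pos)
qed

section \<open>Both elliptic integrals at the theta modulus\<close>

lemma thA_gt:
  assumes q: "0 < q" "q < 1"
  shows "thB q < thA q" "thC q < thA q"
proof -
  have q2: "0 < q\<^sup>2" "q\<^sup>2 < 1" using power_in_unit[OF q, of 2] by auto
  show "thB q < thA q"
    using thC_pos[OF q2] unfolding thA_square_arg[OF q] thB_square_arg[OF q] by simp
  show "thC q < thA q"
    using theta_modulus_bounds(2)[OF q] thA_pos[OF q] by (simp add: theta_modulus_def)
qed

lemma power_two_power_Suc: "q ^ (2 ^ Suc n) = (q ^ (2 ^ n))\<^sup>2" for q :: real
  by (simp flip: power_mult add: mult.commute)

text \<open>The integral is unchanged from q to q^2. Along q^(2^n) both arguments tend to 1, so the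
  bounds pi/(2a) and pi/(2b) squeeze it to pi/2.\<close>

lemma agm_integral_theta_AB:
  assumes q: "0 < q" "q < 1"
  shows "agm_integral (thA q) (thB q) = pi / 2"
proof -
  let ?q = "\<lambda>n. q ^ (2 ^ n)"
  have qn: "0 < ?q n" "?q n < 1" for n
    using power_in_unit[OF q, of "2 ^ n"] by auto
  have step: "agm_integral (thA x) (thB x) = agm_integral (thA (x\<^sup>2)) (thB (x\<^sup>2))" if x: "0 < x" "x < 1" for x
  proof -
    have x2: "0 < x\<^sup>2" "x\<^sup>2 < 1" using power_in_unit[OF x, of 2] by auto
    have "(thA x + thB x) / 2 = thA (x\<^sup>2)"
      unfolding thA_square_arg[OF x] thB_square_arg[OF x] by simp
    moreover have "sqrt (thA x * thB x) = thB (x\<^sup>2)"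
      unfolding thA_thB[OF x] using thB_pos[OF x2] by simp
    ultimately show ?thesis
      using agm_integral_landen[OF thA_pos[OF x] thB_pos[OF x]] by simp
  qed
  have const: "agm_integral (thA q) (thB q) = agm_integral (thA (?q n)) (thB (?q n))" for n
  proof (induction n)
    case (Suc n)
    then show ?case
      using step[OF qn[of n]] unfolding power_two_power_Suc by simp
  qed simp
  note lim = filterlim_compose[OF thA_at_right_0 filterlim_power_two_power[OF q]]
    filterlim_compose[OF thB_at_right_0 filterlim_power_two_power[OF q]]
  have b: "pi / (2 * thA (?q n)) \<le> agm_integral (thA q) (thB q)" "agm_integral (thA q) (thB q) \<le> pi / (2 * thB (?q n))" for n
    unfolding const[of n] using agm_integral_bounds[OF thB_pos[OF qn] less_imp_le[OF thA_gt(1)[OF qn]]] by auto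
  have "(\<lambda>n. pi / (2 * thA (?q n))) \<longlonglongrightarrow> pi / (2 * 1)"
    by (intro tendsto_intros lim) auto
  then have "pi / (2 * 1) \<le> agm_integral (thA q) (thB q)"
    by (rule LIMSEQ_le_const2) (use b in auto)
  moreover have "(\<lambda>n. pi / (2 * thB (?q n))) \<longlonglongrightarrow> pi / (2 * 1)"
    by (intro tendsto_intros lim) auto
  then have "agm_integral (thA q) (thB q) \<le> pi / (2 * 1)"
    by (rule LIMSEQ_le_const) (use b in auto)
  ultimately show ?thesis by simp
qed

text \<open>The complementary integral doubles under \<open>q \<mapsto> q\<^sup>2\<close>; its logarithmic growth as the second
  argument tends to \<open>0\<close> then fixes the value, in place of the modular inversion of theta functions.\<close>

lemma agm_integral_theta_AC:
  assumes q: "0 < q" "q < 1"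
  shows "agm_integral (thA q) (thC q) = - ln q / 2"
proof -
  let ?q = "\<lambda>n. q ^ (2 ^ n)"
  let ?G = "agm_integral (thA q) (thC q)"
  have qn: "0 < ?q n" "?q n < 1" for n
    using power_in_unit[OF q, of "2 ^ n"] by auto
  have step: "agm_integral (thA (x\<^sup>2)) (thC (x\<^sup>2)) = 2 * agm_integral (thA x) (thC x)" if x: "0 < x" "x < 1" for x
  proof -
    have x2: "0 < x\<^sup>2" "x\<^sup>2 < 1" using power_in_unit[OF x, of 2] by auto
    have "sqrt (thA (x\<^sup>2) * thC (x\<^sup>2)) = sqrt ((thC x / 2)\<^sup>2)"
      using thC_squared[OF x] by (simp add: power_divide)
    then have e: "sqrt (thA (x\<^sup>2) * thC (x\<^sup>2)) = thC x / 2"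
      using thC_pos[OF x] by simp
    have "agm_integral (thA (x\<^sup>2)) (thC (x\<^sup>2)) = agm_integral (1 / 2 * thA x) (1 / 2 * thC x)"
      using agm_integral_landen[OF thA_pos[OF x2] thC_pos[OF x2], unfolded e thA_square_arg[OF x, symmetric]] by simp
    also have "\<dots> = 2 * agm_integral (thA x) (thC x)"
      using agm_integral_scale[OF thC_pos[OF x] less_imp_le[OF thA_gt(2)[OF x]], of "1 / 2"] by simp
    finally show ?thesis .
  qed
  have G: "agm_integral (thA (?q n)) (thC (?q n)) = 2 ^ n * ?G" for n
  proof (induction n)
    case (Suc n)
    then show ?case
      using step[OF qn[of n]] unfolding power_two_power_Suc by simp
  qed simp
  let ?A = "\<lambda>n. thA (?q n)" and ?C = "\<lambda>n. thC (?q n)" and ?D = "\<lambda>n. thC (?q n) / sqrt (?q n)"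
  note fl = filterlim_power_two_power[OF q]
  have A: "?A \<longlonglongrightarrow> 1" and D: "?D \<longlonglongrightarrow> 4"
    using filterlim_compose[OF thA_at_right_0 fl] filterlim_compose[OF thC_at_right_0 fl] by simp_all
  have q0: "?q \<longlonglongrightarrow> 0"
    using fl by (simp add: filterlim_at)
  have pos: "?A n > 0" "?C n > 0" "?C n < ?A n" for n
    using thA_pos[OF qn] thC_pos[OF qn] thA_gt(2)[OF qn] by auto
  have C: "?C \<longlonglongrightarrow> 0"
  proof -
    have "(\<lambda>n. ?D n * sqrt (?q n)) \<longlonglongrightarrow> 4 * sqrt 0"
      by (intro tendsto_intros D q0)
    then show ?thesis using q by simp
  qed
  \<comment> \<open>Only the factor sqrt(q^(2^n)) of \<open>?C n\<close> has an unbounded logarithm;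
    after division by 2^n it alone contributes, and it gives -ln q / 2.\<close>
  have ln_eq: "ln (?A n / ?C n) = ln (?A n) - ln (?D n) - 2 ^ n * (ln q / 2)" for n
  proof -
    have "?C n = ?D n * sqrt (?q n)" using qn[of n] q by simp
    moreover have "?D n > 0" using pos[of n] qn[of n] by simp
    ultimately have "ln (?C n) = ln (?D n) + ln (sqrt (?q n))"
      using qn[of n] by (metis ln_mult_pos real_sqrt_gt_zero)
    also have "ln (sqrt (?q n)) = 2 ^ n * (ln q / 2)"
      using qn[of n] q by (simp add: ln_sqrt ln_realpow)
    finally show ?thesis
      using pos[of n] by (simp add: ln_div)
  qed
  have h: "(\<lambda>n. (1 / 2 :: real) ^ n) \<longlonglongrightarrow> 0"
    by (intro LIMSEQ_power_zero) auto
  have main: "(\<lambda>n. ((1 / 2) ^ n * (ln (?A n) - ln (?D n)) - ln q / 2) / (?A n - ?C n)) \<longlonglongrightarrow> (0 * (ln 1 - ln 4) - ln q / 2) / (1 - 0)"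
    by (intro tendsto_intros h A D C) auto
  have eq: "((1 / 2) ^ n * (ln (?A n) - ln (?D n)) - ln q / 2) / (?A n - ?C n) = ln (?A n / ?C n) / (?A n - ?C n) / 2 ^ n" for n
  proof -
    have "(1 / 2) ^ n * (ln (?A n) - ln (?D n)) - ln q / 2 = ln (?A n / ?C n) / 2 ^ n"
      unfolding ln_eq by (simp add: field_simps)
    then show ?thesis by simp
  qed
  have dv: "x / 2 ^ n \<le> y \<longleftrightarrow> x \<le> 2 ^ n * y" "y \<le> x / 2 ^ n \<longleftrightarrow> 2 ^ n * y \<le> x" for x y :: real and n
    by (simp_all add: field_simps)
  have lower: "ln (?A n / ?C n) / (?A n - ?C n) / 2 ^ n \<le> ?G" for n
    using agm_integral_log_bounds(1)[OF pos(2,3), of n] by (simp only: dv G)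
  have "?G \<le> (ln (?A n / ?C n) / (?A n - ?C n) + pi / (?A n + ?C n)) / 2 ^ n" for n
    using agm_integral_log_bounds(2)[OF pos(2,3), of n] by (simp only: dv G)
  then have upper: "?G \<le> ln (?A n / ?C n) / (?A n - ?C n) / 2 ^ n + (1 / 2) ^ n * (pi / (?A n + ?C n))" for n
    by (simp add: add_divide_distrib power_divide mult.commute)
  have main': "(\<lambda>n. ln (?A n / ?C n) / (?A n - ?C n) / 2 ^ n) \<longlonglongrightarrow> - ln q / 2"
    using main unfolding eq by simp
  then have "- ln q / 2 \<le> ?G"
    by (rule LIMSEQ_le_const2) (use lower in auto)
  moreover have "(\<lambda>n. ln (?A n / ?C n) / (?A n - ?C n) / 2 ^ n + (1 / 2) ^ n * (pi / (?A n + ?C n))) \<longlonglongrightarrow> - ln q / 2 + 0 * (pi / (1 + 0))"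
    by (intro tendsto_intros main' h A C) auto
  then have "?G \<le> - ln q / 2 + 0 * (pi / (1 + 0))"
    by (rule LIMSEQ_le_const) (use upper in auto)
  ultimately show ?thesis by simp
qed

text \<open>thB/thA is the complementary modulus and thC/thA the modulus, so the two integrals
  evaluated above are K(k)/thA and K(k')/thA.\<close>

lemma elliptic_K_theta:
  assumes q: "0 < q" "q < 1"
  shows "elliptic_K (theta_modulus q) = pi / 2 * thA q"
    and "elliptic_K (sqrt (1 - (theta_modulus q)\<^sup>2)) = - ln q / 2 * thA q"
proof -
  note k = theta_modulus_bounds[OF q]
  have "1 - (thB q / thA q)\<^sup>2 = (theta_modulus q)\<^sup>2"
    using k(3) by simp
  then have "sqrt (1 - (thB q / thA q)\<^sup>2) = theta_modulus q"
    using k(1) by simp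
  then show "elliptic_K (theta_modulus q) = pi / 2 * thA q"
    using agm_integral_elliptic_K[OF thB_pos[OF q] less_imp_le[OF thA_gt(1)[OF q]]] agm_integral_theta_AB[OF q] thA_pos[OF q]
    by (simp add: field_simps)
  show "elliptic_K (sqrt (1 - (theta_modulus q)\<^sup>2)) = - ln q / 2 * thA q"
    using agm_integral_elliptic_K[OF thC_pos[OF q] less_imp_le[OF thA_gt(2)[OF q]]] agm_integral_theta_AC[OF q] thA_pos[OF q]
    by (simp add: theta_modulus_def field_simps)
qed

lemma elliptic_K_pos:
  assumes "0 < k" "k < 1"
  shows "elliptic_K k > 0"
proof -
  define b where "b = sqrt (1 - k\<^sup>2)"
  have "k\<^sup>2 < 1" using assms by (simp add: power_less_one_iff)
  then have b: "0 < b" "b \<le> 1" and "sqrt (1 - b\<^sup>2) = k" using assms by (simp_all add: b_def)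
  then have "elliptic_K k = agm_integral 1 b"
    using agm_integral_elliptic_K[of b 1] by simp
  then show ?thesis
    using agm_integral_bounds(1)[OF b] pi_gt_zero by linarith
qed

text \<open>The two evaluations give K(k')/K(k) = -ln q / pi = sqrt r. The definite description also
  needs uniqueness, which holds because the quotient strictly decreases in the modulus.\<close>

theorem singular_modulus_theta:
  assumes "r > 0" and q: "q = exp (- pi * sqrt r)"
  shows "singular_modulus r = theta_modulus q"
  unfolding singular_modulus_def
proof (rule the_equality)
  have q01: "0 < q" "q < 1" using assms by auto
  have "- ln q = pi * sqrt r" using q by simp
  then have "elliptic_K (sqrt (1 - (theta_modulus q)\<^sup>2)) / elliptic_K (theta_modulus q) = sqrt r"
    unfolding elliptic_K_theta[OF q01] using thA_pos[OF q01] by simp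
  with theta_modulus_bounds[OF q01]
  show 1: "theta_modulus q \<in> {0<..<1} \<and> elliptic_K (sqrt (1 - (theta_modulus q)\<^sup>2)) / elliptic_K (theta_modulus q) = sqrt r"
    by simp
  have anti: "elliptic_K (sqrt (1 - l\<^sup>2)) / elliptic_K l < elliptic_K (sqrt (1 - k\<^sup>2)) / elliptic_K k"
    if kl: "0 < k" "k < l" "l < 1" for k l
  proof -
    have sq: "k\<^sup>2 < l\<^sup>2" "l\<^sup>2 < 1" "0 < k\<^sup>2" "0 < l\<^sup>2"
      using kl by (auto simp: power_strict_mono power_less_one_iff)
    then have s: "0 < sqrt (1 - l\<^sup>2)" "sqrt (1 - l\<^sup>2) < sqrt (1 - k\<^sup>2)" "sqrt (1 - k\<^sup>2) < 1" by auto
    have "elliptic_K k < elliptic_K l" "elliptic_K (sqrt (1 - l\<^sup>2)) < elliptic_K (sqrt (1 - k\<^sup>2))"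
      using elliptic_K_strict_mono[OF kl] elliptic_K_strict_mono[OF s] by auto
    moreover have "elliptic_K k > 0" "elliptic_K (sqrt (1 - l\<^sup>2)) > 0"
      using elliptic_K_pos kl s by auto
    ultimately show ?thesis by (intro frac_less) auto
  qed
  fix k assume k: "k \<in> {0<..<1} \<and> elliptic_K (sqrt (1 - k\<^sup>2)) / elliptic_K k = sqrt r"
  show "k = theta_modulus q"
    using anti[of k "theta_modulus q"] anti[of "theta_modulus q" k] k 1 by (cases k "theta_modulus q" rule: linorder_cases) auto
qed

text \<open>The primitive, vanishing at 0, of (2k)^(1/3) (1 - k^2)^(-1/3) / k. Termwise integration
  of the binomial series divides its n-th coefficient by 2n + 1/3, and this is where 1/6 and 7/6
  come from.\<close>

definition hyp_primitive :: "real \<Rightarrow> real" where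
  "hyp_primitive k = 3 * root 3 (2 * k) * hypergeometric_2F1 (1/3) (1/6) (7/6) (k\<^sup>2)"

text \<open>As 7/6 = 1/6 + 1, the two products differ only in their end factors.\<close>

lemma pochhammer_ratio: "pochhammer (1/6 :: real) n / pochhammer (7/6) n = 1 / (6 * real n + 1)"
proof -
  have p: "pochhammer (7/6 :: real) n > 0" by (rule pochhammer_pos) simp
  have "pochhammer (1/6 :: real) (Suc n) = 1/6 * pochhammer (7/6) n"
    using pochhammer_rec[of "1/6 :: real" n] by simp
  moreover have "pochhammer (1/6 :: real) (Suc n) = pochhammer (1/6) n * (1/6 + real n)"
    by (rule pochhammer_Suc)
  ultimately have "pochhammer (1/6 :: real) n * (6 * real n + 1) = pochhammer (7/6) n"
    by (simp add: algebra_simps)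
  then show ?thesis using p by (simp add: field_simps)
qed

definition binom_coeff :: "nat \<Rightarrow> real" where
  "binom_coeff n = pochhammer (1/3) n / fact n"

lemma binom_coeff_nonneg: "binom_coeff n \<ge> 0"
  by (simp add: binom_coeff_def pochhammer_nonneg)

lemma binom_coeff_div_le: "binom_coeff n / (6 * real n + 1) \<le> binom_coeff n"
  using divide_left_mono[of 1 "6 * real n + 1" "binom_coeff n"] binom_coeff_nonneg[of n] by simp

lemma hypergeometric_coeff:
  "pochhammer (1/3) n * pochhammer (1/6) n / pochhammer (7/6) n / (fact n :: real) = binom_coeff n / (6 * real n + 1)"
proof -
  have "pochhammer (1/3) n * pochhammer (1/6) n / pochhammer (7/6) n / (fact n :: real)
     = binom_coeff n * (pochhammer (1/6) n / pochhammer (7/6) n)"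
    by (simp add: binom_coeff_def)
  then show ?thesis unfolding pochhammer_ratio by simp
qed

lemma binom_coeff_sums:
  assumes "0 \<le> z" "z < 1"
  shows "(\<lambda>n. binom_coeff n * z ^ n) sums (1 - z) powr (- (1/3))"
proof -
  have "(\<lambda>n. ((- (1/3)) gchoose n) * (- z) ^ n) sums (1 + (- z)) powr (- (1/3))"
    using assms by (intro gen_binomial_real) auto
  moreover have "((- (1/3)) gchoose n) * (- z) ^ n = binom_coeff n * z ^ n" for n
  proof -
    have "(- z) ^ n = (-1) ^ n * z ^ n" by (rule power_minus)
    moreover have "((-1::real) ^ n) * (-1) ^ n = 1" by (simp flip: power_mult_distrib)
    ultimately show ?thesis
      by (simp add: gbinomial_pochhammer binom_coeff_def mult_ac)
  qed
  ultimately show ?thesis by simp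
qed

lemma summable_hypergeometric:
  assumes "\<bar>x\<bar> < 1"
  shows "summable (\<lambda>n. binom_coeff n / (6 * real n + 1) * x ^ n)"
proof (rule summable_comparison_test')
  show "summable (\<lambda>n. binom_coeff n * \<bar>x\<bar> ^ n)"
    using binom_coeff_sums[of "\<bar>x\<bar>"] assms by (simp add: sums_iff)
  show "norm (binom_coeff n / (6 * real n + 1) * x ^ n) \<le> binom_coeff n * \<bar>x\<bar> ^ n" for n
    using binom_coeff_nonneg[of n] binom_coeff_div_le[of n]
    by (simp add: abs_mult power_abs mult_right_mono del: times_divide_eq_left)
qed

lemma hyp_primitive_deriv:
  assumes k: "0 < k" "k < 1"
  shows "(hyp_primitive has_real_derivative (2 * k) powr (1/3) / k * (1 - k\<^sup>2) powr (- (1/3))) (at k)"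
proof -
  let ?c = "\<lambda>n. binom_coeff n / (6 * real n + 1)"
  let ?w = "\<lambda>z. \<Sum>n. ?c n * z ^ n"
  define z where "z = k\<^sup>2"
  have z: "0 < z" "z < 1" using k by (simp_all add: z_def power_less_one_iff)
  have hyp: "hypergeometric_2F1 (1/3) (1/6) (7/6) x = ?w x" for x
  proof -
    have "pochhammer (1/3) n * pochhammer (1/6) n / pochhammer (7/6) n * (x ^ n / fact n) = ?c n * x ^ n" for n
      using arg_cong[OF hypergeometric_coeff[of n], of "\<lambda>y. y * x ^ n"] by simp
    then show ?thesis by (simp add: hypergeometric_2F1_def)
  qed
  note sum_c = summable_hypergeometric
  have wd: "(?w has_real_derivative (\<Sum>n. diffs ?c n * z ^ n)) (at z)"
    by (rule termdiffs_strong'[of 1]) (use z sum_c in simp_all)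
  \<comment> \<open>The operator w + 6 z w' multiplies the n-th coefficient by 6n + 1. This cancels
    the denominator and leaves the binomial series.\<close>
  have key: "?w z + 6 * z * (\<Sum>n. diffs ?c n * z ^ n) = (1 - z) powr (- (1/3))"
  proof -
    have "summable (\<lambda>n. diffs ?c n * z ^ n)"
      by (rule termdiff_converges[of z 1]) (use z sum_c in simp_all)
    then have "(\<lambda>n. real n * ?c n * z ^ (n - Suc 0)) sums (\<Sum>n. diffs ?c n * z ^ n)"
      by (rule diffs_equiv)
    from sums_mult[OF this, of z] have "(\<lambda>n. real n * ?c n * z ^ n) sums (z * (\<Sum>n. diffs ?c n * z ^ n))"
    proof (rule sums_cong[THEN iffD1, rotated])
      fix n show "z * (real n * ?c n * z ^ (n - Suc 0)) = real n * ?c n * z ^ n"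
        by (cases n) auto
    qed
    from sums_add[OF summable_sums[OF sum_c[of z]] sums_mult[OF this, of 6]] z
    have "(\<lambda>n. ?c n * z ^ n + 6 * (real n * ?c n * z ^ n)) sums (?w z + 6 * (z * (\<Sum>n. diffs ?c n * z ^ n)))"
      by simp
    moreover have "?c n * z ^ n + 6 * (real n * ?c n * z ^ n) = binom_coeff n * z ^ n" for n
    proof -
      have "c * y + 6 * (real n * c * y) = c * (6 * real n + 1) * y" for c y :: real
        by (simp add: algebra_simps)
      then have "?c n * z ^ n + 6 * (real n * ?c n * z ^ n) = ?c n * (6 * real n + 1) * z ^ n" .
      then show ?thesis by simp
    qed
    ultimately have "(\<lambda>n. binom_coeff n * z ^ n) sums (?w z + 6 * (z * (\<Sum>n. diffs ?c n * z ^ n)))"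
      by simp
    then show ?thesis
      using binom_coeff_sums[of z] z sums_unique2 by (fastforce simp: mult.assoc)
  qed
  have sq: "((\<lambda>x. x\<^sup>2) has_real_derivative 2 * k) (at k)"
    by (auto intro!: derivative_eq_intros)
  have "((\<lambda>x. ?w (x\<^sup>2)) has_real_derivative (\<Sum>n. diffs ?c n * z ^ n) * (2 * k)) (at k)"
    by (rule DERIV_chain2[where f = ?w and g = "\<lambda>x. x^2", OF wd[unfolded z_def] sq, folded z_def])
  moreover have "((\<lambda>x. 3 * (2 * x) powr (1/3)) has_real_derivative (2 * k) powr (1/3) / k) (at k)"
  proof -
    have "((\<lambda>x. 3 * (2 * x) powr (1/3)) has_real_derivative 3 * ((1/3) * (2 * k) powr (1/3 - 1) * 2)) (at k)"
      using k by (auto intro!: derivative_eq_intros)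
    also have "(2 * k) powr (1/3 - 1) = (2 * k) powr (1/3) / (2 * k)"
      using powr_add[of "2 * k" "1/3 - 1" 1] k by simp
    finally show ?thesis using k by simp
  qed
  ultimately have "((\<lambda>x. 3 * (2 * x) powr (1/3) * ?w (x\<^sup>2)) has_real_derivative
      (2 * k) powr (1/3) / k * ?w (k\<^sup>2) + ((\<Sum>n. diffs ?c n * z ^ n) * (2 * k)) * (3 * (2 * k) powr (1/3))) (at k)"
    by (rule DERIV_mult[rotated])
  also have "(2 * k) powr (1/3) / k * ?w (k\<^sup>2) + ((\<Sum>n. diffs ?c n * z ^ n) * (2 * k)) * (3 * (2 * k) powr (1/3))
      = (2 * k) powr (1/3) / k * (?w z + 6 * z * (\<Sum>n. diffs ?c n * z ^ n))"
    unfolding z_def[symmetric] using k by (simp add: z_def field_simps power2_eq_square)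
  finally have "((\<lambda>x. 3 * (2 * x) powr (1/3) * ?w (x\<^sup>2)) has_real_derivative
      (2 * k) powr (1/3) / k * (1 - k\<^sup>2) powr (- (1/3))) (at k)"
    unfolding key unfolding z_def .
  moreover have "3 * (2 * x) powr (1/3) * ?w (x\<^sup>2) = hyp_primitive x" if "x > 0" for x
    using that by (simp add: hyp_primitive_def hyp root_powr_inverse)
  then have "eventually (\<lambda>x. 3 * (2 * x) powr (1/3) * ?w (x\<^sup>2) = hyp_primitive x) (nhds k)"
    using eventually_nhds_in_open[of "{0<..}" k] k by (auto elim!: eventually_mono)
  ultimately show ?thesis
    by (rule has_derivative_transform_nhds)
qed

lemma hyp_primitive_at_0: "(hyp_primitive \<longlongrightarrow> 0) (at_right 0)"
proof -
  let ?d = "\<lambda>n. pochhammer (1/3) n * pochhammer (1/6) n / pochhammer (7/6) n / (fact n :: real)"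
  let ?h = "hypergeometric_2F1 (1/3) (1/6) (7/6)"
  have "(\<lambda>n. ?d n * x ^ n) sums ?h x" if "norm x < 1" for x
    using summable_hypergeometric[of x] that
    by (simp add: hypergeometric_coeff[symmetric] hypergeometric_2F1_def summable_sums)
  then have "(?h \<longlongrightarrow> ?d 0) (at 0)"
    by (intro powser_limit_0[of 1]) auto
  moreover have "filterlim (\<lambda>k::real. k\<^sup>2) (at 0) (at_right 0)"
    unfolding filterlim_at using eventually_at_right_less[of "0::real"]
    by (auto intro!: tendsto_eq_intros elim: eventually_mono)
  ultimately have "((\<lambda>k. ?h (k\<^sup>2)) \<longlongrightarrow> ?d 0) (at_right 0)"
    by (rule filterlim_compose)
  then have "((\<lambda>k. 3 * root 3 (2 * k) * ?h (k\<^sup>2)) \<longlongrightarrow> 3 * root 3 (2 * 0) * ?d 0) (at_right 0)"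
    by (intro tendsto_intros)
  then show ?thesis
    by (simp add: hyp_primitive_def[abs_def])
qed

section \<open>The three integrals\<close>

lemma hyp_primitive_theta_deriv:
  assumes q: "0 < q" "q < 1"
  shows "((\<lambda>x. hyp_primitive (theta_modulus x)) has_real_derivative (q powr (1/6) * euler q ^ 4 / q)) (at q)"
proof -
  define k where "k = theta_modulus q"
  note k = theta_modulus_bounds[OF q, folded k_def]
  define A B C where ABC: "A = thA q" "B = thB q" "C = thC q"
  have pos: "A > 0" "B > 0" "C > 0"
    using thA_pos[OF q] thB_pos[OF q] thC_pos[OF q] by (simp_all add: ABC)
  have kC: "k = C / A" by (simp add: k_def theta_modulus_def ABC)
  have E: "euler q > 0" using q by (intro euler_pos) auto
  have "((\<lambda>x. hyp_primitive (theta_modulus x)) has_real_derivative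
      ((2 * k) powr (1/3) / k * (1 - k\<^sup>2) powr (- (1/3))) * (k * B\<^sup>2 / (2 * q))) (at q)"
    unfolding k_def ABC
    by (rule DERIV_chain2[where f = hyp_primitive and g = theta_modulus])
       (use hyp_primitive_deriv[OF k(1,2)] theta_modulus_deriv[OF q] in \<open>simp_all add: k_def\<close>)
  also have "((2 * k) powr (1/3) / k * (1 - k\<^sup>2) powr (- (1/3))) * (k * B\<^sup>2 / (2 * q))
      = ((2 * k) powr (1/3) * (1 - k\<^sup>2) powr (- (1/3)) * (B\<^sup>2 / 2)) / q"
    using k by simp
  \<comment> \<open>Cubes are compared to remove the exponents 1/3: the left side becomes 2k/(1 -
    k^2) (B^2/2)^3 = C A B^4 / 4. Both sides are nonnegative, so equal cubes suffice.\<close>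
  also have "(2 * k) powr (1/3) * (1 - k\<^sup>2) powr (- (1/3)) * (B\<^sup>2 / 2) = q powr (1/6) * euler q ^ 4"
  proof -
    have cube: "(x powr (1/3)) ^ 3 = x" if "x > 0" for x :: real
      using that by (simp flip: powr_realpow add: powr_powr)
    have sq: "(y powr (- (1/3))) ^ 3 = 1 / y" if "y > 0" for y :: real
      unfolding powr_minus power_inverse cube[OF that] by (rule inverse_eq_divide)
    have "((2 * k) powr (1/3) * (1 - k\<^sup>2) powr (- (1/3)) * (B\<^sup>2 / 2)) ^ 3 = C * A * B ^ 4 / 4"
    proof -
      have "1 - k\<^sup>2 > 0" using k(3) pos by (simp add: ABC)
      then have "((2 * k) powr (1/3) * (1 - k\<^sup>2) powr (- (1/3)) * (B\<^sup>2 / 2)) ^ 3 = 2 * k / (1 - k\<^sup>2) * (B\<^sup>2 / 2) ^ 3"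
        using sq[of "1 - k\<^sup>2"] cube[of "2 * k"] k(1) by (simp add: power_mult_distrib del: times_divide_eq_right) simp
      also have "\<dots> = 2 * (C / A) / (B / A)\<^sup>2 * (B\<^sup>2 / 2) ^ 3"
        using k(3) kC by (simp add: ABC)
      also have "\<dots> = C * A * B ^ 4 / 4"
        using pos by (simp add: field_simps eval_nat_numeral)
      finally show ?thesis .
    qed
    also have "\<dots> = sqrt q * euler q ^ 12"
      using eta_product_theta[OF q] by (simp add: ABC)
    also have "\<dots> = (q powr (1/6) * euler q ^ 4) ^ 3"
      using q by (simp add: power_mult_distrib powr_half_sqrt flip: powr_realpow power_mult add: powr_powr)
    finally show ?thesis
      by (rule power_eq_imp_eq_base) (use E q in auto)
  qed
  finally show ?thesis by simp
qed

lemma hyp_primitive_theta_at_right_0: "((\<lambda>x. hyp_primitive (theta_modulus x)) \<longlongrightarrow> 0) (at_right 0)"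
proof (rule filterlim_compose[OF hyp_primitive_at_0])
  have "eventually (\<lambda>x::real. x \<in> {0<..<1}) (at_right 0)"
    by (rule eventually_at_right_real) simp
  then have "eventually (\<lambda>x. theta_modulus x \<in> {0<..} \<and> theta_modulus x \<noteq> 0) (at_right 0)"
  proof (rule eventually_mono)
    fix x :: real assume "x \<in> {0<..<1}"
    then show "theta_modulus x \<in> {0<..} \<and> theta_modulus x \<noteq> 0"
      using theta_modulus_bounds(1)[of x] by simp
  qed
  then show "filterlim theta_modulus (at_right 0) (at_right 0)"
    using theta_modulus_at_right_0 unfolding filterlim_at by blast
qed

lemma isCont_transform_nhds:
  fixes f g :: "real \<Rightarrow> real"
  assumes "isCont f x" "eventually (\<lambda>x. f x = g x) (nhds x)"
  shows "isCont g x"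
  using assms(1) isCont_cong[OF assms(2)] by simp

lemma isCont_euler:
  assumes "0 < q" "q < (1::real)"
  shows "isCont euler q"
proof -
  have "isCont (\<lambda>x. exp (ln (euler (x ^ 1)))) q"
    using DERIV_isCont[OF ln_euler_power_deriv[OF assms, of 1]] by (intro isCont_exp') auto
  moreover have "eventually (\<lambda>x. exp (ln (euler (x ^ 1))) = euler x) (nhds q)"
    using eventually_nhds_in_open[of "{0<..<1}" q] assms euler_pos by (auto elim!: eventually_mono)
  ultimately show ?thesis
    by (rule isCont_transform_nhds)
qed

text \<open>Halving the argument makes e^(2 pi i n tau) equal to the n-th power of q = e^(-pi t),
  the nome used for the theta constants.\<close>

lemma dedekind_eta_imag:
  assumes "t > 0"
  shows "dedekind_eta (\<i> * of_real t / 2) = of_real (exp (- pi * t / 24) * euler (exp (- pi * t)))"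
proof -
  let ?p = "exp (- pi * t)"
  have p: "\<bar>?p\<bar> < 1" using assms by simp
  have "exp (2 * of_real pi * \<i> * of_nat (Suc n) * (\<i> * of_real t / 2)) = complex_of_real ?p * of_real ?p ^ n" for n
  proof -
    have "2 * of_real pi * \<i> * of_nat (Suc n) * (\<i> * of_real t / 2) = complex_of_real (real (Suc n) * (- pi * t))"
      by (simp add: algebra_simps)
    then have "exp (2 * of_real pi * \<i> * of_nat (Suc n) * (\<i> * of_real t / 2)) = complex_of_real (exp (real (Suc n) * (- pi * t)))"
      by (simp only: exp_of_real)
    also have "exp (real (Suc n) * (- pi * t)) = ?p ^ Suc n"
      by (rule exp_of_nat_mult)
    finally show ?thesis by simp
  qed
  then have "(\<Prod>n. 1 - exp (2 * of_real pi * \<i> * of_nat (Suc n) * (\<i> * of_real t / 2))) = qpoch_inf (complex_of_real ?p) (of_real ?p)"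
    by (simp only: qpoch_inf_def)
  also have "\<dots> = of_real (euler ?p)"
    by (rule qpoch_inf_of_real[OF p])
  finally have 1: "(\<Prod>n. 1 - exp (2 * of_real pi * \<i> * of_nat (Suc n) * (\<i> * of_real t / 2))) = complex_of_real (euler ?p)" .
  have "of_real pi * \<i> * (\<i> * of_real t / 2) / 12 = complex_of_real (- pi * t / 24)"
    by (simp add: algebra_simps)
  then have 2: "exp (of_real pi * \<i> * (\<i> * of_real t / 2) / 12) = complex_of_real (exp (- pi * t / 24))"
    by (simp only: exp_of_real)
  show ?thesis
    unfolding dedekind_eta_def 1 2 by simp
qed

lemma eta_integral:
  assumes "r > 0" and q: "q = exp (- pi * sqrt r)"
  shows "of_real pi * (LBINT t=ereal (sqrt r)..\<infinity>. dedekind_eta (\<i> * of_real t / 2) ^ 4)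
           = complex_of_real (hyp_primitive (theta_modulus q))"
proof -
  let ?p = "\<lambda>t::real. exp (- pi * t)"
  let ?f = "\<lambda>t. ?p t powr (1/6) * euler (?p t) ^ 4"
  let ?F = "\<lambda>t. - hyp_primitive (theta_modulus (?p t)) / pi"
  have r: "sqrt r > 0" using assms by simp
  \<comment> \<open>The endpoint is included because the primitive must be continuous there.\<close>
  have p: "0 < ?p t" "?p t < 1" if "t > sqrt r \<or> t = sqrt r" for t
  proof -
    have "t > 0" using that r by (elim disjE) linarith+
    then show "0 < ?p t" "?p t < 1" by auto
  qed
  have deriv: "(?F has_real_derivative ?f t) (at t)" if "t > sqrt r \<or> t = sqrt r" for t
  proof -
    have "(?p has_real_derivative ?p t * (- pi)) (at t)"
      by (auto intro!: derivative_eq_intros)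
    from DERIV_chain2[where f = "\<lambda>x. hyp_primitive (theta_modulus x)" and g = ?p, OF hyp_primitive_theta_deriv[OF p[OF that]] this]
    have "((\<lambda>t. hyp_primitive (theta_modulus (?p t))) has_real_derivative
       (?f t / ?p t * (?p t * (- pi)))) (at t)" .
    from DERIV_cdivide[OF DERIV_minus[OF this], of pi] show ?thesis by simp
  qed
  have cont: "isCont ?f t" if "t > sqrt r" for t
  proof -
    have "isCont (\<lambda>t. euler (?p t)) t"
      by (rule isCont_o2[where f = ?p and g = euler]) (use that p[of t] in \<open>auto intro!: isCont_euler continuous_intros\<close>)
    then show ?thesis by (intro continuous_intros) auto
  qed
  have "isCont ?F (sqrt r)" using DERIV_isCont[OF deriv] by blast
  then have "(?F \<longlongrightarrow> ?F (sqrt r)) (at_right (sqrt r))"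
    unfolding isCont_def by (rule filterlim_mono) (auto intro: at_le)
  then have lim0: "((?F \<circ> real_of_ereal) \<longlongrightarrow> ?F (sqrt r)) (at_right (ereal (sqrt r)))"
    unfolding ereal_tendsto_simps .
  have "filterlim ?p (at_right 0) at_top"
  proof -
    have "filterlim (\<lambda>t. - pi * t) at_bot at_top"
      by (rule filterlim_tendsto_neg_mult_at_bot[OF tendsto_const]) (auto intro: filterlim_ident)
    then have "(?p \<longlongrightarrow> 0) at_top" by (rule filterlim_compose[OF exp_at_bot])
    then show ?thesis unfolding filterlim_at by simp
  qed
  from filterlim_compose[OF hyp_primitive_theta_at_right_0 this]
  have "(?F \<longlongrightarrow> - 0 / pi) at_top" by (intro tendsto_intros) auto
  then have lim1: "((?F \<circ> real_of_ereal) \<longlongrightarrow> 0) (at_left \<infinity>)"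
    unfolding ereal_tendsto_simps by simp
  have I: "(LBINT t=ereal (sqrt r)..\<infinity>. ?f t) = 0 - ?F (sqrt r)"
    by (rule interval_integral_FTC_nonneg(2)[OF _ _ _ _ lim0 lim1]) (use deriv cont in auto)
  have "(LBINT t=ereal (sqrt r)..\<infinity>. dedekind_eta (\<i> * of_real t / 2) ^ 4) = (LBINT t=ereal (sqrt r)..\<infinity>. complex_of_real (?f t))"
  proof (rule interval_integral_cong)
    fix t assume "t \<in> einterval (min (ereal (sqrt r)) \<infinity>) (max (ereal (sqrt r)) \<infinity>)"
    then have "t > sqrt r" by (simp add: einterval_def)
    then have "t > 0" using r by linarith
    have "exp (- pi * t / 24) ^ 4 = ?p t powr (1/6)"
      by (simp add: exp_powr_real flip: exp_of_nat_mult)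
    then show "dedekind_eta (\<i> * of_real t / 2) ^ 4 = complex_of_real (?f t)"
      unfolding dedekind_eta_imag[OF \<open>t > 0\<close>] by (simp add: power_mult_distrib flip: of_real_power)
  qed
  also have "\<dots> = complex_of_real (- ?F (sqrt r))"
    unfolding interval_lebesgue_integral_of_real I by simp
  finally show ?thesis
    unfolding q by simp
qed

text \<open>Substitute x = R(p). The sixth root becomes E(p) / (p^(1/6) E(p^5)), so with R'/R =
  E(p)^5 / (5 p E(p^5)) the new integrand is one fifth of the derivative found for the
  hypergeometric side.\<close>

lemma rr_integral:
  assumes q: "0 < q" "q < 1"
  shows "hyp_primitive (theta_modulus q) = 5 * (LBINT x=0..ereal (rogers_ramanujan q). 1 / (x * root 6 (1 / x ^ 5 - 11 - x ^ 5)))"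
proof -
  let ?R = rogers_ramanujan
  let ?f = "\<lambda>x::real. 1 / (x * root 6 (1 / x ^ 5 - 11 - x ^ 5))"
  let ?R' = "\<lambda>p::real. ?R p * euler p ^ 5 / (5 * p * euler (p ^ 5))"
  let ?h = "\<lambda>p::real. p powr (1/6) * euler p ^ 4 / p"
  \<comment> \<open>the substitution rule also wants the derivative to be nonnegative at the endpoints\<close>
  let ?g' = "\<lambda>p. if 0 < p \<and> p < 1 then ?R' p else 0"
  have R: "?R p > 0" "1 / ?R p ^ 5 - 11 - ?R p ^ 5 > 0" "?f (?R p) * ?R' p = 1/5 * ?h p" if p: "0 < p" "p < 1" for p
  proof -
    have p5: "0 < p ^ 5" "p ^ 5 < 1" using power_in_unit[OF p, of 5] by auto
    define a b where ab: "a = euler p" "b = euler (p ^ 5)"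
    have pos: "a > 0" "b > 0" using euler_pos[of p] euler_pos[of "p ^ 5"] p p5 by (auto simp: ab)
    show R0: "?R p > 0" by (rule rogers_ramanujan_deriv(1)[OF p])
    have e: "1 / ?R p ^ 5 - 11 - ?R p ^ 5 = a ^ 6 / (p * b ^ 6)"
      unfolding ab by (rule rogers_ramanujan_eleven[OF p])
    then show "1 / ?R p ^ 5 - 11 - ?R p ^ 5 > 0" using pos p by simp
    have "a ^ 6 / (p * b ^ 6) = (a / (p powr (1/6) * b)) ^ 6"
      using p by (simp add: power_divide power_mult_distrib flip: powr_realpow add: powr_powr)
    then have root: "root 6 (1 / ?R p ^ 5 - 11 - ?R p ^ 5) = a / (p powr (1/6) * b)"
      unfolding e using pos p by (simp only:) (intro real_root_power_cancel; simp)
    have "1 / (x * (a / (w * b))) * (x * a ^ 5 / (5 * p * b)) = 1/5 * (w * a ^ 4 / p)" if "x > 0" "w > 0" for x w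
      using that pos p by (simp add: field_simps eval_nat_numeral)
    then show "?f (?R p) * ?R' p = 1/5 * ?h p"
      unfolding root ab[symmetric] using R0 p by simp
  qed
  have cont_f: "isCont ?f (?R p)" if p: "0 < p" "p < 1" for p
    using R(1,2)[OF p] by (auto intro!: continuous_intros)
  have contE: "isCont (\<lambda>x. euler (x ^ 5)) p" if p: "0 < p" "p < (1::real)" for p
    by (rule isCont_o2[where f = "\<lambda>x. x ^ 5" and g = euler])
       (use power_in_unit[OF p, of 5] in \<open>auto intro!: isCont_euler continuous_intros\<close>)
  have cont_R': "isCont ?g' p" if p: "0 < p" "p < 1" for p
  proof -
    have "euler (p ^ 5) > 0" using power_in_unit[OF p, of 5] by (intro euler_pos) auto
    then have "isCont ?R' p"
      using p DERIV_isCont[OF rogers_ramanujan_deriv(2)[OF p]] isCont_euler[OF p] contE[OF p]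
      by (intro continuous_intros) auto
    moreover have "eventually (\<lambda>x. ?R' x = ?g' x) (nhds p)"
      using eventually_nhds_in_open[of "{0<..<1}" p] p by (auto elim!: eventually_mono)
    ultimately show ?thesis
      by (rule isCont_transform_nhds)
  qed
  let ?F = "\<lambda>p. 1/5 * hyp_primitive (theta_modulus p)"
  have deriv: "(?F has_real_derivative 1/5 * ?h p) (at p)" if p: "0 < p" "p < 1" for p
    by (intro DERIV_cmult hyp_primitive_theta_deriv p)
  have cont_h: "isCont (\<lambda>p. 1/5 * ?h p) p" if p: "0 < p" "p < 1" for p
    using p isCont_euler[OF p] by (intro continuous_intros) auto
  \<comment> \<open>The integrand behaves like p^(-5/6) near 0. Its integrability there follows from
    nonnegativity and the finite limit of the primitive.\<close>
  have "(?F \<longlongrightarrow> 1/5 * 0) (at_right 0)"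
    by (intro tendsto_intros hyp_primitive_theta_at_right_0)
  then have lim0: "((?F \<circ> real_of_ereal) \<longlongrightarrow> 0) (at_right 0)"
    unfolding zero_ereal_def ereal_tendsto_simps by simp
  have "isCont ?F q" using DERIV_isCont[OF deriv[OF q]] .
  then have "(?F \<longlongrightarrow> ?F q) (at_left q)"
    unfolding isCont_def by (rule filterlim_mono) (auto intro: at_le)
  then have lim1: "((?F \<circ> real_of_ereal) \<longlongrightarrow> ?F q) (at_left (ereal q))"
    unfolding ereal_tendsto_simps .
  have FTC: "set_integrable lborel (einterval 0 (ereal q)) (\<lambda>p. 1/5 * ?h p)" "(LBINT p=0..ereal q. 1/5 * ?h p) = ?F q - 0"
    by (rule interval_integral_FTC_nonneg[where F = ?F, OF _ _ _ _ lim0 lim1];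
        use q deriv cont_h in \<open>auto simp: zero_ereal_def\<close>)+
  have mem: "p \<in> einterval 0 (ereal q) \<longleftrightarrow> 0 < p \<and> p < q" for p
    by (simp add: einterval_def zero_ereal_def)
  have eq: "?f (?R p) * ?g' p = 1/5 * ?h p" if "0 < p" "p < q" for p
    using R(3)[of p] that q by simp
  have int: "set_integrable lborel (einterval 0 (ereal q)) (\<lambda>p. ?f (?R p) * ?g' p)"
    by (rule set_integrable_cong[THEN iffD2, OF refl refl _ FTC(1)], rule eq) (simp_all only: mem)
  have A: "((ereal \<circ> ?R \<circ> real_of_ereal) \<longlongrightarrow> 0) (at_right 0)"
    using rogers_ramanujan_at_right_0 unfolding zero_ereal_def ereal_tendsto_simps .
  have "isCont ?R q" using DERIV_isCont[OF rogers_ramanujan_deriv(2)[OF q]] .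
  then have "(?R \<longlongrightarrow> ?R q) (at_left q)"
    unfolding isCont_def by (rule filterlim_mono) (auto intro: at_le)
  then have B: "((ereal \<circ> ?R \<circ> real_of_ereal) \<longlongrightarrow> ereal (?R q)) (at_left (ereal q))"
    unfolding ereal_tendsto_simps .
  have "(LBINT x=0..ereal (?R q). ?f x) = (LBINT p=0..ereal q. ?f (?R p) * ?g' p)"
  proof (rule interval_integral_substitution_nonneg(2)[OF _ _ _ _ _ _ A B int])
    show "0 < ereal q" using q by simp
    fix x :: real
    have g'_nonneg: "0 \<le> ?g' x"
    proof (cases "0 < x \<and> x < 1")
      case True
      then have "0 < x ^ 5" "x ^ 5 < 1" using power_in_unit[of x 5] by auto
      then show ?thesis
        using True R(1)[of x] euler_pos[of x] euler_pos[of "x ^ 5"] by simp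
    qed auto
    then show "0 \<le> ?g' x" .
    assume "0 < ereal x" "ereal x < ereal q"
    then have x: "0 < x" "x < 1" using q by (auto simp: zero_ereal_def)
    show "(?R has_real_derivative ?g' x) (at x)"
      using rogers_ramanujan_deriv(2)[OF x] x by simp
    show "isCont ?f (?R x)" by (rule cont_f[OF x])
    show "isCont ?g' x" by (rule cont_R'[OF x])
    show "0 \<le> ?f (?R x)" using R(1,2)[OF x] by simp
  qed
  also have "\<dots> = (LBINT p=0..ereal q. 1/5 * ?h p)"
  proof (rule interval_integral_cong)
    fix x :: real assume "x \<in> einterval (min 0 (ereal q)) (max 0 (ereal q))"
    moreover have "min 0 (ereal q) = 0" "max 0 (ereal q) = ereal q"
      using q by (simp_all add: min_def max_def zero_ereal_def)
    ultimately have "0 < x \<and> x < q" by (simp only: mem)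
    then show "?f (?R x) * ?g' x = 1/5 * ?h x" by (intro eq) auto
  qed
  also have "\<dots> = 1/5 * hyp_primitive (theta_modulus q)"
    unfolding FTC(2) by simp
  finally show ?thesis by simp
qed

theorem theorem3:
  fixes r q :: real
  assumes "r > 0" and "q = exp (- pi * sqrt r)"
  shows "of_real pi * (LBINT t=ereal (sqrt r)..\<infinity>. dedekind_eta (\<i> * of_real t / 2) ^ 4)
           = complex_of_real (3 * root 3 (2 * singular_modulus r) *
               hypergeometric_2F1 (1/3) (1/6) (7/6) ((singular_modulus r)\<^sup>2))
       \<and> 3 * root 3 (2 * singular_modulus r) *
             hypergeometric_2F1 (1/3) (1/6) (7/6) ((singular_modulus r)\<^sup>2)
           = 5 * (LBINT x=0..ereal (rogers_ramanujan q).
                    1 / (x * root 6 (1 / x ^ 5 - 11 - x ^ 5)))"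
proof -
  have "0 < q" "q < 1" using assms by auto
  from rr_integral[OF this] eta_integral[OF assms] show ?thesis
    unfolding singular_modulus_theta[OF assms] hyp_primitive_def[symmetric] by simp
qed

end
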